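(* For a latin square $L$ on $\{1,\dots,9\}$, let $\pi(L)$ be the number of sudoku tri-partitions with respect to which $L$ is a division sudoku. Among the $45$ main ds-classes of standard division sudokus of rank $3$, only $7$ classes consist of latin squares that are division sudokus with respect to more than one sudoku tri-partition, namely the main ds-classes of $DS(9,i)$ for $i\in\{2,17,18,20,27,175,179\}$, and $$\pi(DS(9,2))=2,\quad \pi(DS(9,17))=24,\quad \pi(DS(9,18))=4,\quad \pi(DS(9,20))=9,$$ $$\pi(DS(9,27))=2,\quad \pi(DS(9,175))=3,\quad \pi(DS(9,179))=4.$$
   Context: A latin square on a finite set $X$ is an array $L=(L(x,y))_{x,y\in X}$ with entries in $X$ such that every row and every column contains all symbols. Its orthogonal array is $O(L)=\{(x,y,L(x,y)):x,y\in X\}$. For $\theta\in\mathrm{Sym}(3)$, the conjugate $L^\theta$ is the latin square with orthogonal array $\{(x_{\theta(1)},x_{\theta(2)},x_{\theta(3)}):(x_1,x_2,x_3)\in O(L)\}$. Let $|X|=m^2$. A sudoku partition of $X$ is an (unordered) partition of $X$ into $m$ blocks of size $m$. A sudoku tri-partition is an ordered triple $(X^B,X^S,X^P)$ of sudoku partitions $X^B=\{X^B_1,\dots,X^B_m\}$, $X^S=\{X^S_1,\dots,X^S_m\}$, $X^P=\{X^P_1,\dots,X^P_m\}$ of $X$. Relative to it, the bands, stacks and piles of $L$ are $B_i=\{(x,y,z)\in O(L):x\in X^B_i\}$, $S_i=\{(x,y,z)\in O(L):y\in X^S_i\}$, $P_i=\{(x,y,z)\in O(L):z\in X^P_i\}$.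 $L$ is a division sudoku with respect to the sudoku tri-partition if for all $i,j$: every $z\in X$ occurs as a third coordinate in $B_i\cap S_j$, every $y\in X$ occurs as a second coordinate in $B_i\cap P_j$, and every $x\in X$ occurs as a first coordinate in $S_i\cap P_j$. A standard division sudoku of rank $3$ is a latin square on $\{1,\dots,9\}$ that is a division sudoku with respect to the tri-partition $(Y,Y,Y)$ with $Y=\{\{1,2,3\},\{4,5,6\},\{7,8,9\}\}$. Two standard division sudokus $L_1,L_2$ of rank $3$ are ds-isotopic if there are permutations $\alpha,\beta,\gamma$ of $\{1,\dots,9\}$, each mapping every block of $Y$ to a block of $Y$, with $L_2(\alpha(x),\beta(y))=\gamma(L_1(x,y))$ for all $x,y$. Main ds-classes are the equivalence classes of the relation "$L_1$ is ds-isotopic to a conjugate of $L_2$"; there are $45$ of them. The value $\pi$ is constant on main ds-classes. The squares named in the claim are (rows $1,\dots,9$ in order, each row written as a string of the entries in columns $1,\dots,9$): $DS(9,2)$: 147258369, 825936714, 693471582, 258147693, 936825147, 471693825, 369582471, 714369258, 582714936. $DS(9,17)$: 147258369, 825936714, 693471582, 258369147, 936714825, 471582693, 369147258, 714825936, 582693471. $DS(9,18)$: 147258369, 825936714, 693471582, 258369147, 936714825, 471582693, 369825471, 714693258, 582147936. $DS(9,20)$: 147258369, 825936714, 693471582, 258369147, 936714825, 471582693, 384627951, 519843276, 762195438. $DS(9,27)$: 147258369, 825936714, 693471582, 258714693, 936582147, 471369825, 384195276, 519627438, 762843951. $DS(9,175)$: 147259386, 825736419, 693481752, 259617834, 736842591,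 481395267, 374168925, 518924673, 962573148. $DS(9,179)$: 147259386, 825736419, 693481752, 268194573, 934527168, 571863924, 386915247, 419672835, 752348691. *)

theory Defs
  imports "HOL-Library.Disjoint_Sets" "HOL-Combinatorics.Permutations"
begin

text \<open>A square on \<open>X\<close> is a binary function of which only the values at arguments in \<open>X\<close> are
  relevant; every notion below depends on these values only.\<close>

definition latin_square :: "'a set \<Rightarrow> ('a \<Rightarrow> 'a \<Rightarrow> 'a) \<Rightarrow> bool" where
  "latin_square X L \<longleftrightarrow> finite X \<and> (\<forall>x\<in>X. \<forall>y\<in>X. L x y \<in> X) \<and>
     (\<forall>x\<in>X. \<forall>z\<in>X. \<exists>y\<in>X. L x y = z) \<and> (\<forall>y\<in>X. \<forall>z\<in>X. \<exists>x\<in>X. L x y = z)"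

definition orthogonal_array :: "'a set \<Rightarrow> ('a \<Rightarrow> 'a \<Rightarrow> 'a) \<Rightarrow> ('a \<times> 'a \<times> 'a) set" where
  "orthogonal_array X L = {(x, y, L x y) | x y. x \<in> X \<and> y \<in> X}"

fun coord :: "'a \<times> 'a \<times> 'a \<Rightarrow> nat \<Rightarrow> 'a" where
  "coord (a, b, c) i = (if i = 1 then a else if i = 2 then b else c)"

definition permute_triple :: "(nat \<Rightarrow> nat) \<Rightarrow> 'a \<times> 'a \<times> 'a \<Rightarrow> 'a \<times> 'a \<times> 'a" where
  "permute_triple \<theta> t = (coord t (\<theta> 1), coord t (\<theta> 2), coord t (\<theta> 3))"

text \<open>The square whose orthogonal array is the image of that of \<open>L\<close>, for \<open>\<theta>\<close> a permutation of
  \<open>{1..3}\<close>.\<close>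

definition conjugate :: "'a set \<Rightarrow> (nat \<Rightarrow> nat) \<Rightarrow> ('a \<Rightarrow> 'a \<Rightarrow> 'a) \<Rightarrow> 'a \<Rightarrow> 'a \<Rightarrow> 'a" where
  "conjugate X \<theta> L = (\<lambda>x y. THE z. (x, y, z) \<in> permute_triple \<theta> ` orthogonal_array X L)"

definition sudoku_partition :: "nat \<Rightarrow> 'a set \<Rightarrow> 'a set set \<Rightarrow> bool" where
  "sudoku_partition m X Q \<longleftrightarrow> finite X \<and> card X = m\<^sup>2 \<and>
     partition_on X Q \<and> card Q = m \<and> (\<forall>A\<in>Q. card A = m)"

type_synonym 'a tri_partition = "'a set set \<times> 'a set set \<times> 'a set set"

definition sudoku_tri_partition :: "nat \<Rightarrow> 'a set \<Rightarrow> 'a tri_partition \<Rightarrow> bool" where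
  "sudoku_tri_partition m X T \<longleftrightarrow> (case T of (XB, XS, XP) \<Rightarrow>
     sudoku_partition m X XB \<and> sudoku_partition m X XS \<and> sudoku_partition m X XP)"

definition band :: "'a set \<Rightarrow> ('a \<Rightarrow> 'a \<Rightarrow> 'a) \<Rightarrow> 'a set \<Rightarrow> ('a \<times> 'a \<times> 'a) set" where
  "band X L A = {(x, y, z) \<in> orthogonal_array X L. x \<in> A}"

definition stack :: "'a set \<Rightarrow> ('a \<Rightarrow> 'a \<Rightarrow> 'a) \<Rightarrow> 'a set \<Rightarrow> ('a \<times> 'a \<times> 'a) set" where
  "stack X L A = {(x, y, z) \<in> orthogonal_array X L. y \<in> A}"

definition pile :: "'a set \<Rightarrow> ('a \<Rightarrow> 'a \<Rightarrow> 'a) \<Rightarrow> 'a set \<Rightarrow> ('a \<times> 'a \<times> 'a) set" where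
  "pile X L A = {(x, y, z) \<in> orthogonal_array X L. z \<in> A}"

definition division_sudoku ::
  "nat \<Rightarrow> 'a set \<Rightarrow> 'a tri_partition \<Rightarrow> ('a \<Rightarrow> 'a \<Rightarrow> 'a) \<Rightarrow> bool" where
  "division_sudoku m X T L \<longleftrightarrow> latin_square X L \<and> sudoku_tri_partition m X T \<and>
     (case T of (XB, XS, XP) \<Rightarrow>
       (\<forall>A\<in>XB. \<forall>C\<in>XS. \<forall>z\<in>X. \<exists>x y. (x, y, z) \<in> band X L A \<inter> stack X L C) \<and>
       (\<forall>A\<in>XB. \<forall>C\<in>XP. \<forall>y\<in>X. \<exists>x z. (x, y, z) \<in> band X L A \<inter> pile X L C) \<and>
       (\<forall>A\<in>XS. \<forall>C\<in>XP. \<forall>x\<in>X. \<exists>y z. (x, y, z) \<in> stack X L A \<inter> pile X L C))"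

definition tri_partition_count :: "(nat \<Rightarrow> nat \<Rightarrow> nat) \<Rightarrow> nat" where
  "tri_partition_count L =
     card {T. sudoku_tri_partition 3 {1..9} T \<and> division_sudoku 3 {1..9} T L}"

definition standard_partition :: "nat set set" where
  "standard_partition = {{1,2,3}, {4,5,6}, {7,8,9}}"

definition standard_division_sudoku :: "(nat \<Rightarrow> nat \<Rightarrow> nat) \<Rightarrow> bool" where
  "standard_division_sudoku L \<longleftrightarrow>
     division_sudoku 3 {1..9} (standard_partition, standard_partition, standard_partition) L"

definition block_permutation :: "(nat \<Rightarrow> nat) \<Rightarrow> bool" where
  "block_permutation \<alpha> \<longleftrightarrow> \<alpha> permutes {1..9} \<and> (\<forall>A\<in>standard_partition. \<alpha> ` A \<in> standard_partition)"

definition ds_isotopic :: "(nat \<Rightarrow> nat \<Rightarrow> nat) \<Rightarrow> (nat \<Rightarrow> nat \<Rightarrow> nat) \<Rightarrow> bool" where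
  "ds_isotopic L1 L2 \<longleftrightarrow> (\<exists>\<alpha> \<beta> \<gamma>. block_permutation \<alpha> \<and> block_permutation \<beta> \<and> block_permutation \<gamma> \<and>
     (\<forall>x\<in>{1..9}. \<forall>y\<in>{1..9}. L2 (\<alpha> x) (\<beta> y) = \<gamma> (L1 x y)))"

definition main_ds_rel :: "((nat \<Rightarrow> nat \<Rightarrow> nat) \<times> (nat \<Rightarrow> nat \<Rightarrow> nat)) set" where
  "main_ds_rel = {(L1, L2). standard_division_sudoku L1 \<and> standard_division_sudoku L2 \<and>
     (\<exists>\<theta>. \<theta> permutes {1..3} \<and> ds_isotopic L1 (conjugate {1..9} \<theta> L2))}"

text \<open>Functions that differ only at arguments outside \<open>{1..9}\<close> are related by \<open>main_ds_rel\<close>, so the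
  classes correspond bijectively to classes of arrays.\<close>

definition main_ds_classes :: "(nat \<Rightarrow> nat \<Rightarrow> nat) set set" where
  "main_ds_classes = Collect standard_division_sudoku // main_ds_rel"

definition main_ds_class :: "(nat \<Rightarrow> nat \<Rightarrow> nat) \<Rightarrow> (nat \<Rightarrow> nat \<Rightarrow> nat) set" where
  "main_ds_class L = main_ds_rel `` {L}"

text \<open>Rows and columns are numbered from 1.\<close>

definition square_of_rows :: "nat list list \<Rightarrow> nat \<Rightarrow> nat \<Rightarrow> nat" where
  "square_of_rows rows x y = rows ! (x - 1) ! (y - 1)"

definition DS9_2 :: "nat \<Rightarrow> nat \<Rightarrow> nat" where
  "DS9_2 = square_of_rows
    [[1,4,7,2,5,8,3,6,9],
     [8,2,5,9,3,6,7,1,4],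
     [6,9,3,4,7,1,5,8,2],
     [2,5,8,1,4,7,6,9,3],
     [9,3,6,8,2,5,1,4,7],
     [4,7,1,6,9,3,8,2,5],
     [3,6,9,5,8,2,4,7,1],
     [7,1,4,3,6,9,2,5,8],
     [5,8,2,7,1,4,9,3,6]]"

definition DS9_17 :: "nat \<Rightarrow> nat \<Rightarrow> nat" where
  "DS9_17 = square_of_rows
    [[1,4,7,2,5,8,3,6,9],
     [8,2,5,9,3,6,7,1,4],
     [6,9,3,4,7,1,5,8,2],
     [2,5,8,3,6,9,1,4,7],
     [9,3,6,7,1,4,8,2,5],
     [4,7,1,5,8,2,6,9,3],
     [3,6,9,1,4,7,2,5,8],
     [7,1,4,8,2,5,9,3,6],
     [5,8,2,6,9,3,4,7,1]]"

definition DS9_18 :: "nat \<Rightarrow> nat \<Rightarrow> nat" where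
  "DS9_18 = square_of_rows
    [[1,4,7,2,5,8,3,6,9],
     [8,2,5,9,3,6,7,1,4],
     [6,9,3,4,7,1,5,8,2],
     [2,5,8,3,6,9,1,4,7],
     [9,3,6,7,1,4,8,2,5],
     [4,7,1,5,8,2,6,9,3],
     [3,6,9,8,2,5,4,7,1],
     [7,1,4,6,9,3,2,5,8],
     [5,8,2,1,4,7,9,3,6]]"

definition DS9_20 :: "nat \<Rightarrow> nat \<Rightarrow> nat" where
  "DS9_20 = square_of_rows
    [[1,4,7,2,5,8,3,6,9],
     [8,2,5,9,3,6,7,1,4],
     [6,9,3,4,7,1,5,8,2],
     [2,5,8,3,6,9,1,4,7],
     [9,3,6,7,1,4,8,2,5],
     [4,7,1,5,8,2,6,9,3],
     [3,8,4,6,2,7,9,5,1],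
     [5,1,9,8,4,3,2,7,6],
     [7,6,2,1,9,5,4,3,8]]"

definition DS9_27 :: "nat \<Rightarrow> nat \<Rightarrow> nat" where
  "DS9_27 = square_of_rows
    [[1,4,7,2,5,8,3,6,9],
     [8,2,5,9,3,6,7,1,4],
     [6,9,3,4,7,1,5,8,2],
     [2,5,8,7,1,4,6,9,3],
     [9,3,6,5,8,2,1,4,7],
     [4,7,1,3,6,9,8,2,5],
     [3,8,4,1,9,5,2,7,6],
     [5,1,9,6,2,7,4,3,8],
     [7,6,2,8,4,3,9,5,1]]"

definition DS9_175 :: "nat \<Rightarrow> nat \<Rightarrow> nat" where
  "DS9_175 = square_of_rows
    [[1,4,7,2,5,9,3,8,6],
     [8,2,5,7,3,6,4,1,9],
     [6,9,3,4,8,1,7,5,2],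
     [2,5,9,6,1,7,8,3,4],
     [7,3,6,8,4,2,5,9,1],
     [4,8,1,3,9,5,2,6,7],
     [3,7,4,1,6,8,9,2,5],
     [5,1,8,9,2,4,6,7,3],
     [9,6,2,5,7,3,1,4,8]]"

definition DS9_179 :: "nat \<Rightarrow> nat \<Rightarrow> nat" where
  "DS9_179 = square_of_rows
    [[1,4,7,2,5,9,3,8,6],
     [8,2,5,7,3,6,4,1,9],
     [6,9,3,4,8,1,7,5,2],
     [2,6,8,1,9,4,5,7,3],
     [9,3,4,5,2,7,1,6,8],
     [5,7,1,8,6,3,9,2,4],
     [3,8,6,9,1,5,2,4,7],
     [4,1,9,6,7,2,8,3,5],
     [7,5,2,3,4,8,6,9,1]]"

end

theory Submission
  imports Defs
begin

text \<open>
  Write the point \<open>3 * i + a + 1\<close> of \<open>{1..9}\<close> as \<open>(i, a)\<close> with \<open>i\<close>, \<open>a\<close> in the field of three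
  elements, so that \<open>i\<close> numbers the blocks of the standard partition and \<open>a\<close> is an inner coordinate.
  A square becomes a set of triples of points (row, column, symbol), and the main ds-classes become the
  orbits under permutations of the three coordinates and block-preserving permutations in each of
  them (\<open>main_ds_rel_iff\<close>).

  In a standard division sudoku exactly three triples lie over any choice of a block of rows, a block
  of columns and a block of symbols, and they match the elements of these blocks bijectively.
  A bijection between sets of three elements is affine. If only the third block varies, the bijections
  between the other two are disjoint, so they have the same slope and their constant terms exhaust the
  field. Reversing some blocks makes all slopes \<open>1\<close>, and the constant terms then have the form
  \<open>F c i j + E c i j * k\<close>, where \<open>i\<close>, \<open>j\<close> are the blocks in coordinates \<open>c\<close>, \<open>c + 1\<close>, and \<open>k\<close> is the
  third block (\<open>ds_rel_signature\<close>). The 27 signs \<open>E\<close>, the signature, determine the square up to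
  translations of the blocks (\<open>signature_determines\<close>). A family of signs occurs if and only if its mixed
  third difference vanishes (\<open>signature_balanced\<close>, \<open>presents_model\<close>), and equivalence of squares amounts
  to an explicit action on signatures of permutations of the coordinates, permutations of the blocks and
  a global sign (\<open>signature_act\<close>, \<open>equiv_signature_act\<close>).

  It remains to find the orbits of a finite group on the balanced signatures. The list \<open>reps\<close> contains
  45 of them. No element of the group makes any of these lexicographically smaller, so they lie in
  different orbits (\<open>rep_not_improved\<close>, \<open>rep_unique\<close>). Every other balanced signature is made smaller by
  one of a few moves, so repeated moves lead into the list (\<open>settled_balanced\<close>, \<open>signature_rep\<close>).

  The number \<open>\<pi>\<close> of tri-partitions is invariant under equivalence
  (\<open>card_tri_partition_rel_equiv\<close>). For each of the 45 representatives it is found by choosing blocks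
  of rows, columns and symbols one after the other, discarding a block as soon as it violates a condition
  with one chosen before (\<open>card_tri_partitions\<close>). The seven named squares are located in the list
  through explicit translations of blocks and moves (\<open>identified_class\<close>).
\<close>

section \<open>The field of three elements\<close>

datatype z3 = Z0 | Z1 | Z2
instantiation z3 :: field
begin
definition "0 = Z0"
definition "1 = Z1"
fun plus_z3 where
"Z0 + y = y" | "Z1 + Z0 = Z1" | "Z1 + Z1 = Z2" | "Z1 + Z2 = Z0" | "Z2 + Z0 = Z2"| "Z2 + Z1 = Z0"| "Z2 + Z2 = Z1"
fun uminus_z3 where "- Z0 = Z0" | "- Z1 = Z2" | "- Z2 = Z1"
definition "x - y = x + - (y::z3)"
fun times_z3 where "Z0 * y = Z0" | "Z1 * y = y" | "Z2 * y = - (y::z3)"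
definition "inverse x = (x::z3)"
definition "x div y = x * (y::z3)"
instance
proof
  fix a b c :: z3
  show "a + b + c = a + (b + c)" by (cases a; cases b; cases c; simp)
  show "a + b = b + a" by (cases a; cases b; simp)
  show "0 + a = a" by (simp add: zero_z3_def)
  show "- a + a = 0" by (cases a; simp add: zero_z3_def)
  show "a - b = a + - b" by (simp add: minus_z3_def)
  show "a * b * c = a * (b * c)" by (cases a; cases b; cases c; simp)
  show "a * b = b * a" by (cases a; cases b; simp)
  show "1 * a = a" by (simp add: one_z3_def)
  show "(a + b) * c = a * c + b * c" by (cases a; cases b; cases c; simp)
  show "(0::z3) \<noteq> 1" by (simp add: zero_z3_def one_z3_def)
  show "a \<noteq> 0 \<Longrightarrow> inverse a * a = 1" by (cases a; simp add: zero_z3_def one_z3_def inverse_z3_def)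
  show "a div b = a * inverse b" by (simp add: divide_z3_def inverse_z3_def)
  show "inverse (0::z3) = 0" by (simp add: inverse_z3_def)
qed
end

lemmas z3_const = zero_z3_def one_z3_def minus_z3_def

lemma z3_exhaust: "x = 0 \<or> x = 1 \<or> x = (-1::z3)"
  by (cases x) (simp_all add: z3_const)

lemma UNIV_z3: "UNIV = {0, 1, -1::z3}"
  using z3_exhaust by auto

lemma z3_distinct [simp]: "(1::z3) \<noteq> -1" "(-1::z3) \<noteq> 1"
  by (simp_all add: z3_const)

instance z3 :: finite
  by standard (simp add: UNIV_z3)

lemma card_z3: "card (UNIV :: z3 set) = 3"
  by (simp add: UNIV_z3)

lemma z3_all: "(\<forall>x. P x) \<longleftrightarrow> P 0 \<and> P 1 \<and> P (-1::z3)"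
  by (metis z3_exhaust)

lemma z3_rotate [simp]: "c + 1 + 1 = c - (1::z3)" "c - 1 - 1 = c + (1::z3)" "(1::z3) + 1 = -1" "- (1::z3) - 1 = 1"
  by (cases c; simp add: z3_const)+

lemma z3_two [simp]: "(2::z3) = -1"
  using z3_rotate(3) by simp

lemma unit_sq [simp]: "u \<noteq> 0 \<Longrightarrow> u * u = (1::z3)" "u \<noteq> 0 \<Longrightarrow> u * (u * x) = (x::z3)"
  by (cases u; cases x; simp add: z3_const)+

lemma unit_product_cancel:
  "x \<noteq> 0 \<Longrightarrow> y \<noteq> 0 \<Longrightarrow> z \<noteq> 0 \<Longrightarrow> x * y * z = 1 \<Longrightarrow> x = y * (z::z3)"
  by (cases x; cases y; cases z; simp add: z3_const)

lemma z3_neq_iff: "c \<noteq> (c'::z3) \<longleftrightarrow> c' = c + 1 \<or> c' = c - 1"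
  by (cases c; cases c'; simp add: z3_const)

lemma succ_neq [simp]: "c + 1 \<noteq> (c::z3)" "c \<noteq> c + (1::z3)" "c \<noteq> c - (1::z3)" "c - 1 \<noteq> (c::z3)" "c + 1 \<noteq> c - (1::z3)" "c - 1 \<noteq> c + (1::z3)"
  by (cases c; simp add: z3_const)+

text \<open>Affine maps of a field with three elements are all six permutations of it. This is what turns
  the combinatorics of bijections between blocks into linear algebra.\<close>
lemma inj_z3_affine:
  fixes f :: "z3 \<Rightarrow> z3"
  assumes "inj f"
  shows "f 1 - f 0 \<noteq> 0" and "f x = (f 1 - f 0) * x + f 0"
proof -
  have d: "f 0 \<noteq> f 1" "f 0 \<noteq> f (-1)" "f 1 \<noteq> f (-1)"
    using assms by (simp_all add: inj_eq)
  then show "f 1 - f 0 \<noteq> 0" by simp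
  \<comment> \<open>The three values are distinct, and the elements of the field sum to zero.\<close>
  have "f 0 + f 1 + f (-1) = 0"
    using d by (cases "f 0"; cases "f 1"; cases "f (-1)") (simp_all add: z3_const)
  then have e: "f (-1) = - f 0 - f 1" by (simp add: algebra_simps eq_neg_iff_add_eq_0)
  have t: "a + a + a = 0" for a :: z3 by (cases a) (simp_all add: z3_const)
  have "f 0 + f 0 + f 0 = 0" by (rule t)
  then have "- f 0 = f 0 + f 0" by (simp add: algebra_simps neg_eq_iff_add_eq_0)
  then have "f (-1) = f 0 + f 0 - f 1" using e by simp
  with z3_exhaust [of x] show "f x = (f 1 - f 0) * x + f 0"
    by (auto simp: algebra_simps)
qed

lemma bij_affine: "m \<noteq> 0 \<Longrightarrow> bij (\<lambda>x. m * x + n :: z3)"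
proof -
  assume "m \<noteq> 0"
  then have "inj (\<lambda>x. m * x + n)" by (auto intro: injI)
  then show ?thesis by (simp add: finite_UNIV_inj_surj bij_def)
qed

section \<open>Division sudokus as sets of triples of points\<close>
type_synonym pt = "z3 \<times> z3"
type_synonym config = "z3 \<Rightarrow> pt"
type_synonym coeffs = "z3 \<Rightarrow> z3 \<Rightarrow> z3 \<Rightarrow> z3"

text \<open>The coordinates row, column, symbol are numbered \<open>0\<close>, \<open>1\<close>, \<open>-1\<close>, so that passing from
  \<open>c\<close> to \<open>c + 1\<close> runs through them cyclically and every notion below is visibly invariant under
  conjugation.\<close>
definition latin_rel :: "config set \<Rightarrow> bool" where
  "latin_rel R \<longleftrightarrow> (\<forall>c p q. \<exists>!v. v \<in> R \<and> v c = p \<and> v (c + 1) = q)"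

text \<open>The coordinate that is left over when \<open>c\<close> and \<open>c + 1\<close> are used is \<open>c - 1\<close>; letting \<open>c\<close> run
  through the three coordinates gives the band-stack, stack-pile and pile-band conditions at once.\<close>
definition divides :: "config set \<Rightarrow> (z3 \<Rightarrow> pt set set) \<Rightarrow> bool" where
  "divides R Q \<longleftrightarrow>
     (\<forall>c. \<forall>A\<in>Q c. \<forall>C\<in>Q (c + 1). \<forall>p. \<exists>v\<in>R. v c \<in> A \<and> v (c + 1) \<in> C \<and> v (c - 1) = p)"

definition fibres :: "pt set set" where
  "fibres = range (\<lambda>i. {i} \<times> UNIV)"

definition ds_rel :: "config set \<Rightarrow> bool" where
  "ds_rel R \<longleftrightarrow> latin_rel R \<and> divides R (\<lambda>_. fibres)"

definition block_map :: "(pt \<Rightarrow> pt) \<Rightarrow> bool" where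
  "block_map \<psi> \<longleftrightarrow> bij \<psi> \<and> (\<exists>\<pi>. \<forall>x. fst (\<psi> x) = \<pi> (fst x))"

text \<open>The permutation \<open>\<theta>\<close> accounts for the conjugation, \<open>\<psi> 0\<close>, \<open>\<psi> 1\<close> and \<open>\<psi> (-1)\<close> for the ds-isotopy.\<close>
definition ds_equiv :: "config set \<Rightarrow> config set \<Rightarrow> bool" where
  "ds_equiv R R' \<longleftrightarrow> (\<exists>\<theta> \<psi>. bij \<theta> \<and> (\<forall>c. block_map (\<psi> c)) \<and>
     (\<forall>v. v \<in> R \<longleftrightarrow> (\<lambda>c. \<psi> c (v (\<theta> c))) \<in> R'))"

lemma latin_rel_unique:
  assumes "latin_rel R" "v \<in> R" "w \<in> R" "v c = w c" "v (c + 1) = w (c + 1)"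
  shows "v = w"
proof -
  have "\<exists>!u. u \<in> R \<and> u c = v c \<and> u (c + 1) = v (c + 1)"
    using assms(1) unfolding latin_rel_def by blast
  with assms(2-) show ?thesis by auto
qed

text \<open>A block-preserving permutation is affine on the blocks and affine within each block.\<close>
lemma block_map_affine:
  assumes "block_map \<psi>"
  obtains m n V W where "m \<noteq> 0" "\<And>i. V i \<noteq> 0" "\<And>i a. \<psi> (i, a) = (m * i + n, V i * a + W i)"
proof -
  from assms obtain \<pi> where b: "bij \<psi>" and p: "\<And>x. fst (\<psi> x) = \<pi> (fst x)"
    by (auto simp: block_map_def)
  have "surj \<pi>"
  proof (rule surjI)
    fix y :: z3
    show "\<pi> (fst (inv \<psi> (y, 0))) = y"
      using p [of "inv \<psi> (y, 0)"] bij_is_surj [OF b] by (simp add: surj_f_inv_f)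
  qed
  then have ip: "inj \<pi>" by (simp add: finite_UNIV_surj_inj)
  have iq: "inj (\<lambda>a. snd (\<psi> (i, a)))" for i
  proof (rule injI)
    fix a a' assume "snd (\<psi> (i, a)) = snd (\<psi> (i, a'))"
    then have "\<psi> (i, a) = \<psi> (i, a')" by (simp add: prod_eq_iff p)
    then show "a = a'" using b by (simp add: bij_def inj_eq)
  qed
  show thesis
  proof (rule that)
    show "\<pi> 1 - \<pi> 0 \<noteq> 0" by (rule inj_z3_affine [OF ip])
    show "snd (\<psi> (i, 1)) - snd (\<psi> (i, 0)) \<noteq> 0" for i by (rule inj_z3_affine(1) [OF iq])
    show "\<psi> (i, a) = ((\<pi> 1 - \<pi> 0) * i + \<pi> 0, (snd (\<psi> (i, 1)) - snd (\<psi> (i, 0))) * a + snd (\<psi> (i, 0)))" for i a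
      using inj_z3_affine(2) [OF ip, of i] inj_z3_affine(2) [OF iq, of i a] p [of "(i, a)"]
      by (simp add: prod_eq_iff)
  qed
qed

lemma affine_block_map:
  assumes "m \<noteq> 0" "\<And>i. V i \<noteq> 0"
  shows "block_map (\<lambda>(i, a). (m * i + n, V i * a + W i))"
proof -
  have "inj (\<lambda>(i, a). (m * i + n, V i * a + W i))"
    using assms by (auto intro!: injI)
  then show ?thesis
    by (auto simp: block_map_def bij_def finite_UNIV_inj_surj intro!: exI [of _ "\<lambda>i. m * i + n"])
qed

lemma block_map_comp:
  assumes "block_map f" "block_map g" shows "block_map (f \<circ> g)"
proof -
  from assms obtain \<pi> \<pi>' where "bij f" "bij g" "\<And>x. fst (f x) = \<pi> (fst x)" "\<And>x. fst (g x) = \<pi>' (fst x)"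
    unfolding block_map_def by blast
  then have "bij (f \<circ> g)" "\<And>x. fst ((f \<circ> g) x) = (\<pi> \<circ> \<pi>') (fst x)"
    by (simp_all add: bij_comp)
  then show ?thesis unfolding block_map_def by blast
qed

lemma block_map_inv:
  assumes "block_map f" shows "block_map (inv f)"
proof -
  obtain m n V W where a: "m \<noteq> 0" "\<And>i. V i \<noteq> 0" "\<And>i a. f (i, a) = (m * i + n, V i * a + W i)"
    by (rule block_map_affine [OF assms], rule that)
  have b: "bij f" using assms by (simp add: block_map_def)
  have "fst (inv f x) = m * (fst x - n)" for x
  proof -
    have "x = f (inv f x)" using b by (simp add: bij_def surj_f_inv_f)
    also have "\<dots> = f (fst (inv f x), snd (inv f x))" by simp
    finally have "fst x = m * fst (inv f x) + n" unfolding a(3) by (metis fst_conv)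
    then show ?thesis using a(1) by simp
  qed
  then show ?thesis using b
    by (auto simp: block_map_def bij_imp_bij_inv)
qed

lemma ds_equiv_refl: "ds_equiv R R"
  unfolding ds_equiv_def
  by (intro exI [of _ id] exI [of _ "\<lambda>_. id"]) (auto simp: block_map_def)

lemma ds_equiv_sym:
  assumes "ds_equiv R S" shows "ds_equiv S R"
proof -
  from assms obtain \<theta> \<psi> where a: "bij \<theta>" "\<And>c. block_map (\<psi> c)"
      "\<And>v. v \<in> R \<longleftrightarrow> (\<lambda>c. \<psi> c (v (\<theta> c))) \<in> S"
    unfolding ds_equiv_def by blast
  have b: "\<psi> c (inv (\<psi> c) x) = x" for c x
    using a(2) [of c] by (simp add: block_map_def bij_def surj_f_inv_f)
  have t: "inv \<theta> (\<theta> c) = c" for c using a(1) by (simp add: bij_def)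
  show ?thesis
    unfolding ds_equiv_def
  proof (intro exI conjI allI)
    show "bij (inv \<theta>)" using a(1) by (rule bij_imp_bij_inv)
    show "block_map (inv (\<psi> (inv \<theta> c)))" for c using a(2) by (rule block_map_inv)
    show "v \<in> S \<longleftrightarrow> (\<lambda>c. inv (\<psi> (inv \<theta> c)) (v (inv \<theta> c))) \<in> R" for v
      unfolding a(3) by (simp add: t b)
  qed
qed

lemma ds_equiv_trans:
  assumes "ds_equiv R S" "ds_equiv S T" shows "ds_equiv R T"
proof -
  from assms(1) obtain \<theta> \<psi> where a: "bij \<theta>" "\<And>c. block_map (\<psi> c)"
      "\<And>v. v \<in> R \<longleftrightarrow> (\<lambda>c. \<psi> c (v (\<theta> c))) \<in> S"
    unfolding ds_equiv_def by blast
  from assms(2) obtain \<theta>' \<psi>' where b: "bij \<theta>'" "\<And>c. block_map (\<psi>' c)"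
      "\<And>v. v \<in> S \<longleftrightarrow> (\<lambda>c. \<psi>' c (v (\<theta>' c))) \<in> T"
    unfolding ds_equiv_def by blast
  show ?thesis
    unfolding ds_equiv_def
  proof (intro exI conjI allI)
    show "bij (\<theta> \<circ> \<theta>')" using b(1) a(1) by (rule bij_comp)
    show "block_map (\<psi>' c \<circ> \<psi> (\<theta>' c))" for c using a(2) b(2) by (simp add: block_map_comp)
    show "v \<in> R \<longleftrightarrow> (\<lambda>c. (\<psi>' c \<circ> \<psi> (\<theta>' c)) (v ((\<theta> \<circ> \<theta>') c))) \<in> T" for v
      unfolding a(3) b(3) by simp
  qed
qed

section \<open>Affine coordinates and signatures\<close>

text \<open>Over a choice \<open>I\<close> of one block per coordinate, \<open>shift F E c I\<close> is the amount by which the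
  suitably scaled inner coordinate grows from coordinate \<open>c\<close> to \<open>c + 1\<close>. As a function of the
  remaining block \<open>I (c - 1)\<close> it is a permutation of the field, hence affine, and \<open>E\<close> collects the
  slopes.\<close>
definition shift :: "coeffs \<Rightarrow> coeffs \<Rightarrow> z3 \<Rightarrow> (z3 \<Rightarrow> z3) \<Rightarrow> z3" where
  "shift F E c I = F c (I c) (I (c + 1)) + E c (I c) (I (c + 1)) * I (c - 1)"

text \<open>The units \<open>U c i\<close> reverse some blocks, which makes all relations between inner coordinates
  translations.\<close>
definition affine_rel :: "(z3 \<Rightarrow> z3 \<Rightarrow> z3) \<Rightarrow> coeffs \<Rightarrow> coeffs \<Rightarrow> config set" where
  "affine_rel U F E = {v. \<forall>c. U (c + 1) (fst (v (c + 1))) * snd (v (c + 1)) - U c (fst (v c)) * snd (v c)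
     = shift F E c (fst \<circ> v)}"

text \<open>The three shifts must cancel because going once around the coordinates returns to the same
  point.\<close>
definition presents :: "(z3 \<Rightarrow> z3 \<Rightarrow> z3) \<Rightarrow> coeffs \<Rightarrow> coeffs \<Rightarrow> config set \<Rightarrow> bool" where
  "presents U F E R \<longleftrightarrow> (\<forall>c i. U c i \<noteq> 0) \<and> (\<forall>c i j. E c i j \<noteq> 0) \<and>
     (\<forall>I. (\<Sum>c\<in>UNIV. shift F E c I) = 0) \<and> R = affine_rel U F E"

definition signature :: "config set \<Rightarrow> coeffs \<Rightarrow> bool" where
  "signature R E \<longleftrightarrow> (\<exists>U F. presents U F E R)"

lemma sum_z3: "(\<Sum>c\<in>UNIV. f c) = f c + f (c + 1) + f (c - (1::z3))" for f :: "z3 \<Rightarrow> 'a::comm_monoid_add"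
proof -
  have "UNIV = {c, c + 1, c - 1}" by (cases c) (auto simp: z3_const UNIV_z3)
  then have "(\<Sum>c\<in>UNIV. f c) = (\<Sum>c\<in>{c, c + 1, c - 1}. f c)" by simp
  also have "\<dots> = f c + f (c + 1) + f (c - 1)" by (simp add: add.assoc)
  finally show ?thesis .
qed

lemma telescope3:
  fixes x y z :: "'a::ab_group_add"
  assumes "y - x = a" "z - y = b" "a + b + c = 0" shows "x - z = c"
proof -
  have "c = - (a + b)" using assms(3) by (simp add: add_eq_0_iff)
  then show ?thesis by (simp flip: assms(1,2))
qed

lemma vec3: "\<exists>I :: z3 \<Rightarrow> 'a. I c = i \<and> I (c + 1) = j \<and> I (c - 1) = k"
  by (rule exI [of _ "\<lambda>d. if d = c then i else if d = c + 1 then j else k"]) simp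

lemma ext3: "v = w" if "v c = w c" "v (c + 1) = w (c + 1)" "v (c - 1) = w (c - (1::z3))"
proof
  fix d show "v d = w d" using z3_neq_iff [of c d] that by auto
qed

lemma presents_sum:
  assumes "presents U F E R" "I c = i" "I (c + 1) = j" "I (c - 1) = k"
  shows "F c i j + E c i j * k + (F (c + 1) j k + E (c + 1) j k * i) + (F (c - 1) k i + E (c - 1) k i * j) = 0"
proof -
  have "(\<Sum>c\<in>UNIV. shift F E c I) = 0" using assms(1) by (simp add: presents_def)
  then show ?thesis using assms(2-) by (simp add: sum_z3 [of _ c] shift_def)
qed

text \<open>Since the shifts cancel, any two of the three equations of \<open>affine_rel\<close> imply the third.\<close>
lemma affine_rel_two:
  assumes p: "presents U F E R"
    and e: "\<And>d. d = c \<or> d = c + 1 \<Longrightarrow> U (d + 1) (fst (v (d + 1))) * snd (v (d + 1)) - U d (fst (v d)) * snd (v d)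
     = shift F E d (fst \<circ> v)"
  shows "v \<in> R"
proof -
  have s: "shift F E c (fst \<circ> v) + shift F E (c+1) (fst \<circ> v) + shift F E (c-1) (fst \<circ> v) = 0"
    using p by (simp add: presents_def sum_z3 [of _ c])
  have R: "R = affine_rel U F E" using p by (simp add: presents_def)
  have "U (d + 1) (fst (v (d + 1))) * snd (v (d + 1)) - U d (fst (v d)) * snd (v d) = shift F E d (fst \<circ> v)" for d
  proof (cases "d = c \<or> d = c + 1")
    case True then show ?thesis by (rule e)
  next
    case False
    then have "d = c - 1" using z3_neq_iff [of c d] by auto
    then show ?thesis using telescope3 [OF e [of c] e [of "c + 1", unfolded z3_rotate] s] by simp
  qed
  then show ?thesis by (simp add: R affine_rel_def)
qed

lemma presents_block_value:
  assumes p: "presents U F E R"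
  shows "\<exists>v\<in>R. fst \<circ> v = I \<and> snd (v c) = x"
proof -
  have u: "\<And>c i. U c i \<noteq> 0" using p by (simp add: presents_def)
  define y where "y = U (c + 1) (I (c + 1)) * (U c (I c) * x + shift F E c I)"
  define z where "z = U (c - 1) (I (c - 1)) * (U c (I c) * x + shift F E c I + shift F E (c + 1) I)"
  obtain v where v: "v c = (I c, x)" "v (c + 1) = (I (c + 1), y)" "v (c - 1) = (I (c - 1), z)"
    using vec3 [of c "(I c, x)" "(I (c + 1), y)" "(I (c - 1), z)"] by blast
  have f: "fst \<circ> v = I" by (rule ext3 [of _ c]) (simp_all add: v)
  have "v \<in> R"
  proof (rule affine_rel_two [OF p])
    fix d assume "d = c \<or> d = c + 1"
    then show "U (d + 1) (fst (v (d + 1))) * snd (v (d + 1)) - U d (fst (v d)) * snd (v d) = shift F E d (fst \<circ> v)"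
      unfolding f by (auto simp: v y_def z_def u)
  qed
  then show ?thesis using f v by (intro bexI [of _ v]) simp_all
qed

text \<open>Two points determine the third: the equation between them is affine in the remaining block with
  slope \<open>E\<close>, which fixes that block, and a second equation then fixes the inner coordinate.\<close>
lemma presents_latin:
  assumes p: "presents U F E R"
  shows "latin_rel R"
  unfolding latin_rel_def
proof (intro allI)
  fix c and a b :: pt
  have u: "\<And>c i. U c i \<noteq> 0" and e: "\<And>c i j. E c i j \<noteq> 0" and R: "R = affine_rel U F E"
    using p by (simp_all add: presents_def)
  define k where "k = E c (fst a) (fst b) * (U (c + 1) (fst b) * snd b - U c (fst a) * snd a - F c (fst a) (fst b))"
  show "\<exists>!v. v \<in> R \<and> v c = a \<and> v (c + 1) = b"
  proof (rule ex_ex1I)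
    obtain I where I: "I c = fst a" "I (c + 1) = fst b" "I (c - 1) = k" using vec3 [of c "fst a" "fst b" k] by blast
    obtain v where v: "v \<in> R" "fst \<circ> v = I" "snd (v c) = snd a"
      using presents_block_value [OF p, of I c "snd a"] by blast
    have f: "fst (v d) = I d" for d using v(2) by auto
    have "U (c + 1) (fst b) * snd (v (c + 1)) - U c (fst a) * snd a = F c (fst a) (fst b) + E c (fst a) (fst b) * k"
    proof -
      have "U (c + 1) (fst (v (c + 1))) * snd (v (c + 1)) - U c (fst (v c)) * snd (v c) = shift F E c (fst \<circ> v)"
        using v(1) unfolding R affine_rel_def by blast
      then show ?thesis unfolding v(2,3) f shift_def I .
    qed
    then have "U (c + 1) (fst b) * snd (v (c + 1)) = U (c + 1) (fst b) * snd b"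
      by (simp add: k_def e)
    then have "snd (v (c + 1)) = snd b" using u by simp
    then have "v \<in> R \<and> v c = a \<and> v (c + 1) = b" using v(1,3) f I by (simp add: prod_eq_iff)
    then show "\<exists>v. v \<in> R \<and> v c = a \<and> v (c + 1) = b" by blast
  next
    fix v w assume v: "v \<in> R \<and> v c = a \<and> v (c + 1) = b" and w: "w \<in> R \<and> w c = a \<and> w (c + 1) = b"
    have k: "E c (fst a) (fst b) * fst (x (c - 1)) = U (c + 1) (fst b) * snd b - U c (fst a) * snd a - F c (fst a) (fst b)"
      if "x \<in> R \<and> x c = a \<and> x (c + 1) = b" for x
    proof -
      have "U (c + 1) (fst (x (c + 1))) * snd (x (c + 1)) - U c (fst (x c)) * snd (x c) = shift F E c (fst \<circ> x)"
        using that unfolding R affine_rel_def by blast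
      then show ?thesis using that by (simp add: shift_def)
    qed
    have f: "fst (v (c - 1)) = fst (w (c - 1))" using k [OF v, folded k [OF w]] e [of c "fst a" "fst b"] by simp
    have g: "U (c - 1) (fst (x (c - 1))) * snd (x (c - 1)) = F (c + 1) (fst b) (fst (x (c - 1))) + E (c + 1) (fst b) (fst (x (c - 1))) * fst a + U (c + 1) (fst b) * snd b"
      if "x \<in> R \<and> x c = a \<and> x (c + 1) = b" for x
    proof -
      have "U (c + 1 + 1) (fst (x (c + 1 + 1))) * snd (x (c + 1 + 1)) - U (c + 1) (fst (x (c + 1))) * snd (x (c + 1)) = shift F E (c + 1) (fst \<circ> x)"
        using that unfolding R affine_rel_def by blast
      then show ?thesis using that by (simp add: shift_def diff_eq_eq)
    qed
    have "snd (v (c - 1)) = snd (w (c - 1))" using g [OF v, unfolded f, folded g [OF w]] u by simp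
    with f v w show "v = w" by (intro ext3 [of _ c]) (simp_all add: prod_eq_iff)
  qed
qed

lemma presents_ds:
  assumes p: "presents U F E R"
  shows "ds_rel R"
proof -
  have "\<exists>v\<in>R. v c \<in> {i} \<times> UNIV \<and> v (c + 1) \<in> {j} \<times> UNIV \<and> v (c - 1) = q" for c i j q
  proof -
    obtain I where I: "I c = i" "I (c + 1) = j" "I (c - 1) = fst q" using vec3 [of c i j "fst q"] by blast
    obtain v where v: "v \<in> R" "fst \<circ> v = I" "snd (v (c - 1)) = snd q"
      using presents_block_value [OF p, of I "c - 1" "snd q"] by blast
    have "fst (v d) = I d" for d using v(2) by auto
    with v I show ?thesis by (intro bexI [of _ v]) (simp_all add: mem_Times_iff prod_eq_iff)
  qed
  then show ?thesis using presents_latin [OF p]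
    unfolding ds_rel_def divides_def fibres_def by blast
qed

lemma card_pt: "card (UNIV :: pt set) = 9"
  by (simp add: card_z3 flip: UNIV_Times_UNIV)

text \<open>By the latin property there are nine triples over a given pair of blocks in two coordinates,
  and the division property says that they cover the nine points of the third coordinate. So they
  cover each of them once.\<close>
lemma ds_rel_unique:
  assumes ds: "ds_rel R" and vw: "v \<in> R" "w \<in> R" "fst \<circ> v = fst \<circ> w" "v c = w c"
  shows "v = w"
proof -
  define S where "S = {x \<in> R. fst (x (c + 1)) = fst (v (c + 1)) \<and> fst (x (c - 1)) = fst (v (c - 1))}"
  have lat: "latin_rel R" using ds by (simp add: ds_rel_def)
  have inj: "inj_on (\<lambda>x. (snd (x (c + 1)), snd (x (c - 1)))) S"
  proof (rule inj_onI)
    fix x y assume "x \<in> S" "y \<in> S" "(snd (x (c + 1)), snd (x (c - 1))) = (snd (y (c + 1)), snd (y (c - 1)))"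
    then show "x = y"
      by (intro latin_rel_unique [OF lat, of _ _ "c + 1"]) (auto simp: S_def prod_eq_iff)
  qed
  then have fin: "finite S" by (rule inj_on_finite) auto
  have le: "card S \<le> 9"
    using card_inj_on_le [OF inj, of UNIV] card_pt by simp
  have "(\<lambda>x. x c) ` S = UNIV"
  proof -
    have "\<exists>x\<in>R. x (c + 1) \<in> {fst (v (c + 1))} \<times> UNIV \<and> x (c + 1 + 1) \<in> {fst (v (c - 1))} \<times> UNIV \<and> x (c + 1 - 1) = p" for p
      using ds unfolding ds_rel_def divides_def fibres_def by blast
    then have "\<exists>x\<in>R. fst (x (c + 1)) = fst (v (c + 1)) \<and> fst (x (c - 1)) = fst (v (c - 1)) \<and> x c = p" for p
      by (simp add: mem_Times_iff conj_assoc)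
    then have "\<exists>x\<in>R. x \<in> S \<and> x c = p" for p unfolding S_def mem_Collect_eq by meson
    then show ?thesis by (metis (mono_tags, lifting) UNIV_eq_I image_eqI)
  qed
  then have "card ((\<lambda>x. x c) ` S) = 9" by (simp add: card_pt)
  then have "inj_on (\<lambda>x. x c) S"
    using card_image_le [OF fin, of "\<lambda>x. x c"] le fin by (intro eq_card_imp_inj_on) auto
  moreover have "v \<in> S" "w \<in> S" using vw(1,2) fun_cong [OF vw(3)] by (auto simp: S_def)
  ultimately show ?thesis using vw(4) by (auto dest: inj_onD)
qed

lemma ds_rel_exists:
  assumes ds: "ds_rel R"
  shows "\<exists>v\<in>R. fst \<circ> v = I \<and> snd (v c) = x"
proof -
  have "\<exists>v\<in>R. v (c + 1) \<in> {I (c + 1)} \<times> UNIV \<and> v (c + 1 + 1) \<in> {I (c - 1)} \<times> UNIV \<and> v (c + 1 - 1) = (I c, x)"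
    using ds unfolding ds_rel_def divides_def fibres_def by blast
  then obtain v where v: "v \<in> R" "fst (v (c + 1)) = I (c + 1)" "fst (v (c - 1)) = I (c - 1)" "v c = (I c, x)"
    by (auto simp: mem_Times_iff)
  then have "fst \<circ> v = I" by (intro ext3 [of _ c]) simp_all
  with v show ?thesis by (intro bexI [of _ v]) simp_all
qed

lemma unit_mult_diff: "u \<noteq> 0 \<Longrightarrow> u * x - y = z \<longleftrightarrow> x = u * (z + (y::z3))"
  by (metis diff_eq_eq unit_sq(2))

lemma unit_product_swap:
  "a \<noteq> 0 \<Longrightarrow> b \<noteq> 0 \<Longrightarrow> c \<noteq> 0 \<Longrightarrow> d \<noteq> 0 \<Longrightarrow> a * b = c * d \<Longrightarrow> a * c = b * (d::z3)"
  by (cases a; cases b; cases c; cases d; simp add: z3_const)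

text \<open>Over a choice \<open>I\<close> of blocks, \<open>g I c\<close> is the bijection from the block in coordinate \<open>c\<close> to the
  block in coordinate \<open>c + 1\<close>. If \<open>I\<close> and \<open>J\<close> differ only in the coordinate \<open>c - 1\<close>, then \<open>g I c\<close> and
  \<open>g J c\<close> agree nowhere, since two points of a triple determine the third. Affine maps with different
  slopes agree somewhere, so the slope \<open>p c\<close> depends only on the two blocks involved. The product of
  the slopes around any \<open>I\<close> is \<open>1\<close>, which makes \<open>p c i j\<close> a product \<open>U c i * U (c + 1) j\<close>; rescaling
  by \<open>U\<close> leaves translations only.\<close>
lemma ds_rel_signature:
  assumes ds: "ds_rel R"
  shows "\<exists>E. signature R E"
proof -
  have lat: "latin_rel R" using ds by (simp add: ds_rel_def)
  define V where "V I c x = (SOME v. v \<in> R \<and> fst \<circ> v = I \<and> snd (v c) = x)" for I c x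
  have V: "V I c x \<in> R" "fst \<circ> V I c x = I" "snd (V I c x c) = x" for I c x
    using someI_ex [of "\<lambda>v. v \<in> R \<and> fst \<circ> v = I \<and> snd (v c) = x"] ds_rel_exists [OF ds, of I c x]
    unfolding V_def by blast+
  have fV: "fst (V I c x d) = I d" for I c x d using fun_cong [OF V(2), of I c x d] by simp
  have Vu: "v = V (fst \<circ> v) c (snd (v c))" if "v \<in> R" for v c
    by (rule ds_rel_unique [OF ds that V(1), where c = c]) (simp_all add: V fV prod_eq_iff)
  define g where "g I c x = snd (V I c x (c + 1))" for I c x
  have injg: "inj (g I c)" for I c
  proof (rule injI)
    fix x y assume "g I c x = g I c y"
    then have "V I c x (c + 1) = V I c y (c + 1)" by (simp add: g_def prod_eq_iff fV)
    then have "V I c x = V I c y" by (intro ds_rel_unique [OF ds, of _ _ "c + 1"]) (simp_all add: V)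
    then show "x = y" using V(3) by metis
  qed
  define P where "P I c = g I c 1 - g I c 0" for I c
  have P: "P I c \<noteq> 0" for I c unfolding P_def by (rule inj_z3_affine [OF injg])
  have gP: "g I c x = P I c * x + g I c 0" for I c x unfolding P_def by (rule inj_z3_affine [OF injg])
  have step: "snd (v (c + 1)) = g (fst \<circ> v) c (snd (v c))" if "v \<in> R" for v c
    unfolding g_def using Vu [OF that, of c] by simp
  have clash: "g I c x \<noteq> g J c x" if "I c = J c" "I (c + 1) = J (c + 1)" "I (c - 1) \<noteq> J (c - 1)" for I J c x
  proof
    assume "g I c x = g J c x"
    then have "V I c x (c + 1) = V J c x (c + 1)" "V I c x c = V J c x c"
      using that by (simp_all add: g_def prod_eq_iff fV V)
    then have "V I c x = V J c x" by (intro latin_rel_unique [OF lat]) (simp_all add: V)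
    then show False using that fV by metis
  qed
  have PP: "P I c = P J c" if "I c = J c" "I (c + 1) = J (c + 1)" for I J c
  proof (cases "I (c - 1) = J (c - 1)")
    case True then have "I = J" using that by (intro ext3 [of _ c]) then show ?thesis by simp
  next
    case False
    show ?thesis
    proof (rule ccontr)
      define d where "d = P I c - P J c"
      assume "P I c \<noteq> P J c"
      then have d: "d \<noteq> 0" by (simp add: d_def)
      \<comment> \<open>The point where two affine maps with different slopes agree.\<close>
      define x where "x = d * (g J c 0 - g I c 0)"
      have "d * x = g J c 0 - g I c 0" using d by (simp add: x_def)
      then have "g I c x = g J c x" unfolding gP [of I c x] gP [of J c x] d_def by (simp add: algebra_simps)
      with clash [OF that False] show False by blast
    qed
  qed
  define p where "p c i j = P (\<lambda>d. if d = c then i else if d = c + 1 then j else 0) c" for c i j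
  have pP: "P I c = p c (I c) (I (c + 1))" for I c unfolding p_def by (rule PP) simp_all
  have pn: "p c i j \<noteq> 0" for c i j unfolding p_def by (rule P)
  have cyc: "p 0 i j * p 1 j k * p (-1) k i = 1" for i j k
  proof -
    obtain I where I: "I (0::z3) = i" "I (0 + 1) = j" "I (0 - 1) = k" using vec3 [of 0 i j k] by blast
    have s: "snd (V I 0 x 1) = P I 0 * x + g I 0 0" "snd (V I 0 x (-1)) = P I 1 * snd (V I 0 x 1) + g I 1 0"
       "x = P I (-1) * snd (V I 0 x (-1)) + g I (-1) 0" for x
      using step [OF V(1) [of I 0 x], of 0] step [OF V(1) [of I 0 x], of 1] step [OF V(1) [of I 0 x], of "-1"]
      by (simp_all add: V gP [symmetric])
    have "x = P I (-1) * (P I 1 * (P I 0 * x + g I 0 0) + g I 1 0) + g I (-1) 0" for x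
      using s [of x] by simp
    note x = this
    let ?f = "\<lambda>x. P I (-1) * (P I 1 * (P I 0 * x + g I 0 0) + g I 1 0) + g I (-1) 0"
    have "P I (-1) * (P I 1 * P I 0) = ?f 1 - ?f 0" by (simp add: algebra_simps)
    also have "\<dots> = 1" using x [of 0] x [of 1] by simp
    finally have "P I (-1) * (P I 1 * P I 0) = 1" .
    then show ?thesis using I by (simp add: pP mult.assoc mult.commute mult.left_commute)
  qed
  \<comment> \<open>The slopes along paths through the block 0 of another coordinate.\<close>
  define U where "U c i = (if c = (0::z3) then p (-1) 0 i else if c = 1 then p 1 i 0 else p 1 0 i * p 1 0 0)" for c i
  have U: "U c i \<noteq> 0" for c i by (simp add: U_def pn)
  have e1: "p 0 i j = p 1 j k * p (-1) k i" for i j k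
    by (rule unit_product_cancel) (simp_all add: pn cyc)
  have pU: "p c i j = U c i * U (c + 1) j" for c i j
  proof -
    have "p 0 i j = U 0 i * U 1 j" by (simp add: U_def e1 [of i j 0] mult.commute)
    moreover have "p 1 i j = U 1 i * U (-1) j"
    proof -
      have "p 1 j k * p 1 j 0 = p (-1) k 0 * p (-1) 0 0" for j k
        by (rule unit_product_swap [OF _ _ _ _ trans [OF e1 [of 0 j k, symmetric] e1 [of 0 j 0]]]) (simp_all add: pn)
      from this [of i j] this [of 0 j] have "p 1 i j * p 1 i 0 = p 1 0 j * p 1 0 0" by simp
      moreover have "p 1 i j = p 1 i 0 * (p 1 i j * p 1 i 0)" by (simp add: mult.left_commute pn)
      ultimately show ?thesis by (simp add: U_def)
    qed
    moreover have "p (-1) i j = U (-1) i * U 0 j"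
    proof -
      have "p 1 0 i * p (-1) i j = p 1 0 0 * p (-1) 0 j" by (rule trans [OF e1 [symmetric] e1])
      moreover have "p (-1) i j = p 1 0 i * (p 1 0 i * p (-1) i j)" by (simp add: pn)
      ultimately show ?thesis by (simp add: U_def mult.assoc)
    qed
    ultimately show ?thesis using z3_exhaust [of c] by auto
  qed
  define s where "s c i j k = U (c + 1) j * g (\<lambda>d. if d = c then i else if d = c + 1 then j else k) c 0" for c i j k
  have injs: "inj (s c i j)" for c i j
  proof (rule injI, rule ccontr)
    fix k k' assume "s c i j k = s c i j k'" and k: "k \<noteq> k'"
    then show False using U [of "c + 1" j]
        clash [of "\<lambda>d. if d = c then i else if d = c + 1 then j else k" c "\<lambda>d. if d = c then i else if d = c + 1 then j else k'" 0]
      by (simp add: s_def)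
  qed
  define E where "E c i j = s c i j 1 - s c i j 0" for c i j
  define F where "F c i j = s c i j 0" for c i j
  have E: "E c i j \<noteq> 0" for c i j unfolding E_def by (rule inj_z3_affine [OF injs])
  have sEF: "s c i j k = F c i j + E c i j * k" for c i j k
    unfolding E_def F_def using inj_z3_affine(2) [OF injs, of c i j k] by (simp add: add.commute)
  have sh: "shift F E c I = U (c + 1) (I (c + 1)) * g I c 0" for I c
  proof -
    have "(\<lambda>d. if d = c then I c else if d = c + 1 then I (c + 1) else I (c - 1)) = I"
      by (rule ext3 [of _ c]) simp_all
    then show ?thesis by (simp add: shift_def sEF [symmetric] s_def)
  qed
  have eq: "snd (v (c + 1)) = g I c (snd (v c)) \<longleftrightarrow>
      U (c + 1) (I (c + 1)) * snd (v (c + 1)) - U c (I c) * snd (v c) = shift F E c I" for I v c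
    unfolding sh gP [of I c "snd (v c)"] pP pU unit_mult_diff [OF U]
    by (simp add: U algebra_simps)
  have mem: "v \<in> R" if "\<And>c. snd (v (c + 1)) = g (fst \<circ> v) c (snd (v c))" for v
  proof -
    let ?w = "V (fst \<circ> v) 0 (snd (v 0))"
    have w: "snd (?w (c + 1)) = g (fst \<circ> v) c (snd (?w c))" for c
      using step [OF V(1) [of "fst \<circ> v" 0 "snd (v 0)"], of c] by (simp add: V(2))
    have 0: "snd (v 0) = snd (?w 0)" by (simp add: V)
    have 1: "snd (v 1) = snd (?w 1)" using that [of 0] w [of 0] 0 by simp
    have 2: "snd (v (-1)) = snd (?w (-1))" using that [of 1] w [of 1] 1 by simp
    have "v = ?w" using 0 1 2 by (intro ext3 [of _ 0]) (simp_all add: prod_eq_iff fV)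
    then show "v \<in> R" using V(1) by metis
  qed
  have "R = affine_rel U F E"
  proof (rule set_eqI)
    fix v
    have "v \<in> R \<longleftrightarrow> (\<forall>c. snd (v (c + 1)) = g (fst \<circ> v) c (snd (v c)))" using step mem by blast
    then show "v \<in> R \<longleftrightarrow> v \<in> affine_rel U F E" unfolding eq by (simp add: affine_rel_def)
  qed
  moreover have "(\<Sum>c\<in>UNIV. shift F E c I) = 0" for I
  proof -
    have "shift F E c I = U (c + 1) (I (c + 1)) * snd (V I 0 0 (c + 1)) - U c (I c) * snd (V I 0 0 c)" for c
      using eq [of "V I 0 0" c I] step [OF V(1) [of I 0 0], of c] by (simp add: V(2))
    then show ?thesis by (simp add: sum_z3 [of _ 0])
  qed
  ultimately have "presents U F E R" using U E by (simp add: presents_def)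
  then show ?thesis unfolding signature_def by blast
qed

text \<open>For equal slopes the difference of the two offsets \<open>F\<close> satisfies
  \<open>D 0 i j + D 1 j k + D (-1) k i = 0\<close>, so it is a coboundary \<open>T (c + 1) j - T c i\<close>, and translating
  every block by its value of \<open>T\<close> carries one set of triples to the other.\<close>
lemma signature_determines:
  assumes "signature R E" "signature R' E"
  shows "ds_equiv R R'"
proof -
  from assms obtain U F U' F' where p: "presents U F E R" and p': "presents U' F' E R'"
    unfolding signature_def by blast
  have u: "U c i \<noteq> 0" "U' c i \<noteq> 0" for c i using p p' by (simp_all add: presents_def)
  have R: "R = affine_rel U F E" "R' = affine_rel U' F' E" using p p' by (simp_all add: presents_def)
  define D where "D c i j = F c i j - F' c i j" for c i j
  have D: "D 0 i j + D 1 j k + D (-1) k i = 0" for i j k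
  proof -
    obtain I where I: "I (0::z3) = i" "I (0 + 1) = j" "I (0 - 1) = k" using vec3 [of 0 i j k] by blast
    let ?S = "\<lambda>F. F 0 i j + E 0 i j * k + (F 1 j k + E 1 j k * i) + (F (-1) k i + E (-1) k i * j)"
    have "D 0 i j + D 1 j k + D (-1) k i = ?S F - ?S F'"
      by (simp add: D_def algebra_simps)
    also have "?S F = 0" using presents_sum [OF p I] by simp
    also have "?S F' = 0" using presents_sum [OF p' I] by simp
    finally show ?thesis by simp
  qed
  \<comment> \<open>Fixing one of the three blocks to be 0 in the cocycle equation.\<close>
  define T where "T c i = (if c = (0::z3) then D (-1) 0 i else if c = 1 then - D 1 i 0 else D 1 0 i - D 1 0 0)" for c i
  have DT: "D c i j = T (c + 1) j - T c i" for c i j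
  proof -
    have d: "D 0 i j = - D 1 j k - D (-1) k i" for i j k
      using D [of i j k] by (simp add: add_eq_0_iff algebra_simps)
    have "D 0 i j = T 1 j - T 0 i" by (simp add: T_def d [of i j 0])
    moreover have "D 1 i j = T (-1) j - T 1 i"
    proof -
      have e: "D 1 j k = - D 0 i j - D (-1) k i" for i j k
        using D [of i j k] by (simp add: add_eq_0_iff2 algebra_simps)
      show ?thesis by (simp add: T_def e [of i j 0] e [of i 0 0] e [of 0 j 0] e [of 0 0 0])
    qed
    moreover have "D (-1) i j = T 0 j - T (-1) i"
      using d [of j 0 i] d [of j 0 0] by (simp add: T_def algebra_simps)
    ultimately show ?thesis using z3_exhaust [of c] by auto
  qed
  define \<psi> where "\<psi> c = (\<lambda>(i, a). (1 * i + 0, (U' c i * U c i) * a + (- U' c i * T c i)))" for c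
  have "block_map (\<psi> c)" for c unfolding \<psi>_def by (rule affine_block_map) (simp_all add: u)
  moreover have "v \<in> R \<longleftrightarrow> (\<lambda>c. \<psi> c (v c)) \<in> R'" for v
  proof -
    have f: "fst (\<psi> c x) = fst x" for c x by (cases x) (simp add: \<psi>_def)
    have g: "U' c (fst x) * snd (\<psi> c x) = U c (fst x) * snd x - T c (fst x)" for c x
      by (cases x) (simp add: \<psi>_def u algebra_simps)
    have "shift F E c (fst \<circ> v) = shift F' E c (fst \<circ> v) + (T (c + 1) (fst (v (c + 1))) - T c (fst (v c)))" for c
      by (simp add: shift_def DT [symmetric] D_def)
    moreover have "a - t - (b - t') = z \<longleftrightarrow> a - b = z + (t - t')" for a b t t' z :: z3
      by (auto simp: algebra_simps)
    ultimately show ?thesis unfolding R affine_rel_def mem_Collect_eq by (simp add: f g comp_def)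
  qed
  ultimately show ?thesis unfolding ds_equiv_def
    by (intro exI [of _ id] exI [of _ \<psi>]) simp
qed

text \<open>The action on signatures of the permutation \<open>c \<mapsto> h + c\<close> or \<open>c \<mapsto> h - c\<close> of the coordinates (the
  latter if \<open>r\<close> holds), the permutations \<open>i \<mapsto> m c * i + n c\<close> of the blocks in coordinate \<open>c\<close>, and
  the scaling of all inner coordinates by \<open>e\<close>. The factor \<open>m (c - 1)\<close> appears because \<open>E c\<close> is a slope
  in the block of coordinate \<open>c - 1\<close>. Reversing the cyclic order of the coordinates turns a shift into
  its negative and interchanges its two arguments.\<close>
definition act :: "bool \<Rightarrow> z3 \<Rightarrow> z3 \<Rightarrow> (z3 \<Rightarrow> z3) \<Rightarrow> (z3 \<Rightarrow> z3) \<Rightarrow> coeffs \<Rightarrow> z3 \<Rightarrow> z3 \<Rightarrow> z3 \<Rightarrow> z3" where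
  "act r h e m n E c i j = e * m (c - 1) *
     (let i' = m c * (i - n c); j' = m (c + 1) * (j - n (c + 1))
      in if r then - E (h - c - 1) j' i' else E (h + c) i' j')"

lemma all_surj: "surj f \<Longrightarrow> (\<forall>y. P y) \<longleftrightarrow> (\<forall>x. P (f x))"
  by (metis surjD)

text \<open>Applying the permutations behind \<open>act\<close> to the set of triples itself transforms its shifts,
  and with them the slopes, in the asserted way.\<close>
lemma signature_act:
  assumes "signature R E" and e: "e \<noteq> 0" and m: "\<And>c. m c \<noteq> 0"
  obtains R' where "ds_equiv R R'" "signature R' (act r h e m n E)"
proof -
  from assms(1) obtain U F where p: "presents U F E R" unfolding signature_def by blast
  have u: "\<And>c i. U c i \<noteq> 0" and ne: "\<And>c i j. E c i j \<noteq> 0" and R: "R = affine_rel U F E"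
    and sum: "\<And>I. (\<Sum>c\<in>UNIV. shift F E c I) = 0"
    using p by (simp_all add: presents_def)
  define \<theta> where "\<theta> c = (if r then h - c else h + c)" for c
  have bij: "bij \<theta>"
    using bij_affine [of "-1" h] bij_affine [of "1" h] by (cases r) (simp_all add: \<theta>_def [abs_def] add.commute)
  define U' where "U' c i = e * U (\<theta> c) (m c * (i - n c))" for c i
  define S where "S G c i j = (if r then - G (h - c - 1) j i else G (h + c) i j)" for G :: "z3 \<Rightarrow> z3 \<Rightarrow> z3 \<Rightarrow> z3" and c i j
  define E' where "E' = act r h e m n E"
  have E': "E' c i j = e * m (c - 1) * S E c (m c * (i - n c)) (m (c + 1) * (j - n (c + 1)))" for c i j
    by (simp add: E'_def act_def S_def)
  define F' where "F' c i j = e * (S F c (m c * (i - n c)) (m (c + 1) * (j - n (c + 1)))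
     - S E c (m c * (i - n c)) (m (c + 1) * (j - n (c + 1))) * m (c - 1) * n (c - 1))" for c i j
  define \<phi> where "\<phi> I c = m c * I (\<theta> c) + n c" for I c
  have inv: "m c * (m c * x + n c - n c) = x" for c x using m by simp
  have sh: "shift F' E' c (\<phi> I) = e * (if r then - shift F E (h - c - 1) I else shift F E (h + c) I)" for c I
  proof -
    have t: "h - c - 1 - 1 = h - (c - 1)" "h - (c + 1) = h - c - 1" "h + c + 1 = h + (c + 1)" "h + c - 1 = h + (c - 1)"
      "h - c - 1 + 1 = h - c" "h - (c - 1) = h - c + 1"
      by (simp_all add: algebra_simps)
    have "shift F' E' c (\<phi> I) = e * (S F c (I (\<theta> c)) (I (\<theta> (c + 1))) + S E c (I (\<theta> c)) (I (\<theta> (c + 1))) * I (\<theta> (c - 1)))"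
      unfolding shift_def F'_def E' \<phi>_def inv by (simp add: algebra_simps m)
    then show ?thesis by (simp add: S_def \<theta>_def shift_def algebra_simps t)
  qed
  have "presents U' F' E' (affine_rel U' F' E')"
    unfolding presents_def
  proof (intro conjI allI refl)
    show "U' c i \<noteq> 0" for c i by (simp add: U'_def e u)
    show "E' c i j \<noteq> 0" for c i j by (simp add: E' S_def e m ne)
    show "(\<Sum>c\<in>UNIV. shift F' E' c I) = 0" for I
    proof -
      \<comment> \<open>The sum over the coordinates is only reordered.\<close>
      define J where "J d = m (inv \<theta> d) * (I (inv \<theta> d) - n (inv \<theta> d))" for d
      have J: "\<phi> J = I" using bij m by (auto simp: \<phi>_def J_def bij_def)
      have b: "bij (\<lambda>c. h - c - 1)" "bij (\<lambda>c. h + c)"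
        using bij_affine [of "-1" "h - 1"] bij_affine [of "1" h] by (simp_all add: add.commute algebra_simps)
      have "(\<Sum>c\<in>UNIV. shift F E (h - c - 1) J) = 0" "(\<Sum>c\<in>UNIV. shift F E (h + c) J) = 0"
        using sum.reindex_bij_betw [OF b(1), of "\<lambda>c. shift F E c J"] sum.reindex_bij_betw [OF b(2), of "\<lambda>c. shift F E c J"]
        by (simp_all add: sum)
      then show ?thesis unfolding J [symmetric] sh
        by (cases r) (simp_all add: sum_negf flip: sum_distrib_left)
    qed
  qed
  moreover have "ds_equiv R (affine_rel U' F' E')"
    unfolding ds_equiv_def
  proof (intro exI conjI allI)
    show "bij \<theta>" by (rule bij)
    show "block_map (\<lambda>(i, a). (m c * i + n c, 1 * a + 0))" for c by (rule affine_block_map) (simp_all add: m)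
    fix v :: config
    define w where "w = (\<lambda>c. (\<lambda>(i, a). (m c * i + n c, 1 * a + 0)) (v (\<theta> c)))"
    have w: "fst (w c) = m c * fst (v (\<theta> c)) + n c" "snd (w c) = snd (v (\<theta> c))" for c
      by (simp_all add: w_def case_prod_beta)
    have fw: "fst \<circ> w = \<phi> (fst \<circ> v)" by (auto simp: \<phi>_def w)
    have U'w: "U' c (fst (w c)) = e * U (\<theta> c) (fst (v (\<theta> c)))" for c by (simp add: U'_def w m)
    let ?P = "\<lambda>d. U (d + 1) (fst (v (d + 1))) * snd (v (d + 1)) - U d (fst (v d)) * snd (v d) = shift F E d (fst \<circ> v)"
    have eq: "U' (c + 1) (fst (w (c + 1))) * snd (w (c + 1)) - U' c (fst (w c)) * snd (w c) = shift F' E' c (fst \<circ> w)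
        \<longleftrightarrow> ?P (if r then h - c - 1 else h + c)" for c
    proof -
      have "e * x - e * y = e * z \<longleftrightarrow> x - y = z" for x y z
        using e by (simp flip: right_diff_distrib)
      then have "e * x * x' - e * y * y' = e * z \<longleftrightarrow> x * x' - y * y' = z" for x y z x' y'
        by (simp add: mult.assoc)
      then show ?thesis unfolding U'w w(2) fw sh
        by (simp add: \<theta>_def) (simp add: algebra_simps, metis minus_diff_eq neg_equal_iff_equal)
    qed
    have "v \<in> R \<longleftrightarrow> (\<forall>d. ?P d)" by (simp add: R affine_rel_def)
    also have "\<dots> \<longleftrightarrow> (\<forall>c. ?P (if r then h - c - 1 else h + c))"
    proof (rule all_surj, rule surjI)
      show "(if r then h - (if r then h - d - 1 else d - h) - 1 else h + (if r then h - d - 1 else d - h)) = d" for d by simp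
    qed
    also have "\<dots> \<longleftrightarrow> w \<in> affine_rel U' F' E'" unfolding eq [symmetric] by (simp add: affine_rel_def)
    finally show "v \<in> R \<longleftrightarrow> (\<lambda>c. (\<lambda>(i, a). (m c * i + n c, 1 * a + 0)) (v (\<theta> c))) \<in> affine_rel U' F' E'"
      unfolding w_def .
  qed
  ultimately show thesis using that unfolding signature_def E'_def by blast
qed

text \<open>An equivalence multiplies the scaled inner coordinate of a point of the block \<open>i\<close> by a unit
  \<open>\<Lambda> c i\<close> and adds a constant. Both sides are related by translations along every triple, so the units
  of any two blocks in consecutive coordinates coincide, hence all of them do. Comparing the shifts for
  two values of the remaining block isolates the slopes.\<close>
lemma equiv_signature_act:
  assumes "ds_equiv R R'" "signature R E" "signature R' E'"
  obtains r h e m n where "e \<noteq> 0" "\<And>c. m c \<noteq> 0" "E' = act r h e m n E"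
proof -
  from assms(2,3) obtain U F U' F' where p: "presents U F E R" and p': "presents U' F' E' R'"
    unfolding signature_def by blast
  have u: "U c i \<noteq> 0" "U' c i \<noteq> 0" for c i using p p' by (simp_all add: presents_def)
  have R: "R = affine_rel U F E" "R' = affine_rel U' F' E'" using p p' by (simp_all add: presents_def)
  from assms(1) obtain \<theta> \<psi> where th: "bij \<theta>" and bm: "\<And>c. block_map (\<psi> c)"
     and RR: "\<And>v. v \<in> R \<longleftrightarrow> (\<lambda>c. \<psi> c (v (\<theta> c))) \<in> R'"
    unfolding ds_equiv_def by blast
  have "\<exists>m n V W. m \<noteq> 0 \<and> (\<forall>i. V i \<noteq> 0) \<and> (\<forall>i a. \<psi> c (i, a) = (m * i + n, V i * a + W i))" for c
    using block_map_affine [OF bm [of c]] by metis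
  then obtain m n V W where m: "\<And>c. m c \<noteq> 0" and V: "\<And>c i. V c i \<noteq> 0"
      and \<psi>: "\<And>c i a. \<psi> c (i, a) = (m c * i + n c, V c i * a + W c i)"
    by metis
  define d where "d = \<theta> 1 - \<theta> 0"
  define h where "h = \<theta> 0"
  have inj: "inj \<theta>" using th by (rule bij_is_inj)
  have d0: "d \<noteq> 0" unfolding d_def by (rule inj_z3_affine(1) [OF inj])
  have \<theta>: "\<theta> c = d * c + h" for c unfolding d_def h_def by (rule inj_z3_affine(2) [OF inj])
  define r where "r \<longleftrightarrow> d = -1"
  have d: "d = (if r then -1 else 1)" using d0 z3_exhaust [of d] by (auto simp: r_def)
  define \<Lambda> where "\<Lambda> c i = U' c (m c * i + n c) * V c i * U (\<theta> c) i" for c i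
  define K where "K c i = U' c (m c * i + n c) * W c i" for c i
  define S where "S G c i j = (if r then - G (h - c - 1) j i else G (h + c) i j)" for G :: "z3 \<Rightarrow> z3 \<Rightarrow> z3 \<Rightarrow> z3" and c i j
  define D where "D c I = (if r then - shift F E (h - c - 1) I else shift F E (h + c) I)" for c I
  \<comment> \<open>Here \<open>x\<close> is the scaled inner coordinate in coordinate \<open>\<theta> c\<close> of a triple over \<open>I\<close>; it is arbitrary.\<close>
  have key: "\<Lambda> (c + 1) (I (\<theta> (c + 1))) * (x + D c I) + K (c + 1) (I (\<theta> (c + 1))) - (\<Lambda> c (I (\<theta> c)) * x + K c (I (\<theta> c)))
      = shift F' E' c (\<lambda>c. m c * I (\<theta> c) + n c)" for c I x
  proof -
    obtain v where v: "v \<in> R" "fst \<circ> v = I" "snd (v (\<theta> c)) = U (\<theta> c) (I (\<theta> c)) * x"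
      using presents_block_value [OF p] by blast
    have f: "fst (v c) = I c" for c using v(2) by auto
    have vI: "v c = (I c, snd (v c))" for c by (simp add: prod_eq_iff f)
    define X where "X c = U c (I c) * snd (v c)" for c
    have X: "X (c + 1) = X c + shift F E c I" for c
      using v(1) unfolding R affine_rel_def by (simp add: X_def f v(2) diff_eq_eq)
    have X1: "X (\<theta> c) = x" by (simp add: X_def v(3) u)
    have X2: "X (\<theta> (c + 1)) = x + D c I"
    proof (cases r)
      case True
      have "X (h - c) = X (h - c - 1) + shift F E (h - c - 1) I" using X [of "h - c - 1"] by simp
      then show ?thesis using X1 True by (simp add: \<theta> d D_def algebra_simps)
    next
      case False
      then show ?thesis using X1 X [of "h + c"] by (simp add: \<theta> d D_def algebra_simps)
    qed
    have w: "\<psi> c (v (\<theta> c)) = (m c * I (\<theta> c) + n c, V c (I (\<theta> c)) * snd (v (\<theta> c)) + W c (I (\<theta> c)))" for c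
      by (subst vI) (simp add: \<psi>)
    have val: "U' c (m c * I (\<theta> c) + n c) * (V c (I (\<theta> c)) * snd (v (\<theta> c)) + W c (I (\<theta> c))) = \<Lambda> c (I (\<theta> c)) * X (\<theta> c) + K c (I (\<theta> c))" for c
      by (simp add: \<Lambda>_def K_def X_def algebra_simps u)
    have "(\<lambda>c. \<psi> c (v (\<theta> c))) \<in> affine_rel U' F' E'" using RR v(1) by (simp add: R)
    then have "U' (c + 1) (m (c + 1) * I (\<theta> (c + 1)) + n (c + 1)) * (V (c + 1) (I (\<theta> (c + 1))) * snd (v (\<theta> (c + 1))) + W (c + 1) (I (\<theta> (c + 1))))
       - U' c (m c * I (\<theta> c) + n c) * (V c (I (\<theta> c)) * snd (v (\<theta> c)) + W c (I (\<theta> c)))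
       = shift F' E' c (\<lambda>c. m c * I (\<theta> c) + n c)"
      unfolding affine_rel_def mem_Collect_eq w by (simp add: comp_def w)
    then show ?thesis unfolding val X1 X2 .
  qed
  have vecth: "\<exists>I. I (\<theta> c) = i \<and> I (\<theta> (c + 1)) = j \<and> I (\<theta> (c - 1)) = k" for c and i j k :: z3
  proof -
    obtain J where J: "J c = i" "J (c + 1) = j" "J (c - 1) = k" using vec3 [of c i j k] by blast
    have "inv \<theta> (\<theta> c) = c" for c using th by (simp add: bij_def)
    then show ?thesis using J by (intro exI [of _ "J \<circ> inv \<theta>"]) simp
  qed
  have L: "\<Lambda> (c + 1) j = \<Lambda> c i" for c i j
  proof -
    obtain I where I: "I (\<theta> c) = i" "I (\<theta> (c + 1)) = j" using vecth [of c i j 0] by blast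
    show ?thesis using trans [OF key [of c I 0] key [of c I 1, symmetric]] unfolding I by (simp add: algebra_simps)
  qed
  define e where "e = \<Lambda> 0 0"
  have Le: "\<Lambda> c i = e" for c i
  proof -
    have "\<Lambda> 1 i = e" for i using L [of 0 i 0] by (simp add: e_def)
    moreover have "\<Lambda> 0 i = e" for i using L [of 0 0 i] L [of 0 0 0] by (simp add: e_def)
    moreover have "\<Lambda> (-1) i = e" for i using L [of 1 i 0] L [of 0 0 0] by (simp add: e_def)
    ultimately show ?thesis using z3_exhaust [of c] by auto
  qed
  have e: "e \<noteq> 0" by (simp add: e_def \<Lambda>_def u V)
  have t: "h - c - 1 - 1 = h - (c - 1)" "h - (c + 1) = h - c - 1" "h + c + 1 = h + (c + 1)" "h + c - 1 = h + (c - 1)"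
      "h - c - 1 + 1 = h - c" "h - c + 1 = h - (c - 1)" for c
    by (simp_all add: algebra_simps)
  have DS: "D c I = S F c (I (\<theta> c)) (I (\<theta> (c + 1))) + S E c (I (\<theta> c)) (I (\<theta> (c + 1))) * I (\<theta> (c - 1))" for c I
  proof -
    have "\<theta> c = (if r then h - c else h + c)" for c by (simp add: \<theta> d)
    then show ?thesis unfolding D_def S_def shift_def by (simp add: t)
  qed
  have EE: "E' c (m c * i + n c) (m (c + 1) * j + n (c + 1)) * m (c - 1) = e * S E c i j" for c i j
  proof -
    obtain I where I: "I (\<theta> c) = i" "I (\<theta> (c + 1)) = j" "I (\<theta> (c - 1)) = 0" using vecth [of c i j 0] by blast
    obtain J where J: "J (\<theta> c) = i" "J (\<theta> (c + 1)) = j" "J (\<theta> (c - 1)) = 1" using vecth [of c i j 1] by blast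
    let ?i = "m c * i + n c" and ?j = "m (c + 1) * j + n (c + 1)"
    have 1: "e * S F c i j + K (c + 1) j - K c i = F' c ?i ?j + E' c ?i ?j * n (c - 1)"
      using key [of c I 0] unfolding Le DS shift_def I by simp
    have 2: "e * (S F c i j + S E c i j) + K (c + 1) j - K c i = F' c ?i ?j + E' c ?i ?j * (m (c - 1) + n (c - 1))"
      using key [of c J 0] unfolding Le DS shift_def J by simp
    have "E' c ?i ?j * m (c - 1) = (F' c ?i ?j + E' c ?i ?j * (m (c - 1) + n (c - 1))) - (F' c ?i ?j + E' c ?i ?j * n (c - 1))"
      by (simp add: algebra_simps)
    also have "\<dots> = e * S E c i j" unfolding 1 [symmetric] 2 [symmetric] by (simp add: algebra_simps)
    finally show ?thesis .
  qed
  have "E' c i j = act r h e m n E c i j" for c i j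
  proof -
    have "m c * (m c * (x - n c)) + n c = x" for c x using m by simp
    then have "E' c i j * m (c - 1) = e * S E c (m c * (i - n c)) (m (c + 1) * (j - n (c + 1)))"
      using EE [of c "m c * (i - n c)" "m (c + 1) * (j - n (c + 1))"] by simp
    then have "E' c i j = m (c - 1) * (e * S E c (m c * (i - n c)) (m (c + 1) * (j - n (c + 1))))"
      using m by (metis mult.commute unit_sq(2))
    then show ?thesis by (simp add: act_def S_def mult.commute mult.left_commute)
  qed
  then have "E' = act r h e m n E" by (intro ext)
  with e m show thesis by (rule that)
qed

section \<open>From squares on nine symbols to sets of triples\<close>

text \<open>Intervals such as \<open>{1..9}\<close> should keep their shape under simplification.\<close>
declare One_nat_def [simp del]

fun z3_nat :: "z3 \<Rightarrow> nat" where
  "z3_nat Z0 = 0" | "z3_nat Z1 = 1" | "z3_nat Z2 = 2"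

definition enc :: "pt \<Rightarrow> nat" where
  "enc p = 3 * z3_nat (fst p) + z3_nat (snd p) + 1"

lemma range_z3: "range f = {f Z0, f Z1, f Z2}"
proof -
  have "UNIV = {Z0, Z1, Z2}" using z3.exhaust by auto
  then show ?thesis by (metis image_empty image_insert)
qed

lemma inj_enc: "inj enc"
proof (rule injI)
  fix p q assume e: "enc p = enc q"
  obtain i a j b where "p = (i, a)" "q = (j, b)" by (metis surj_pair)
  with e show "p = q"
    by (cases i; cases a; cases j; cases b) (simp_all add: enc_def)
qed

lemma enc_eq [simp]: "enc p = enc q \<longleftrightarrow> p = q"
  using inj_enc by (simp add: inj_eq)

lemma range_enc: "range enc = {1..9}"
proof -
  have "enc p \<in> {1..9}" for p
    by (cases "fst p"; cases "snd p"; simp add: enc_def)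
  moreover have "card (range enc) = 9" by (simp add: card_image inj_enc card_pt)
  ultimately show ?thesis by (intro card_subset_eq) auto
qed

lemma enc_mem [simp]: "enc p \<in> {1..9}"
  using range_enc by blast

lemma ball_enc: "(\<forall>x\<in>{1..9}. P x) \<longleftrightarrow> (\<forall>p. P (enc p))"
  unfolding range_enc [symmetric] by blast

lemma bex_enc: "(\<exists>x\<in>{1..9}. P x) \<longleftrightarrow> (\<exists>p. P (enc p))"
  unfolding range_enc [symmetric] by blast

definition cfg :: "pt \<Rightarrow> pt \<Rightarrow> pt \<Rightarrow> config" where
  "cfg p q r = (\<lambda>c. if c = 0 then p else if c = 1 then q else r)"

lemma cfg_simps [simp]: "cfg p q r 0 = p" "cfg p q r 1 = q" "cfg p q r (-1) = r"
  by (simp_all add: cfg_def)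

lemma cfg_eta: "cfg (v 0) (v 1) (v (-1)) = v"
  by (rule ext3 [of _ 0]) simp_all

lemma ex_cfg: "(\<exists>v. P v) \<longleftrightarrow> (\<exists>p q r. P (cfg p q r))"
  by (metis cfg_eta)

definition rel_of :: "(nat \<Rightarrow> nat \<Rightarrow> nat) \<Rightarrow> config set" where
  "rel_of L = {v. L (enc (v 0)) (enc (v 1)) = enc (v (-1))}"

lemma cfg_rel_of [simp]: "cfg p q r \<in> rel_of L \<longleftrightarrow> L (enc p) (enc q) = enc r"
  by (simp add: rel_of_def)

lemma ex1_alt: "(\<exists>!x. P x) \<longleftrightarrow> (\<exists>x. P x) \<and> (\<forall>x y. P x \<longrightarrow> P y \<longrightarrow> x = y)"
  by blast

lemma ex1_image:
  assumes i: "\<And>r r'. g r = g r' \<Longrightarrow> r = r'" and s: "\<And>v. Q v \<Longrightarrow> \<exists>r. v = g r"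
  shows "(\<exists>!v. Q v) \<longleftrightarrow> (\<exists>!r. Q (g r))"
proof -
  have "(\<exists>v. Q v) \<longleftrightarrow> (\<exists>r. Q (g r))" using s by auto
  moreover have "(\<forall>v w. Q v \<longrightarrow> Q w \<longrightarrow> v = w) \<longleftrightarrow> (\<forall>r r'. Q (g r) \<longrightarrow> Q (g r') \<longrightarrow> r = r')" (is "?a \<longleftrightarrow> ?b")
  proof
    assume ?a then show ?b using i by auto
  next
    assume b: ?b
    show ?a
    proof (intro allI impI)
      fix v w assume vw: "Q v" "Q w"
      obtain r where r: "v = g r" using s [OF vw(1)] ..
      obtain r' where r': "w = g r'" using s [OF vw(2)] ..
      have "r = r'" using b vw unfolding r r' by simp
      then show "v = w" by (simp add: r r')
    qed
  qed
  ultimately show ?thesis by (simp only: ex1_alt)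
qed

lemma ex1_cfg: "(\<exists>!v. P v \<and> v 0 = p \<and> v 1 = q) \<longleftrightarrow> (\<exists>!r. P (cfg p q r))"
  "(\<exists>!v. P v \<and> v 1 = p \<and> v (-1) = q) \<longleftrightarrow> (\<exists>!r. P (cfg r p q))"
  "(\<exists>!v. P v \<and> v (-1) = p \<and> v 0 = q) \<longleftrightarrow> (\<exists>!r. P (cfg q r p))"
proof -
  have v: "v = cfg a b c" if "v 0 = a" "v 1 = b" "v (-1) = c" for v a b c
    using cfg_eta [of v] that by simp
  have i: "a = a'" "b = b'" "c = c'" if "cfg a b c = cfg a' b' c'" for a b c a' b' c'
    using fun_cong [OF that, of 0] fun_cong [OF that, of 1] fun_cong [OF that, of "-1"] by simp_all
  show "(\<exists>!v. P v \<and> v 0 = p \<and> v 1 = q) \<longleftrightarrow> (\<exists>!r. P (cfg p q r))"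
  proof -
    have "(\<exists>!v. P v \<and> v 0 = p \<and> v 1 = q) \<longleftrightarrow> (\<exists>!r. P (cfg p q r) \<and> cfg p q r 0 = p \<and> cfg p q r 1 = q)"
      by (rule ex1_image) (erule i(3), elim conjE, rule exI, rule v, (assumption | rule refl)+)
    then show ?thesis by simp
  qed
  show "(\<exists>!v. P v \<and> v 1 = p \<and> v (-1) = q) \<longleftrightarrow> (\<exists>!r. P (cfg r p q))"
  proof -
    have "(\<exists>!v. P v \<and> v 1 = p \<and> v (-1) = q) \<longleftrightarrow> (\<exists>!r. P (cfg r p q) \<and> cfg r p q 1 = p \<and> cfg r p q (-1) = q)"
      by (rule ex1_image) (erule i(1), elim conjE, rule exI, rule v, (assumption | rule refl)+)
    then show ?thesis by simp
  qed
  show "(\<exists>!v. P v \<and> v (-1) = p \<and> v 0 = q) \<longleftrightarrow> (\<exists>!r. P (cfg q r p))"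
  proof -
    have "(\<exists>!v. P v \<and> v (-1) = p \<and> v 0 = q) \<longleftrightarrow> (\<exists>!r. P (cfg q r p) \<and> cfg q r p (-1) = p \<and> cfg q r p 0 = q)"
      by (rule ex1_image) (erule i(2), elim conjE, rule exI, rule v, (assumption | rule refl)+)
    then show ?thesis by simp
  qed
qed

lemma latin_rel_of:
  "latin_rel (rel_of L) \<longleftrightarrow> (\<forall>p q. \<exists>!r. L (enc p) (enc q) = enc r) \<and>
     (\<forall>q r. \<exists>!p. L (enc p) (enc q) = enc r) \<and> (\<forall>r p. \<exists>!q. L (enc p) (enc q) = enc r)"
proof -
  have "latin_rel R \<longleftrightarrow> (\<forall>p q. \<exists>!v. v \<in> R \<and> v 0 = p \<and> v 1 = q) \<and>
     (\<forall>p q. \<exists>!v. v \<in> R \<and> v 1 = p \<and> v (-1) = q) \<and> (\<forall>p q. \<exists>!v. v \<in> R \<and> v (-1) = p \<and> v 0 = q)" for R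
    unfolding latin_rel_def z3_all by simp
  from this [of "rel_of L"] show ?thesis unfolding ex1_cfg cfg_rel_of .
qed

lemma ex1_of_surj:
  fixes f :: "'a::finite \<Rightarrow> 'a" assumes "\<And>y. \<exists>x. f x = y" shows "\<exists>!x. f x = y"
proof -
  have "y \<in> range f" for y using assms [of y] by blast
  then have "surj f" by blast
  then have inj: "inj f" by (rule finite_UNIV_surj_inj [OF finite])
  obtain x where x: "f x = y" using assms by blast
  show ?thesis
  proof (rule ex1I)
    show "f x = y" by (rule x)
    show "x' = x" if "f x' = y" for x' using injD [OF inj, of x' x] that x by simp
  qed
qed

text \<open>Surjectivity of rows and columns gives uniqueness because they are finite.\<close>
lemma latin_square_rel: "latin_square {1..9} L \<longleftrightarrow> latin_rel (rel_of L)"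
proof
  assume L: "latin_square {1..9} L"
  have r: "\<exists>r. L (enc p) (enc q) = enc r" for p q
  proof -
    have "L (enc p) (enc q) \<in> range enc" using L unfolding latin_square_def ball_enc range_enc by blast
    then show ?thesis by blast
  qed
  define M where "M p q = inv enc (L (enc p) (enc q))" for p q
  have M: "L (enc p) (enc q) = enc (M p q)" for p q
  proof -
    obtain t where "L (enc p) (enc q) = enc t" using r by blast
    then show ?thesis by (simp add: M_def inj_enc)
  qed
  have "\<exists>q. M p q = r" "\<exists>p. M p q = r" for p q r
    using L unfolding latin_square_def ball_enc bex_enc M enc_eq by blast+
  then show "latin_rel (rel_of L)"
    unfolding latin_rel_of M enc_eq by (auto intro!: ex1_of_surj)
next
  assume "latin_rel (rel_of L)"
  then have e: "(\<forall>p q. \<exists>!r. L (enc p) (enc q) = enc r) \<and>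
     (\<forall>q r. \<exists>!p. L (enc p) (enc q) = enc r) \<and> (\<forall>r p. \<exists>!q. L (enc p) (enc q) = enc r)"
    unfolding latin_rel_of .
  have e1: "\<exists>r. L (enc p) (enc q) = enc r" for p q
    using conjunct1 [OF e, rule_format, of p q] by (rule ex1_implies_ex)
  have e2: "\<exists>p. L (enc p) (enc q) = enc r" for q r
    using conjunct1 [OF conjunct2 [OF e], rule_format, of q r] by (rule ex1_implies_ex)
  have e3: "\<exists>q. L (enc p) (enc q) = enc r" for p r
    using conjunct2 [OF conjunct2 [OF e], rule_format, of p r] by (rule ex1_implies_ex)
  have "L (enc p) (enc q) \<in> {1..9}" for p q
  proof -
    obtain r where r: "L (enc p) (enc q) = enc r" using e1 [of p q] ..
    show ?thesis unfolding r by (rule enc_mem)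
  qed
  with e2 e3 show "latin_square {1..9} L"
    unfolding latin_square_def ball_enc bex_enc by blast
qed
definition tri_of :: "(z3 \<Rightarrow> pt set set) \<Rightarrow> nat tri_partition" where
  "tri_of Q = ((`) enc ` Q 0, (`) enc ` Q 1, (`) enc ` Q (-1))"

lemma sudoku_partition_image:
  assumes "inj f" "sudoku_partition m X P"
  shows "sudoku_partition m (f ` X) ((`) f ` P)"
proof -
  have p: "partition_on X P" using assms(2) by (simp add: sudoku_partition_def)
  have "{} \<notin> (`) f ` P" using partition_onD3 [OF p] by auto
  then have "partition_on (f ` X) ((`) f ` P)"
    using partition_on_inj_image [OF p, of f] assms(1) by (simp add: inj_on_subset [of f UNIV])
  moreover have "inj_on ((`) f) P" using assms(1) by (meson inj_image_eq_iff inj_onI)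
  moreover have "card (f ` A) = card A" for A
    using assms(1) by (intro card_image) (auto intro: inj_on_subset)
  ultimately show ?thesis using assms(2) by (simp add: sudoku_partition_def card_image)
qed

lemma sudoku_partition_enc: "sudoku_partition 3 {1..9} P \<longleftrightarrow> (\<exists>Q. P = (`) enc ` Q \<and> sudoku_partition 3 UNIV Q)"
proof
  assume P: "sudoku_partition 3 {1..9} P"
  then have sub: "A \<subseteq> {1..9}" if "A \<in> P" for A
    using that by (auto simp: sudoku_partition_def partition_on_def)
  define d where "d x = (if x \<in> {1..9} then inv enc x else undefined)" for x
  have e: "enc (inv enc x) = x" if "x \<in> {1..9}" for x
    using that unfolding range_enc [symmetric] by (auto simp: inj_enc)
  have i: "enc ` inv enc ` A = A" if "A \<in> P" for A
  proof -
    have "enc ` inv enc ` A = (\<lambda>x. x) ` A" unfolding image_image by (rule image_cong) (use e sub [OF that] in auto)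
    then show ?thesis by simp
  qed
  have im: "(`) enc ` (`) (inv enc) ` P = P"
  proof -
    have "(`) enc ` (`) (inv enc) ` P = (\<lambda>A. A) ` P" unfolding image_image [of "(`) enc"] by (rule image_cong) (use i in auto)
    then show ?thesis by simp
  qed
  have inj: "inj_on (inv enc) {1..9}" using e by (metis inj_onI)
  have p: "partition_on {1..9} P" using P by (simp add: sudoku_partition_def)
  have u: "inv enc ` {1..9} = UNIV" unfolding range_enc [symmetric] by (auto simp: image_image inj_enc)
  have "{} \<notin> (`) (inv enc) ` P" using partition_onD3 [OF p] by auto
  then have "partition_on UNIV ((`) (inv enc) ` P)"
    using partition_on_inj_image [OF p inj] by (simp add: u)
  moreover have "card ((`) (inv enc) ` P) = card P"
    by (rule card_image) (metis i inj_onI)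
  moreover have "card (inv enc ` A) = card A" if "A \<in> P" for A
    by (rule card_image) (rule inj_on_subset [OF inj sub [OF that]])
  ultimately have "sudoku_partition 3 UNIV ((`) (inv enc) ` P)"
    using P by (auto simp: sudoku_partition_def card_pt)
  with im show "\<exists>Q. P = (`) enc ` Q \<and> sudoku_partition 3 UNIV Q" by metis
next
  assume "\<exists>Q. P = (`) enc ` Q \<and> sudoku_partition 3 UNIV Q"
  then show "sudoku_partition 3 {1..9} P"
    using sudoku_partition_image [OF inj_enc, of 3 UNIV] range_enc by auto
qed

lemma tri_of_inj: "inj tri_of"
proof (rule injI)
  fix Q Q' assume e: "tri_of Q = tri_of Q'"
  have i: "inj ((`) ((`) enc))" using inj_enc by (simp add: inj_image_eq_iff inj_def)
  show "Q = Q'"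
    using e by (intro ext3 [of Q 0 Q']) (simp_all add: tri_of_def inj_eq [OF i])
qed

definition tri_partition_rel :: "config set \<Rightarrow> (z3 \<Rightarrow> pt set set) \<Rightarrow> bool" where
  "tri_partition_rel R Q \<longleftrightarrow> (\<forall>c. sudoku_partition 3 UNIV (Q c)) \<and> divides R Q"

lemma sudoku_tri_partition_enc:
  "sudoku_tri_partition 3 {1..9} T \<longleftrightarrow> (\<exists>Q. T = tri_of Q \<and> (\<forall>c. sudoku_partition 3 UNIV (Q c)))"
proof
  assume "sudoku_tri_partition 3 {1..9} T"
  moreover obtain A' B' C' where "T = (A', B', C')" by (cases T)
  ultimately obtain A B C where T: "T = ((`) enc ` A, (`) enc ` B, (`) enc ` C)"
    and s: "sudoku_partition 3 UNIV A" "sudoku_partition 3 UNIV B" "sudoku_partition 3 UNIV C"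
    unfolding sudoku_tri_partition_def sudoku_partition_enc by auto
  define Q where "Q c = (if c = 0 then A else if c = 1 then B else C)" for c :: z3
  have "T = tri_of Q" "\<forall>c. sudoku_partition 3 UNIV (Q c)"
    using T s by (simp_all add: tri_of_def Q_def)
  then show "\<exists>Q. T = tri_of Q \<and> (\<forall>c. sudoku_partition 3 UNIV (Q c))" by blast
qed (auto simp: sudoku_tri_partition_def tri_of_def sudoku_partition_enc)

lemma divides_cfg:
  "divides R Q \<longleftrightarrow>
    (\<forall>A\<in>Q 0. \<forall>C\<in>Q 1. \<forall>r. \<exists>p\<in>A. \<exists>q\<in>C. cfg p q r \<in> R) \<and>
    (\<forall>A\<in>Q 0. \<forall>C\<in>Q (-1). \<forall>q. \<exists>p\<in>A. \<exists>r\<in>C. cfg p q r \<in> R) \<and>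
    (\<forall>A\<in>Q 1. \<forall>C\<in>Q (-1). \<forall>p. \<exists>q\<in>A. \<exists>r\<in>C. cfg p q r \<in> R)"
proof -
  have b: "(\<exists>v\<in>R. P v) \<longleftrightarrow> (\<exists>p q r. cfg p q r \<in> R \<and> P (cfg p q r))" for P
    using ex_cfg [of "\<lambda>v. v \<in> R \<and> P v"] by (auto simp: Bex_def)
  have e: "(\<exists>v\<in>R. v 0 \<in> A \<and> v 1 \<in> C \<and> v (-1) = r) \<longleftrightarrow> (\<exists>p\<in>A. \<exists>q\<in>C. cfg p q r \<in> R)"
    "(\<exists>v\<in>R. v 1 \<in> A \<and> v (-1) \<in> C \<and> v 0 = p) \<longleftrightarrow> (\<exists>q\<in>A. \<exists>r\<in>C. cfg p q r \<in> R)"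
    "(\<exists>v\<in>R. v (-1) \<in> C \<and> v 0 \<in> A \<and> v 1 = q) \<longleftrightarrow> (\<exists>p\<in>A. \<exists>r\<in>C. cfg p q r \<in> R)" for A C p q r
    unfolding b cfg_simps by blast+
  have "divides R Q \<longleftrightarrow>
    (\<forall>A\<in>Q 0. \<forall>C\<in>Q 1. \<forall>r. \<exists>v\<in>R. v 0 \<in> A \<and> v 1 \<in> C \<and> v (-1) = r) \<and>
    (\<forall>A\<in>Q 1. \<forall>C\<in>Q (-1). \<forall>p. \<exists>v\<in>R. v 1 \<in> A \<and> v (-1) \<in> C \<and> v 0 = p) \<and>
    (\<forall>C\<in>Q (-1). \<forall>A\<in>Q 0. \<forall>q. \<exists>v\<in>R. v (-1) \<in> C \<and> v 0 \<in> A \<and> v 1 = q)"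
  proof -
    have t: "0 - 1 = (-1::z3)" "1 + 1 = (-1::z3)" "0 + 1 = (1::z3)" "1 - 1 = (0::z3)" "-1 + 1 = (0::z3)" "-1 - 1 = (1::z3)"
      by (simp_all only: z3_const plus_z3.simps uminus_z3.simps)
    show ?thesis unfolding divides_def z3_all [where P = "\<lambda>c. \<forall>A\<in>Q c. \<forall>C\<in>Q (c + 1). \<forall>p. \<exists>v\<in>R. v c \<in> A \<and> v (c + 1) \<in> C \<and> v (c - 1) = p"] t ..
  qed
  then show ?thesis unfolding e by blast
qed

lemma division_sudoku_rel:
  "division_sudoku 3 {1..9} (tri_of Q) L \<longleftrightarrow> latin_rel (rel_of L) \<and> tri_partition_rel (rel_of L) Q"
proof -
  have s: "sudoku_tri_partition 3 {1..9} (tri_of Q) \<longleftrightarrow> (\<forall>c. sudoku_partition 3 UNIV (Q c))"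
    unfolding sudoku_tri_partition_enc by (auto simp: inj_eq [OF tri_of_inj])
  have oa: "(x, y, z) \<in> orthogonal_array {1..9} L \<longleftrightarrow> x \<in> {1..9} \<and> y \<in> {1..9} \<and> L x y = z" for x y z
    unfolding orthogonal_array_def by auto
  have sub: "x \<in> enc ` A \<Longrightarrow> x \<in> {1..9}" for x A using range_enc by blast
  have b: "(\<exists>x y. (x, y, enc r) \<in> band {1..9} L (enc ` A) \<inter> stack {1..9} L (enc ` C))
      \<longleftrightarrow> (\<exists>p\<in>A. \<exists>q\<in>C. L (enc p) (enc q) = enc r)" for r A C
  proof -
    have "(x, y, z) \<in> band {1..9} L (enc ` A) \<inter> stack {1..9} L (enc ` C) \<longleftrightarrow> x \<in> enc ` A \<and> y \<in> enc ` C \<and> L x y = z" for x y z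
      by (auto simp: band_def stack_def oa simp del: atLeastAtMost_iff dest: sub)
    note m = this
    show ?thesis unfolding m by blast
  qed
  have c: "(\<exists>x z. (x, enc q, z) \<in> band {1..9} L (enc ` A) \<inter> pile {1..9} L (enc ` C))
      \<longleftrightarrow> (\<exists>p\<in>A. \<exists>r\<in>C. L (enc p) (enc q) = enc r)" for q A C
  proof -
    have "(x, enc q, z) \<in> band {1..9} L (enc ` A) \<inter> pile {1..9} L (enc ` C) \<longleftrightarrow> x \<in> enc ` A \<and> z \<in> enc ` C \<and> L x (enc q) = z" for x z
      by (auto simp: band_def pile_def oa simp del: atLeastAtMost_iff dest: sub)
    note m = this
    show ?thesis unfolding m by blast
  qed
  have d: "(\<exists>y z. (enc p, y, z) \<in> stack {1..9} L (enc ` A) \<inter> pile {1..9} L (enc ` C))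
      \<longleftrightarrow> (\<exists>q\<in>A. \<exists>r\<in>C. L (enc p) (enc q) = enc r)" for p A C
  proof -
    have "(enc p, y, z) \<in> stack {1..9} L (enc ` A) \<inter> pile {1..9} L (enc ` C) \<longleftrightarrow> y \<in> enc ` A \<and> z \<in> enc ` C \<and> L (enc p) y = z" for y z
      by (auto simp: stack_def pile_def oa simp del: atLeastAtMost_iff dest: sub)
    note m = this
    show ?thesis unfolding m by blast
  qed
  show ?thesis
    unfolding division_sudoku_def latin_square_rel s tri_partition_rel_def divides_cfg cfg_rel_of
    unfolding tri_of_def prod.case ball_simps ball_enc b c d by (rule refl)
qed

text \<open>With this the value \<open>\<pi>\<close> can be studied on sets of triples.\<close>
lemma tri_partition_count_rel:
  assumes "latin_rel (rel_of L)"
  shows "tri_partition_count L = card {Q. tri_partition_rel (rel_of L) Q}"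
proof -
  have "{T. sudoku_tri_partition 3 {1..9} T \<and> division_sudoku 3 {1..9} T L} = tri_of ` {Q. tri_partition_rel (rel_of L) Q}"
    using assms by (auto simp: sudoku_tri_partition_enc division_sudoku_rel tri_partition_rel_def)
  then show ?thesis unfolding tri_partition_count_def
    by (simp add: card_image inj_on_subset [OF tri_of_inj])
qed

lemma sudoku_partition_fibres: "sudoku_partition 3 UNIV fibres"
proof -
  have "inj (\<lambda>i::z3. {i} \<times> (UNIV :: z3 set))" by (auto intro!: injI)
  from card_image [OF this] have "card fibres = 3" by (simp add: fibres_def card_z3)
  moreover have "card ({i} \<times> (UNIV :: z3 set)) = 3" for i :: z3
    by (simp add: card_cartesian_product card_z3)
  moreover have "partition_on UNIV fibres" by (auto simp: partition_on_def disjoint_def fibres_def)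
  ultimately show ?thesis
    unfolding sudoku_partition_def by (simp add: card_pt) (auto simp: fibres_def)
qed

lemma tri_of_fibres: "tri_of (\<lambda>_. fibres) = (standard_partition, standard_partition, standard_partition)"
proof -
  have "enc ` ({i} \<times> UNIV) = {enc (i, Z0), enc (i, Z1), enc (i, Z2)}" for i
  proof -
    have "{i} \<times> (UNIV :: z3 set) = range (Pair i)" by auto
    then show ?thesis by (simp only: image_image range_z3 image_insert image_empty)
  qed
  note im = this
  have "enc (Z0, Z0) = 1" "enc (Z0, Z1) = 2" "enc (Z0, Z2) = 3" "enc (Z1, Z0) = 4" "enc (Z1, Z1) = 5"
      "enc (Z1, Z2) = 6" "enc (Z2, Z0) = 7" "enc (Z2, Z1) = 8" "enc (Z2, Z2) = 9"
    by (simp_all only: enc_def fst_conv snd_conv z3_nat.simps)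
  then have "(`) enc ` fibres = standard_partition"
    unfolding fibres_def range_z3 standard_partition_def by (simp only: image_insert image_empty im)
  then show ?thesis by (simp add: tri_of_def)
qed

lemma standard_rel: "standard_division_sudoku L \<longleftrightarrow> ds_rel (rel_of L)"
  unfolding standard_division_sudoku_def tri_of_fibres [symmetric] division_sudoku_rel
  by (simp add: tri_partition_rel_def ds_rel_def sudoku_partition_fibres)

text \<open>Every latin set of triples comes from a square, so representatives of classes can be given as
  sets of triples.\<close>
lemma rel_of_surj:
  assumes "latin_rel R" obtains L where "rel_of L = R"
proof -
  define L where "L x y = enc (THE r. cfg (inv enc x) (inv enc y) r \<in> R)" for x y
  have "L (enc p) (enc q) = enc r \<longleftrightarrow> cfg p q r \<in> R" for p q r
  proof -
    have "\<exists>!v. v \<in> R \<and> v 0 = p \<and> v (0 + 1) = q" using assms unfolding latin_rel_def by blast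
    then have "\<exists>!r. cfg p q r \<in> R" using ex1_cfg(1) [of "\<lambda>v. v \<in> R"] by simp
    then show ?thesis unfolding L_def by (simp add: inj_enc) (metis theI')
  qed
  then have "v \<in> rel_of L \<longleftrightarrow> v \<in> R" for v
    using cfg_rel_of cfg_eta by metis
  then show thesis by (intro that [of L]) auto
qed

lemma divides_any:
  assumes "divides R Q" "c \<noteq> c'" "d \<noteq> c" "d \<noteq> c'" "A \<in> Q c" "C \<in> Q c'"
  shows "\<exists>v\<in>R. v c \<in> A \<and> v c' \<in> C \<and> v d = p"
proof -
  have D: "\<And>c A C p. A \<in> Q c \<Longrightarrow> C \<in> Q (c + 1) \<Longrightarrow> \<exists>v\<in>R. v c \<in> A \<and> v (c + 1) \<in> C \<and> v (c - 1) = p"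
    using assms(1) unfolding divides_def by blast
  consider "c' = c + 1" "d = c - 1" | "c' = c - 1" "d = c + 1"
    using z3_neq_iff [of c c'] z3_neq_iff [of c d] assms(2-4) by auto
  then show ?thesis
  proof cases
    case 1 then show ?thesis using D [of A c C p] assms(5,6) by auto
  next
    case 2 then show ?thesis using D [of C c' A p] assms(5,6) by auto
  qed
qed

lemma tri_partition_rel_transfer:
  assumes th: "bij \<theta>" and ps: "\<And>c. bij (\<psi> c)" and R: "\<And>v. v \<in> R \<longleftrightarrow> (\<lambda>c. \<psi> c (v (\<theta> c))) \<in> R'"
    and Q: "tri_partition_rel R Q"
  shows "tri_partition_rel R' (\<lambda>c. (`) (\<psi> c) ` Q (\<theta> c))"
  unfolding tri_partition_rel_def
proof
  show "\<forall>c. sudoku_partition 3 UNIV ((`) (\<psi> c) ` Q (\<theta> c))"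
  proof
    fix c
    have "sudoku_partition 3 UNIV (Q (\<theta> c))" using Q by (simp add: tri_partition_rel_def)
    from sudoku_partition_image [OF bij_is_inj [OF ps [of c]] this]
    show "sudoku_partition 3 UNIV ((`) (\<psi> c) ` Q (\<theta> c))" using bij_is_surj [OF ps [of c]] by simp
  qed
  have inj: "\<theta> c = \<theta> c' \<longleftrightarrow> c = c'" for c c' using th by (simp add: bij_def inj_eq)
  have dv: "divides R Q" using Q by (simp add: tri_partition_rel_def)
  show "divides R' (\<lambda>c. (`) (\<psi> c) ` Q (\<theta> c))"
    unfolding divides_def
  proof (intro allI ballI)
    fix c A C p
    assume "A \<in> (`) (\<psi> c) ` Q (\<theta> c)" "C \<in> (`) (\<psi> (c + 1)) ` Q (\<theta> (c + 1))"
    then obtain A' C' where A: "A = \<psi> c ` A'" "A' \<in> Q (\<theta> c)" and C: "C = \<psi> (c + 1) ` C'" "C' \<in> Q (\<theta> (c + 1))" by blast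
    obtain p' where p: "p = \<psi> (c - 1) p'" using bij_is_surj [OF ps [of "c - 1"]] by (metis surjD)
    obtain v where v: "v \<in> R" "v (\<theta> c) \<in> A'" "v (\<theta> (c + 1)) \<in> C'" "v (\<theta> (c - 1)) = p'"
      using divides_any [OF dv _ _ _ A(2) C(2), of "\<theta> (c - 1)" p'] by (auto simp: inj)
    then show "\<exists>v\<in>R'. v c \<in> A \<and> v (c + 1) \<in> C \<and> v (c - 1) = p"
      using R [of v] by (intro bexI [of _ "\<lambda>c. \<psi> c (v (\<theta> c))"]) (auto simp: A C p)
  qed
qed

lemma card_tri_partition_rel_le:
  assumes "ds_equiv R R'"
  shows "card {Q. tri_partition_rel R Q} \<le> card {Q. tri_partition_rel R' Q}"
proof -
  from assms obtain \<theta> \<psi> where th: "bij \<theta>" and bm: "\<And>c. block_map (\<psi> c)"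
     and R: "\<And>v. v \<in> R \<longleftrightarrow> (\<lambda>c. \<psi> c (v (\<theta> c))) \<in> R'"
    unfolding ds_equiv_def by blast
  have ps: "\<And>c. bij (\<psi> c)" using bm by (simp add: block_map_def)
  let ?f = "\<lambda>Q c. (`) (\<psi> c) ` Q (\<theta> c) :: pt set set"
  have "inj ?f"
  proof (rule injI)
    fix Q Q' :: "z3 \<Rightarrow> pt set set" assume e: "?f Q = ?f Q'"
    have i: "inj ((`) ((`) (\<psi> c)))" for c
      using bij_is_inj [OF ps [of c]] by (simp add: inj_image_eq_iff inj_def)
    have "Q (\<theta> c) = Q' (\<theta> c)" for c using fun_cong [OF e, of c] by (simp add: inj_eq [OF i])
    then show "Q = Q'" using th by (metis bij_pointE ext)
  qed
  then show ?thesis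
    by (rule card_inj_on_le [OF inj_on_subset]) (use tri_partition_rel_transfer [OF th ps R] in auto)
qed

text \<open>An equivalence transports tri-partitions coordinate by coordinate, injectively; applying this to
  the inverse equivalence too gives the invariance of \<open>\<pi>\<close>.\<close>
lemma card_tri_partition_rel_equiv:
  "ds_equiv R R' \<Longrightarrow> card {Q. tri_partition_rel R Q} = card {Q. tri_partition_rel R' Q}"
  using card_tri_partition_rel_le [of R R'] card_tri_partition_rel_le [of R' R] ds_equiv_sym [of R R'] by simp

section \<open>Main ds-classes as orbits\<close>

lemma permutes_transport:
  fixes f :: "'a::finite \<Rightarrow> 'b"
  assumes f: "inj f" "range f = S" and a: "\<alpha> permutes S"
  obtains g where "bij g" "\<And>p. \<alpha> (f p) = f (g p)"
proof -
  define g where "g p = inv f (\<alpha> (f p))" for p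
  have g: "\<alpha> (f p) = f (g p)" for p
  proof -
    have "\<alpha> (f p) \<in> range f" using permutes_in_image [OF a, of "f p"] f(2) by blast
    then show ?thesis unfolding g_def by (rule f_inv_into_f [symmetric])
  qed
  have "inj g"
  proof (rule injI)
    fix p q assume "g p = g q"
    then have "\<alpha> (f p) = \<alpha> (f q)" by (simp only: g)
    then show "p = q" using permutes_inj [OF a] f(1) by (simp add: inj_eq)
  qed
  then have "bij g" by (simp add: bij_def finite_UNIV_inj_surj)
  then show thesis using g by (rule that)
qed

lemma permutes_of_bij:
  assumes f: "inj f" "range f = S" and g: "bij g"
  obtains \<alpha> where "\<alpha> permutes S" "\<And>p. \<alpha> (f p) = f (g p)"
proof -
  define \<alpha> where "\<alpha> x = (if x \<in> S then f (g (inv f x)) else x)" for x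
  have v: "\<alpha> (f p) = f (g p)" for p
  proof -
    have "f p \<in> S" using f(2) by blast
    then show ?thesis by (simp add: \<alpha>_def f(1))
  qed
  have "bij_betw \<alpha> S S"
    unfolding bij_betw_def
  proof
    show "inj_on \<alpha> S"
      unfolding f(2) [symmetric] using f(1) bij_is_inj [OF g] by (auto simp: v inj_eq intro!: inj_onI)
    have "\<alpha> ` S = f ` range g" unfolding f(2) [symmetric] image_image v ..
    then show "\<alpha> ` S = S" using bij_is_surj [OF g] f(2) by simp
  qed
  then have "\<alpha> permutes S" by (rule bij_imp_permutes) (simp add: \<alpha>_def)
  then show thesis using v by (rule that)
qed

lemma standard_partition_enc: "standard_partition = (`) enc ` fibres"
  using tri_of_fibres by (simp add: tri_of_def)

lemma block_permutation_map:
  assumes "block_permutation \<alpha>"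
  obtains \<psi> where "block_map \<psi>" "\<And>p. \<alpha> (enc p) = enc (\<psi> p)"
proof -
  have a: "\<alpha> permutes {1..9}" and bl: "\<And>A. A \<in> standard_partition \<Longrightarrow> \<alpha> ` A \<in> standard_partition"
    using assms by (auto simp: block_permutation_def)
  obtain \<psi> where \<psi>: "bij \<psi>" "\<And>p. \<alpha> (enc p) = enc (\<psi> p)"
    by (rule permutes_transport [OF inj_enc range_enc a], rule that)
  have "\<exists>j. \<forall>x. fst (\<psi> (i, x)) = j" for i
  proof -
    have "enc ` ({i} \<times> UNIV) \<in> standard_partition" unfolding standard_partition_enc fibres_def by blast
    then have "\<alpha> ` enc ` ({i} \<times> UNIV) \<in> standard_partition" by (rule bl)
    then obtain j where "\<alpha> ` enc ` ({i} \<times> UNIV) = enc ` ({j} \<times> UNIV)"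
      unfolding standard_partition_enc fibres_def by blast
    then have "enc ` (\<psi> ` ({i} \<times> UNIV)) = enc ` ({j} \<times> UNIV)" by (simp only: image_image \<psi>(2))
    then have "\<psi> ` ({i} \<times> UNIV) = {j} \<times> UNIV" by (simp only: inj_image_eq_iff [OF inj_enc])
    then have "\<psi> (i, x) \<in> {j} \<times> UNIV" for x by blast
    then show ?thesis by (auto simp: mem_Times_iff)
  qed
  then obtain \<pi> where "\<And>i x. fst (\<psi> (i, x)) = \<pi> i" by metis
  then have "fst (\<psi> p) = \<pi> (fst p)" for p by (cases p) simp
  then have "block_map \<psi>" using \<psi>(1) unfolding block_map_def by blast
  then show thesis using \<psi>(2) by (rule that)
qed

lemma block_map_permutation:
  assumes "block_map \<psi>"
  obtains \<alpha> where "block_permutation \<alpha>" "\<And>p. \<alpha> (enc p) = enc (\<psi> p)"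
proof -
  have "bij \<psi>" using assms by (simp add: block_map_def)
  note b = this
  obtain \<alpha> where a: "\<alpha> permutes {1..9}" "\<And>p. \<alpha> (enc p) = enc (\<psi> p)"
    by (rule permutes_of_bij [OF inj_enc range_enc b], rule that)
  obtain m n V W where m: "m \<noteq> 0" "\<And>i. V i \<noteq> 0" "\<And>i a. \<psi> (i, a) = (m * i + n, V i * a + W i)"
    by (rule block_map_affine [OF assms], rule that)
  have im: "\<psi> ` ({i} \<times> UNIV) = {m * i + n} \<times> UNIV" for i
  proof -
    have "\<psi> ` ({i} \<times> UNIV) = (\<lambda>a. (m * i + n, V i * a + W i)) ` UNIV" 
    proof -
      have "{i} \<times> (UNIV :: z3 set) = range (Pair i)" by auto
      then show ?thesis by (simp only: image_image m(3))
    qed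
    also have "\<dots> = {m * i + n} \<times> range (\<lambda>a. V i * a + W i)" by auto
    also have "range (\<lambda>a. V i * a + W i) = UNIV" by (rule bij_is_surj [OF bij_affine [OF m(2)]])
    finally show ?thesis .
  qed
  have "\<alpha> ` enc ` ({i} \<times> UNIV) = enc ` ({m * i + n} \<times> UNIV)" for i
  proof -
    have "\<alpha> ` enc ` ({i} \<times> UNIV) = enc ` \<psi> ` ({i} \<times> UNIV)" by (simp only: image_image a(2))
    then show ?thesis by (simp only: im)
  qed
  then have "\<forall>A\<in>standard_partition. \<alpha> ` A \<in> standard_partition"
    unfolding standard_partition_enc fibres_def by blast
  then have "block_permutation \<alpha>" using a(1) by (simp add: block_permutation_def)
  then show thesis using a(2) by (rule that)
qed

lemma ds_isotopic_rel:
  assumes lat: "latin_rel (rel_of L1)"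
  shows "ds_isotopic L1 L2 \<longleftrightarrow> (\<exists>\<psi>. (\<forall>c. block_map (\<psi> c)) \<and>
     (\<forall>v. v \<in> rel_of L1 \<longleftrightarrow> (\<lambda>c. \<psi> c (v c)) \<in> rel_of L2))"
proof
  assume "ds_isotopic L1 L2"
  then obtain \<alpha> \<beta> \<gamma> where b: "block_permutation \<alpha>" "block_permutation \<beta>" "block_permutation \<gamma>"
    and L: "\<And>x y. x \<in> {1..9} \<Longrightarrow> y \<in> {1..9} \<Longrightarrow> L2 (\<alpha> x) (\<beta> y) = \<gamma> (L1 x y)"
    unfolding ds_isotopic_def by blast
  have LL: "L2 (\<alpha> (enc p)) (\<beta> (enc q)) = \<gamma> (L1 (enc p) (enc q))" for p q
    by (rule L) (rule enc_mem)+
  obtain f where f: "block_map f" "\<And>p. \<alpha> (enc p) = enc (f p)" by (rule block_permutation_map [OF b(1)], rule that)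
  obtain g where g: "block_map g" "\<And>p. \<beta> (enc p) = enc (g p)" by (rule block_permutation_map [OF b(2)], rule that)
  obtain h where h: "block_map h" "\<And>p. \<gamma> (enc p) = enc (h p)" by (rule block_permutation_map [OF b(3)], rule that)
  have inj: "\<gamma> x = \<gamma> y \<longleftrightarrow> x = y" for x y
    using b(3) permutes_inj [of \<gamma> "{1..9}"] by (simp add: block_permutation_def inj_eq)
  define \<psi> where "\<psi> c = (if c = 0 then f else if c = 1 then g else h)" for c :: z3
  have "block_map (\<psi> c)" for c by (simp add: \<psi>_def f g h)
  moreover have "v \<in> rel_of L1 \<longleftrightarrow> (\<lambda>c. \<psi> c (v c)) \<in> rel_of L2" for v
    by (simp add: rel_of_def \<psi>_def LL inj flip: f(2) g(2) h(2))
  ultimately show "\<exists>\<psi>. (\<forall>c. block_map (\<psi> c)) \<and> (\<forall>v. v \<in> rel_of L1 \<longleftrightarrow> (\<lambda>c. \<psi> c (v c)) \<in> rel_of L2)"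
    by blast
next
  assume "\<exists>\<psi>. (\<forall>c. block_map (\<psi> c)) \<and> (\<forall>v. v \<in> rel_of L1 \<longleftrightarrow> (\<lambda>c. \<psi> c (v c)) \<in> rel_of L2)"
  then obtain \<psi> where \<psi>: "\<And>c. block_map (\<psi> c)" and R: "\<And>v. v \<in> rel_of L1 \<longleftrightarrow> (\<lambda>c. \<psi> c (v c)) \<in> rel_of L2"
    by blast
  obtain \<alpha> where f: "block_permutation \<alpha>" "\<And>p. \<alpha> (enc p) = enc (\<psi> 0 p)" by (rule block_map_permutation [OF \<psi>], rule that)
  obtain \<beta> where g: "block_permutation \<beta>" "\<And>p. \<beta> (enc p) = enc (\<psi> 1 p)" by (rule block_map_permutation [OF \<psi>], rule that)
  obtain \<gamma> where h: "block_permutation \<gamma>" "\<And>p. \<gamma> (enc p) = enc (\<psi> (-1) p)" by (rule block_map_permutation [OF \<psi>], rule that)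
  have "L2 (\<alpha> (enc p)) (\<beta> (enc q)) = \<gamma> (L1 (enc p) (enc q))" for p q
  proof -
    have "\<exists>!r. L1 (enc p) (enc q) = enc r" using conjunct1 [OF lat [unfolded latin_rel_of]] by (elim allE)
    then obtain r where r: "L1 (enc p) (enc q) = enc r" by (elim ex1E)
    then have "cfg p q r \<in> rel_of L1" by simp
    then have "(\<lambda>c. \<psi> c (cfg p q r c)) \<in> rel_of L2" by (simp only: R)
    then have "L2 (enc (\<psi> 0 p)) (enc (\<psi> 1 q)) = enc (\<psi> (-1) r)" by (simp add: rel_of_def)
    then show ?thesis by (simp only: f(2) g(2) h(2) r)
  qed
  then have "\<forall>x\<in>{1..9}. \<forall>y\<in>{1..9}. L2 (\<alpha> x) (\<beta> y) = \<gamma> (L1 x y)" unfolding ball_enc by blast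
  then show "ds_isotopic L1 L2" using f(1) g(1) h(1) unfolding ds_isotopic_def by blast
qed

fun idx :: "z3 \<Rightarrow> nat" where
  "idx Z0 = 1" | "idx Z1 = 2" | "idx Z2 = 3"

lemma inj_idx: "inj idx"
proof (rule injI)
  fix c d assume "idx c = idx d" then show "c = d" by (cases c; cases d) simp_all
qed

lemma range_idx: "range idx = {1..3}"
  unfolding range_z3 by (auto simp: numeral_3_eq_3 numeral_2_eq_2 One_nat_def atLeastAtMostSuc_conv)

definition triple :: "config \<Rightarrow> nat \<times> nat \<times> nat" where
  "triple v = (enc (v 0), enc (v 1), enc (v (-1)))"

lemma coord_triple: "coord (triple v) (idx c) = enc (v c)"
  by (cases c) (simp_all add: triple_def z3_const)

lemma orthogonal_array_rel:
  assumes lat: "latin_rel (rel_of L)"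
  shows "orthogonal_array {1..9} L = triple ` rel_of L"
proof (intro equalityI subsetI)
  fix t assume "t \<in> orthogonal_array {1..9} L"
  then obtain x y where t: "t = (x, y, L x y)" "x \<in> {1..9}" "y \<in> {1..9}" unfolding orthogonal_array_def by blast
  then obtain p q where pq: "x = enc p" "y = enc q" unfolding range_enc [symmetric] by blast
  have "\<exists>!r. L (enc p) (enc q) = enc r" using conjunct1 [OF lat [unfolded latin_rel_of]] by (elim allE)
  then obtain r where r: "L (enc p) (enc q) = enc r" by (elim ex1E)
  then have "t = triple (cfg p q r)" using t pq by (simp add: triple_def)
  then show "t \<in> triple ` rel_of L" using r by auto
next
  fix t assume "t \<in> triple ` rel_of L"
  then obtain v where v: "t = triple v" "L (enc (v 0)) (enc (v 1)) = enc (v (-1))" by (auto simp: rel_of_def)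
  then have "t = (enc (v 0), enc (v 1), L (enc (v 0)) (enc (v 1)))" by (simp add: triple_def)
  then show "t \<in> orthogonal_array {1..9} L" unfolding orthogonal_array_def using enc_mem by blast
qed

lemma latin_any:
  assumes lat: "latin_rel R" and c: "c \<noteq> c'"
  shows "\<exists>v\<in>R. v c = p \<and> v c' = q"
    and "v \<in> R \<Longrightarrow> w \<in> R \<Longrightarrow> v c = w c \<Longrightarrow> v c' = w c' \<Longrightarrow> v = w"
proof -
  have ex: "\<exists>v\<in>R. v c = p \<and> v (c + 1) = q" for c p q
  proof -
    have "\<exists>!v. v \<in> R \<and> v c = p \<and> v (c + 1) = q" using lat unfolding latin_rel_def by (elim allE)
    then show ?thesis by (elim ex1E) auto
  qed
  show "\<exists>v\<in>R. v c = p \<and> v c' = q"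
    using c [unfolded z3_neq_iff] ex [of c p q] ex [of c' q p] by auto
  show "v = w" if "v \<in> R" "w \<in> R" "v c = w c" "v c' = w c'"
    using c [unfolded z3_neq_iff] latin_rel_unique [OF lat that(1,2), of c] latin_rel_unique [OF lat that(1,2), of c'] that(3,4) by auto
qed

text \<open>Conjugation permutes the coordinates of the triples; the description operator in
  \<open>conjugate\<close> is well defined because any two coordinates determine the third.\<close>
lemma rel_of_conjugate:
  assumes lat: "latin_rel (rel_of L)" and g: "bij g" and th: "\<And>c. \<theta> (idx c) = idx (g c)"
  shows "rel_of (conjugate {1..9} \<theta> L) = (\<lambda>w. w \<circ> g) ` rel_of L"
proof -
  have pt: "permute_triple \<theta> (triple w) = triple (w \<circ> g)" for w
  proof -
    have "\<theta> 1 = idx (g 0)" "\<theta> 2 = idx (g 1)" "\<theta> 3 = idx (g (-1))"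
      using th [of 0] th [of 1] th [of "-1"] by (simp_all add: z3_const)
    then show ?thesis unfolding permute_triple_def by (simp only: coord_triple) (simp add: triple_def)
  qed
  have im: "permute_triple \<theta> ` orthogonal_array {1..9} L = (\<lambda>w. triple (w \<circ> g)) ` rel_of L"
    unfolding orthogonal_array_rel [OF lat] image_image pt ..
  have g01: "g 0 \<noteq> g 1" using bij_is_inj [OF g] by (simp add: inj_eq)
  have val: "conjugate {1..9} \<theta> L (enc (w (g 0))) (enc (w (g 1))) = enc (w (g (-1)))" if w: "w \<in> rel_of L" for w
    unfolding conjugate_def im
  proof (rule the_equality)
    show "(enc (w (g 0)), enc (w (g 1)), enc (w (g (-1)))) \<in> (\<lambda>w. triple (w \<circ> g)) ` rel_of L"
      using w by (intro image_eqI [of _ _ w]) (simp_all add: triple_def)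
    fix z assume "(enc (w (g 0)), enc (w (g 1)), z) \<in> (\<lambda>w. triple (w \<circ> g)) ` rel_of L"
    then obtain w' where w': "w' \<in> rel_of L" "w' (g 0) = w (g 0)" "w' (g 1) = w (g 1)" "z = enc (w' (g (-1)))"
      by (auto simp: triple_def)
    have "w' = w" by (rule latin_any(2) [OF lat g01 w'(1) w w'(2,3)])
    then show "z = enc (w (g (-1)))" using w'(4) by simp
  qed
  show ?thesis
  proof (intro equalityI subsetI)
    fix v assume v: "v \<in> rel_of (conjugate {1..9} \<theta> L)"
    obtain w where w: "w \<in> rel_of L" "w (g 0) = v 0" "w (g 1) = v 1" using latin_any(1) [OF lat g01] by blast
    have "enc (w (g (-1))) = enc (v (-1))" using v val [OF w(1)] w(2,3) by (simp add: rel_of_def)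
    then have "v = w \<circ> g" using w(2,3) by (intro ext3 [of v 0]) simp_all
    then show "v \<in> (\<lambda>w. w \<circ> g) ` rel_of L" using w(1) by blast
  next
    fix v assume "v \<in> (\<lambda>w. w \<circ> g) ` rel_of L"
    then obtain w where "w \<in> rel_of L" "v = w \<circ> g" by blast
    then show "v \<in> rel_of (conjugate {1..9} \<theta> L)" using val [of w] by (simp add: rel_of_def)
  qed
qed

lemma image_comp_mem: "bij g \<Longrightarrow> v \<in> (\<lambda>w. w \<circ> g) ` R \<longleftrightarrow> v \<circ> inv g \<in> R"
proof
  assume g: "bij g" and "v \<circ> inv g \<in> R"
  moreover have "v = (v \<circ> inv g) \<circ> g" using g by (simp add: comp_assoc bij_def)
  ultimately show "v \<in> (\<lambda>w. w \<circ> g) ` R" by (rule_tac image_eqI)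
next
  assume g: "bij g" and "v \<in> (\<lambda>w. w \<circ> g) ` R"
  then obtain w where w: "w \<in> R" "v = w \<circ> g" by blast
  have "v \<circ> inv g = w" unfolding w(2) using g by (simp add: comp_assoc bij_def surj_iff)
  then show "v \<circ> inv g \<in> R" using w(1) by simp
qed

lemma main_ds_rel_iff:
  "(L1, L2) \<in> main_ds_rel \<longleftrightarrow> standard_division_sudoku L1 \<and> standard_division_sudoku L2 \<and> ds_equiv (rel_of L1) (rel_of L2)"
proof -
  have "(\<exists>\<theta>. \<theta> permutes {1..3} \<and> ds_isotopic L1 (conjugate {1..9} \<theta> L2)) \<longleftrightarrow> ds_equiv (rel_of L1) (rel_of L2)"
    if s: "standard_division_sudoku L1" "standard_division_sudoku L2"
  proof -
    have lat: "latin_rel (rel_of L1)" "latin_rel (rel_of L2)" using s by (simp_all add: standard_rel ds_rel_def)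
    show ?thesis
    proof
      assume "\<exists>\<theta>. \<theta> permutes {1..3} \<and> ds_isotopic L1 (conjugate {1..9} \<theta> L2)"
      then obtain \<theta> where th: "\<theta> permutes {1..3}" and iso: "ds_isotopic L1 (conjugate {1..9} \<theta> L2)" by blast
      obtain g where g: "bij g" "\<And>c. \<theta> (idx c) = idx (g c)" by (rule permutes_transport [OF inj_idx range_idx th], rule that)
      from iso obtain \<psi> where \<psi>: "\<And>c. block_map (\<psi> c)"
        and R: "\<And>v. v \<in> rel_of L1 \<longleftrightarrow> (\<lambda>c. \<psi> c (v c)) \<in> rel_of (conjugate {1..9} \<theta> L2)"
        unfolding ds_isotopic_rel [OF lat(1)] by blast
      have "v \<in> rel_of L1 \<longleftrightarrow> (\<lambda>c. \<psi> (inv g c) (v (inv g c))) \<in> rel_of L2" for v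
        unfolding R rel_of_conjugate [OF lat(2) g] image_comp_mem [OF g(1)] unfolding comp_def ..
      then show "ds_equiv (rel_of L1) (rel_of L2)"
        unfolding ds_equiv_def
        by (intro exI [of _ "inv g"] exI [of _ "\<lambda>c. \<psi> (inv g c)"]) (simp add: \<psi> bij_imp_bij_inv [OF g(1)])
    next
      assume "ds_equiv (rel_of L1) (rel_of L2)"
      then obtain \<theta> \<psi> where th: "bij \<theta>" and \<psi>: "\<And>c. block_map (\<psi> c)"
        and R: "\<And>v. v \<in> rel_of L1 \<longleftrightarrow> (\<lambda>c. \<psi> c (v (\<theta> c))) \<in> rel_of L2"
        unfolding ds_equiv_def by blast
      have g: "bij (inv \<theta>)" by (rule bij_imp_bij_inv [OF th])
      obtain \<tau> where t: "\<tau> permutes {1..3}" "\<And>c. \<tau> (idx c) = idx (inv \<theta> c)"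
        by (rule permutes_of_bij [OF inj_idx range_idx g], rule that)
      have "inv (inv \<theta>) = \<theta>" by (rule inv_inv_eq [OF th])
      moreover have "inv \<theta> (\<theta> c) = c" for c using bij_is_inj [OF th] by simp
      ultimately have "v \<in> rel_of L1 \<longleftrightarrow> (\<lambda>c. \<psi> (inv \<theta> c) (v c)) \<in> rel_of (conjugate {1..9} \<tau> L2)" for v
        unfolding R rel_of_conjugate [OF lat(2) g t(2)] image_comp_mem [OF g] by (simp add: comp_def)
      then have "ds_isotopic L1 (conjugate {1..9} \<tau> L2)"
        unfolding ds_isotopic_rel [OF lat(1)] using \<psi> by (intro exI [of _ "\<lambda>c. \<psi> (inv \<theta> c)"]) simp
      then show "\<exists>\<theta>. \<theta> permutes {1..3} \<and> ds_isotopic L1 (conjugate {1..9} \<theta> L2)" using t(1) by blast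
    qed
  qed
  then show ?thesis unfolding main_ds_rel_def by auto
qed

section \<open>Signatures as data\<close>

text \<open>A signature is stored as three matrices of nine entries, in the order of the coordinates
  \<open>0\<close>, \<open>1\<close>, \<open>-1\<close>. Functions on such data are written with nested conditionals, whose branches are only
  evaluated when they are needed.\<close>
datatype mat = Mat z3 z3 z3 z3 z3 z3 z3 z3 z3

fun at :: "mat \<Rightarrow> z3 \<Rightarrow> z3 \<Rightarrow> z3" where
  "at (Mat a b c d e f g h i) Z0 Z0 = a"
| "at (Mat a b c d e f g h i) Z0 Z1 = b"
| "at (Mat a b c d e f g h i) Z0 Z2 = c"
| "at (Mat a b c d e f g h i) Z1 Z0 = d"
| "at (Mat a b c d e f g h i) Z1 Z1 = e"
| "at (Mat a b c d e f g h i) Z1 Z2 = f"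
| "at (Mat a b c d e f g h i) Z2 Z0 = g"
| "at (Mat a b c d e f g h i) Z2 Z1 = h"
| "at (Mat a b c d e f g h i) Z2 Z2 = i"

definition mat_of :: "(z3 \<Rightarrow> z3 \<Rightarrow> z3) \<Rightarrow> mat" where
  "mat_of M = Mat (M Z0 Z0) (M Z0 Z1) (M Z0 Z2) (M Z1 Z0) (M Z1 Z1) (M Z1 Z2) (M Z2 Z0) (M Z2 Z1) (M Z2 Z2)"

lemma at_mat_of [simp]: "at (mat_of M) = M"
proof (intro ext)
  fix i j show "at (mat_of M) i j = M i j" by (cases i; cases j) (simp_all add: mat_of_def)
qed

lemma mat_of_at: "mat_of (at A) = A"
  by (cases A) (simp add: mat_of_def)

type_synonym sig = "mat \<times> mat \<times> mat"

fun decode :: "sig \<Rightarrow> z3 \<Rightarrow> z3 \<Rightarrow> z3 \<Rightarrow> z3" where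
  "decode (A, B, C) Z0 i j = at A i j"
| "decode (A, B, C) Z1 i j = at B i j"
| "decode (A, B, C) Z2 i j = at C i j"

definition sig_of :: "coeffs \<Rightarrow> sig" where
  "sig_of E = (mat_of (E Z0), mat_of (E Z1), mat_of (E Z2))"

lemma decode_sig_of [simp]: "decode (sig_of E) = E"
proof (intro ext)
  fix c i j show "decode (sig_of E) c i j = E c i j" by (cases c) (simp_all add: sig_of_def)
qed

lemma sig_of_decode: "sig_of (decode r) = r"
proof -
  obtain A B C where r: "r = (A, B, C)" by (cases r)
  have "decode r Z0 = at A" "decode r Z1 = at B" "decode r Z2 = at C" by (simp_all add: r fun_eq_iff)
  then show ?thesis by (simp add: sig_of_def mat_of_at r)
qed

datatype 'a tri = Tri 'a 'a 'a

fun app :: "'a tri \<Rightarrow> z3 \<Rightarrow> 'a" where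
  "app (Tri a b c) Z0 = a" | "app (Tri a b c) Z1 = b" | "app (Tri a b c) Z2 = c"

lemma app_Tri: "app (Tri (f Z0) (f Z1) (f Z2)) = f"
proof
  fix x show "app (Tri (f Z0) (f Z1) (f Z2)) x = f x" by (cases x) simp_all
qed

text \<open>A move \<open>(r, h, e, (m0, n0), (m1, n1), (m2, n2))\<close> lists the parameters of \<open>act\<close>.\<close>
type_synonym move = "bool \<times> z3 \<times> z3 \<times> (z3 \<times> z3) \<times> (z3 \<times> z3) \<times> (z3 \<times> z3)"

fun move_act :: "move \<Rightarrow> coeffs \<Rightarrow> z3 \<Rightarrow> z3 \<Rightarrow> z3 \<Rightarrow> z3" where
  "move_act (r, h, e, (m0, n0), (m1, n1), (m2, n2)) E = act r h e (app (Tri m0 m1 m2)) (app (Tri n0 n1 n2)) E"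

text \<open>The lexicographic order of the signs read off at the given positions, with \<open>Z1\<close>, that is \<open>1\<close>,
  before \<open>Z2\<close>, that is \<open>-1\<close>.\<close>
fun lexless :: "(z3 \<times> z3 \<times> z3) list \<Rightarrow> coeffs \<Rightarrow> coeffs \<Rightarrow> bool" where
  "lexless [] E E' = False"
| "lexless ((c, i, j) # ps) E E' = (if E c i j = E' c i j then lexless ps E E' else E c i j = Z1)"

definition z3_list :: "z3 list" where "z3_list = [Z0, Z1, Z2]"
definition signs :: "z3 list" where "signs = [Z1, Z2]"
definition positions0 :: "(z3 \<times> z3 \<times> z3) list" where
  "positions0 = [(Z0, i, j). i \<leftarrow> z3_list, j \<leftarrow> z3_list]"
definition positions :: "(z3 \<times> z3 \<times> z3) list" where
  "positions = positions0 @ [(c, i, j). c \<leftarrow> signs, i \<leftarrow> z3_list, j \<leftarrow> z3_list]"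

fun all_list :: "('a \<Rightarrow> bool) \<Rightarrow> 'a list \<Rightarrow> bool" where
  "all_list P [] = True" | "all_list P (x # xs) = (if P x then all_list P xs else False)"
fun any_list :: "('a \<Rightarrow> bool) \<Rightarrow> 'a list \<Rightarrow> bool" where
  "any_list P [] = False" | "any_list P (x # xs) = (if P x then True else any_list P xs)"

lemma all_list_iff: "all_list P xs \<longleftrightarrow> (\<forall>x\<in>set xs. P x)" by (induction xs) auto
lemma any_list_iff: "any_list P xs \<longleftrightarrow> (\<exists>x\<in>set xs. P x)" by (induction xs) auto

lemma set_z3_list: "x \<in> set z3_list" by (cases x) (simp_all add: z3_list_def)
lemma set_signs: "x \<in> set signs \<longleftrightarrow> x \<noteq> 0" by (cases x) (simp_all add: signs_def z3_const)

lemma set_positions: "p \<in> set positions"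
proof -
  obtain c i j where p: "p = (c, i, j)" by (cases p)
  show ?thesis using set_z3_list [of i] set_z3_list [of j] unfolding p
    by (cases c) (auto simp: positions_def positions0_def signs_def)
qed

definition is_sign :: "coeffs \<Rightarrow> bool" where
  "is_sign E \<longleftrightarrow> (\<forall>c i j. E c i j \<noteq> 0)"

abbreviation key :: "coeffs \<Rightarrow> z3 list" where
  "key E \<equiv> map (\<lambda>(c, i, j). E c i j) positions"

lemma lexless_lex:
  assumes "lexless ps E E'" "is_sign E'"
  shows "(map (\<lambda>(c, i, j). E c i j) ps, map (\<lambda>(c, i, j). E' c i j) ps) \<in> lex {(Z1, Z2)}"
  using assms(1)
proof (induction ps)
  case (Cons p ps)
  obtain c i j where p: "p = (c, i, j)" by (cases p)
  have n: "E' c i j \<noteq> Z0" using assms(2) by (simp add: is_sign_def z3_const)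
  show ?case
  proof (cases "E c i j = E' c i j")
    case True then show ?thesis using Cons by (simp add: p)
  next
    case False
    then have "E c i j = Z1" using Cons.prems by (simp add: p)
    moreover from this have "E' c i j = Z2" using n False by (cases "E' c i j") auto
    ultimately show ?thesis by (simp add: p)
  qed
qed simp

lemma lexless_append: "lexless ps E E' \<Longrightarrow> lexless (ps @ qs) E E'"
proof (induction ps)
  case (Cons p ps) then show ?case by (cases p) (auto split: if_splits)
qed simp

lemma lexless_cong:
  "(\<And>c i j. (c, i, j) \<in> set ps \<Longrightarrow> E c i j = F c i j) \<Longrightarrow> (\<And>c i j. (c, i, j) \<in> set ps \<Longrightarrow> E' c i j = F' c i j)
    \<Longrightarrow> lexless ps E E' = lexless ps F F'"
proof (induction ps)
  case (Cons p ps) then show ?case by (cases p) simp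
qed simp

lemma lexless_asym: "lexless ps E E' \<Longrightarrow> is_sign E' \<Longrightarrow> \<not> lexless ps E' E"
proof (induction ps)
  case (Cons p ps) then show ?case by (cases p) (auto split: if_splits)
qed simp

lemma lexless_total:
  "is_sign E \<Longrightarrow> is_sign E' \<Longrightarrow> \<not> lexless ps E E' \<Longrightarrow> \<not> lexless ps E' E \<Longrightarrow> (c, i, j) \<in> set ps \<Longrightarrow> E c i j = E' c i j"
proof (induction ps)
  case (Cons p ps)
  obtain d k l where p: "p = (d, k, l)" by (cases p)
  have n: "E d k l \<noteq> Z0" "E' d k l \<noteq> Z0" using Cons.prems by (simp_all add: is_sign_def z3_const)
  have "E d k l = E' d k l"
  proof (rule ccontr)
    assume ne: "E d k l \<noteq> E' d k l"
    then have "E d k l \<noteq> Z1" "E' d k l \<noteq> Z1" using Cons.prems(3,4) by (simp_all add: p split: if_splits)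
    with n ne show False by (cases "E d k l"; cases "E' d k l") simp_all
  qed
  with Cons show ?case by (auto simp: p)
qed simp

text \<open>The mixed second difference based at \<open>(0, 0)\<close>.\<close>
definition mdiff :: "(z3 \<Rightarrow> z3 \<Rightarrow> z3) \<Rightarrow> z3 \<Rightarrow> z3 \<Rightarrow> z3" where
  "mdiff M i j = M i j - M i Z0 - M Z0 j + M Z0 Z0"

text \<open>The mixed third difference of \<open>\<lambda>i j k. E 0 i j * k + E 1 j k * i + E (-1) k i * j\<close> vanishes.\<close>
definition balanced :: "coeffs \<Rightarrow> bool" where
  "balanced E \<longleftrightarrow> is_sign E \<and> (\<forall>i j k. k * mdiff (E 0) i j + i * mdiff (E 1) j k + j * mdiff (E (-1)) k i = 0)"

text \<open>The sum of the three shifts is zero, and so is its mixed third difference; the offsets \<open>F\<close>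
  do not contribute to it, since each of them depends on two of the three blocks.\<close>
lemma signature_balanced:
  assumes "signature R E" shows "balanced E"
proof -
  from assms obtain U F where p: "presents U F E R" unfolding signature_def by blast
  define T where "T i j k = F 0 i j + E 0 i j * k + (F 1 j k + E 1 j k * i) + (F (-1) k i + E (-1) k i * j)" for i j k
  have T: "T i j k = 0" for i j k
  proof -
    obtain I where I: "I (0::z3) = i" "I (0 + 1) = j" "I (0 - 1) = k" using vec3 [of 0 i j k] by blast
    show ?thesis unfolding T_def using presents_sum [OF p I] by simp
  qed
  have z: "Z0 = 0" by (simp add: z3_const)
  have "k * mdiff (E 0) i j + i * mdiff (E 1) j k + j * mdiff (E (-1)) k i
     = T i j k - T 0 j k - T i 0 k - T i j 0 + T i 0 0 + T 0 j 0 + T 0 0 k - T 0 0 0" for i j k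
    unfolding T_def mdiff_def z by (simp add: algebra_simps)
  then show ?thesis using p by (simp add: balanced_def T is_sign_def presents_def)
qed

text \<open>Offsets making the three shifts cancel, for given balanced slopes. They are normalized to vanish
  in coordinate \<open>1\<close> if one of the arguments is \<open>0\<close> and in coordinate \<open>-1\<close> if the first one is; the
  cancellation at \<open>k = 0\<close>, \<open>i = 0\<close>, \<open>j = 0\<close> forces the rest.\<close>
definition offset :: "coeffs \<Rightarrow> z3 \<Rightarrow> z3 \<Rightarrow> z3 \<Rightarrow> z3" where
  "offset E c x y = (case c of
     Z0 \<Rightarrow> - (E Z1 y Z0 * x + E Z2 Z0 x * y)
   | Z1 \<Rightarrow> (E Z2 Z0 Z0 - E Z2 y Z0) * x + (E Z0 Z0 Z0 - E Z0 Z0 x) * y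
   | Z2 \<Rightarrow> (E Z1 Z0 Z0 - E Z1 Z0 x) * y - E Z0 y Z0 * x)"

definition model :: "coeffs \<Rightarrow> config set" where
  "model E = affine_rel (\<lambda>_ _. 1) (offset E) E"

lemma presents_model:
  assumes "balanced E" shows "presents (\<lambda>_ _. 1) (offset E) E (model E)"
proof -
  have z: "Z0 = 0" "Z1 = 1" "Z2 = -1" by (simp_all add: z3_const)
  have F: "offset E 0 i j = - (E 1 j 0 * i + E (-1) 0 i * j)"
    "offset E 1 j k = (E (-1) 0 0 - E (-1) k 0) * j + (E 0 0 0 - E 0 0 j) * k"
    "offset E (-1) k i = (E 1 0 0 - E 1 0 k) * i - E 0 i 0 * k" for i j k
    unfolding offset_def z3_const by simp_all
  have "(\<Sum>c\<in>UNIV. shift (offset E) E c I) = 0" for I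
  proof -
    let ?i = "I 0" and ?j = "I 1" and ?k = "I (-1)"
    have "(\<Sum>c\<in>UNIV. shift (offset E) E c I)
       = ?k * mdiff (E 0) ?i ?j + ?i * mdiff (E 1) ?j ?k + ?j * mdiff (E (-1)) ?k ?i"
      unfolding sum_z3 [of _ 0] by (simp add: shift_def F mdiff_def z algebra_simps)
    then show ?thesis using assms by (simp add: balanced_def)
  qed
  then show ?thesis using assms by (simp add: presents_def model_def balanced_def is_sign_def)
qed

text \<open>Moves that change the first matrix by a sign and permutations of its rows and columns, without
  mixing in the other two. Only seven matrices with vanishing sum of entries cannot be improved by
  them.\<close>
definition band_moves :: "(z3 \<times> (z3 \<times> z3) \<times> (z3 \<times> z3)) list" where
  "band_moves = [(Z2, (Z1, Z0), (Z1, Z0)),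
    (Z1, (Z2, Z0), (Z2, Z0)),
    (Z2, (Z1, Z1), (Z1, Z0)),
    (Z1, (Z1, Z0), (Z2, Z1)),
    (Z1, (Z1, Z2), (Z1, Z1)),
    (Z1, (Z2, Z0), (Z2, Z1)),
    (Z1, (Z1, Z0), (Z1, Z1)),
    (Z2, (Z1, Z0), (Z1, Z1))]"

text \<open>Chosen so that every balanced signature whose first matrix cannot be improved by
  \<open>band_moves\<close>, and which is not in the list \<open>reps\<close> below, is made smaller by one of them.\<close>
definition moves :: "move list" where
  "moves = [
    (True, Z1, Z2, (Z1, Z0), (Z1, Z0), (Z1, Z1)),
    (False, Z0, Z1, (Z1, Z0), (Z1, Z0), (Z1, Z1)),
    (False, Z0, Z2, (Z1, Z0), (Z1, Z0), (Z2, Z1)),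
    (False, Z0, Z2, (Z2, Z1), (Z2, Z0), (Z2, Z1)),
    (True, Z2, Z1, (Z2, Z1), (Z1, Z0), (Z2, Z1)),
    (False, Z0, Z2, (Z2, Z1), (Z1, Z0), (Z2, Z1)),
    (True, Z2, Z1, (Z2, Z1), (Z1, Z1), (Z2, Z0)),
    (True, Z2, Z2, (Z1, Z1), (Z1, Z2), (Z2, Z1)),
    (False, Z0, Z2, (Z2, Z1), (Z2, Z1), (Z2, Z0)),
    (False, Z0, Z1, (Z2, Z1), (Z1, Z1), (Z1, Z0)),
    (False, Z2, Z1, (Z2, Z0), (Z2, Z2), (Z1, Z0)),
    (True, Z2, Z1, (Z2, Z0), (Z2, Z0), (Z2, Z0)),
    (True, Z1, Z1, (Z1, Z0), (Z1, Z0), (Z2, Z0)),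
    (False, Z0, Z1, (Z1, Z0), (Z1, Z0), (Z1, Z2)),
    (True, Z2, Z1, (Z2, Z1), (Z2, Z1), (Z2, Z1)),
    (True, Z1, Z2, (Z1, Z0), (Z1, Z0), (Z1, Z2)),
    (False, Z0, Z1, (Z1, Z1), (Z1, Z0), (Z1, Z0)),
    (False, Z2, Z1, (Z1, Z0), (Z1, Z2), (Z2, Z1)),
    (False, Z2, Z1, (Z1, Z0), (Z1, Z0), (Z1, Z0)),
    (False, Z0, Z1, (Z1, Z2), (Z1, Z1), (Z1, Z2)),
    (False, Z1, Z1, (Z1, Z1), (Z2, Z1), (Z1, Z0)),
    (False, Z1, Z1, (Z2, Z1), (Z2, Z1), (Z1, Z0)),
    (False, Z1, Z2, (Z2, Z0), (Z2, Z0), (Z2, Z1)),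
    (False, Z2, Z1, (Z1, Z2), (Z1, Z0), (Z2, Z0)),
    (True, Z2, Z1, (Z2, Z0), (Z2, Z2), (Z2, Z0)),
    (True, Z1, Z1, (Z1, Z0), (Z1, Z0), (Z2, Z1)),
    (True, Z1, Z1, (Z1, Z0), (Z1, Z0), (Z2, Z2)),
    (True, Z1, Z1, (Z1, Z0), (Z2, Z1), (Z2, Z1)),
    (True, Z1, Z2, (Z1, Z0), (Z1, Z0), (Z1, Z0))]"

text \<open>The lexicographically least signatures of the orbits, in increasing order; those of the seven
  squares with several tri-partitions have names.\<close>
definition rep17 :: sig where
  "rep17 = (Mat Z1 Z1 Z1 Z1 Z1 Z1 Z1 Z1 Z1, Mat Z1 Z1 Z1 Z1 Z1 Z1 Z1 Z1 Z1, Mat Z1 Z1 Z1 Z1 Z1 Z1 Z1 Z1 Z1)"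

definition rep18 :: sig where
  "rep18 = (Mat Z1 Z1 Z1 Z1 Z1 Z1 Z1 Z1 Z1, Mat Z1 Z1 Z1 Z1 Z1 Z1 Z1 Z1 Z1, Mat Z1 Z1 Z1 Z1 Z1 Z1 Z2 Z2 Z2)"

definition rep2 :: sig where
  "rep2 = (Mat Z1 Z1 Z1 Z1 Z1 Z1 Z1 Z1 Z1, Mat Z1 Z1 Z1 Z1 Z1 Z1 Z2 Z2 Z2, Mat Z1 Z1 Z2 Z1 Z1 Z2 Z1 Z1 Z2)"

definition rep20 :: sig where
  "rep20 = (Mat Z1 Z1 Z1 Z1 Z1 Z1 Z1 Z1 Z1, Mat Z1 Z1 Z2 Z1 Z1 Z2 Z1 Z1 Z2, Mat Z1 Z1 Z1 Z1 Z1 Z1 Z2 Z2 Z2)"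

definition rep27 :: sig where
  "rep27 = (Mat Z1 Z1 Z1 Z1 Z1 Z1 Z1 Z1 Z1, Mat Z1 Z1 Z2 Z1 Z1 Z2 Z1 Z1 Z2, Mat Z1 Z1 Z1 Z2 Z2 Z2 Z1 Z1 Z1)"

definition rep179 :: sig where
  "rep179 = (Mat Z1 Z1 Z2 Z1 Z2 Z1 Z2 Z1 Z1, Mat Z1 Z1 Z2 Z1 Z2 Z1 Z2 Z1 Z1, Mat Z1 Z2 Z2 Z2 Z1 Z2 Z2 Z2 Z1)"

definition rep175 :: sig where
  "rep175 = (Mat Z1 Z1 Z2 Z1 Z2 Z1 Z2 Z1 Z1, Mat Z1 Z1 Z2 Z1 Z2 Z1 Z2 Z1 Z1, Mat Z2 Z1 Z2 Z2 Z2 Z1 Z1 Z2 Z2)"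

definition reps0 :: "sig list" where
  "reps0 = [
    rep17,
    rep18,
    (Mat Z1 Z1 Z1 Z1 Z1 Z1 Z1 Z1 Z1, Mat Z1 Z1 Z1 Z1 Z1 Z1 Z2 Z2 Z2, Mat Z1 Z1 Z1 Z1 Z1 Z1 Z2 Z2 Z2),
    rep2,
    (Mat Z1 Z1 Z1 Z1 Z1 Z1 Z1 Z1 Z1, Mat Z1 Z1 Z1 Z1 Z1 Z2 Z2 Z2 Z1, Mat Z1 Z1 Z2 Z1 Z1 Z2 Z2 Z1 Z1),
    rep20,
    rep27,
    (Mat Z1 Z1 Z1 Z1 Z1 Z1 Z1 Z1 Z1, Mat Z1 Z1 Z2 Z1 Z2 Z1 Z2 Z1 Z1, Mat Z1 Z1 Z2 Z2 Z1 Z1 Z1 Z2 Z1)]"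

definition reps1 :: "sig list" where
  "reps1 = [
    (Mat Z1 Z1 Z1 Z1 Z1 Z1 Z2 Z2 Z2, Mat Z1 Z1 Z1 Z1 Z1 Z1 Z2 Z2 Z2, Mat Z1 Z1 Z1 Z1 Z1 Z1 Z2 Z2 Z2),
    (Mat Z1 Z1 Z1 Z1 Z1 Z1 Z2 Z2 Z2, Mat Z1 Z1 Z1 Z1 Z1 Z1 Z2 Z2 Z2, Mat Z1 Z1 Z2 Z1 Z1 Z2 Z1 Z1 Z2),
    (Mat Z1 Z1 Z1 Z1 Z1 Z1 Z2 Z2 Z2, Mat Z1 Z1 Z1 Z1 Z1 Z1 Z2 Z2 Z2, Mat Z1 Z2 Z1 Z1 Z2 Z1 Z1 Z2 Z1),
    (Mat Z1 Z1 Z1 Z1 Z1 Z1 Z2 Z2 Z2, Mat Z1 Z1 Z1 Z1 Z1 Z2 Z2 Z2 Z1, Mat Z1 Z1 Z2 Z1 Z1 Z2 Z2 Z1 Z1),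
    (Mat Z1 Z1 Z1 Z1 Z1 Z1 Z2 Z2 Z2, Mat Z1 Z1 Z1 Z1 Z1 Z2 Z2 Z2 Z1, Mat Z1 Z2 Z1 Z1 Z2 Z1 Z1 Z1 Z2),
    (Mat Z1 Z1 Z1 Z1 Z1 Z1 Z2 Z2 Z2, Mat Z1 Z1 Z1 Z1 Z1 Z2 Z2 Z2 Z1, Mat Z2 Z1 Z1 Z2 Z1 Z1 Z1 Z2 Z1),
    (Mat Z1 Z1 Z1 Z1 Z1 Z1 Z2 Z2 Z2, Mat Z1 Z1 Z2 Z1 Z2 Z1 Z2 Z1 Z1, Mat Z1 Z1 Z2 Z2 Z1 Z1 Z1 Z2 Z1),
    (Mat Z1 Z1 Z1 Z1 Z1 Z1 Z2 Z2 Z2, Mat Z1 Z1 Z2 Z1 Z2 Z1 Z2 Z1 Z1, Mat Z1 Z2 Z2 Z2 Z2 Z1 Z2 Z1 Z2)]"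

definition reps2 :: "sig list" where
  "reps2 = [
    (Mat Z1 Z1 Z1 Z1 Z1 Z2 Z1 Z2 Z2, Mat Z1 Z1 Z1 Z1 Z1 Z2 Z2 Z1 Z2, Mat Z1 Z1 Z1 Z2 Z2 Z1 Z2 Z1 Z1),
    (Mat Z1 Z1 Z1 Z1 Z1 Z2 Z1 Z2 Z2, Mat Z1 Z1 Z1 Z1 Z1 Z2 Z2 Z1 Z2, Mat Z1 Z1 Z2 Z1 Z1 Z1 Z2 Z1 Z2),
    (Mat Z1 Z1 Z1 Z1 Z1 Z2 Z1 Z2 Z2, Mat Z1 Z1 Z1 Z1 Z1 Z2 Z2 Z1 Z2, Mat Z1 Z1 Z2 Z2 Z2 Z2 Z2 Z1 Z2),
    (Mat Z1 Z1 Z1 Z1 Z1 Z2 Z1 Z2 Z2, Mat Z1 Z1 Z1 Z1 Z2 Z2 Z1 Z2 Z1, Mat Z1 Z2 Z1 Z1 Z1 Z1 Z2 Z2 Z1),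
    (Mat Z1 Z1 Z1 Z1 Z1 Z2 Z1 Z2 Z2, Mat Z1 Z1 Z1 Z1 Z2 Z2 Z1 Z2 Z1, Mat Z1 Z2 Z1 Z2 Z2 Z2 Z2 Z2 Z1),
    (Mat Z1 Z1 Z1 Z1 Z1 Z2 Z1 Z2 Z2, Mat Z1 Z1 Z1 Z1 Z2 Z2 Z1 Z2 Z1, Mat Z2 Z2 Z2 Z2 Z1 Z2 Z2 Z1 Z1),
    (Mat Z1 Z1 Z1 Z1 Z1 Z2 Z1 Z2 Z2, Mat Z1 Z1 Z2 Z1 Z1 Z1 Z2 Z1 Z2, Mat Z1 Z1 Z1 Z2 Z2 Z1 Z1 Z2 Z1),
    (Mat Z1 Z1 Z1 Z1 Z1 Z2 Z1 Z2 Z2, Mat Z1 Z1 Z2 Z1 Z1 Z1 Z2 Z1 Z2, Mat Z2 Z2 Z2 Z2 Z2 Z1 Z1 Z2 Z1),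
    (Mat Z1 Z1 Z1 Z1 Z1 Z2 Z1 Z2 Z2, Mat Z1 Z1 Z2 Z1 Z1 Z2 Z2 Z1 Z1, Mat Z1 Z1 Z1 Z2 Z2 Z1 Z1 Z1 Z2),
    (Mat Z1 Z1 Z1 Z1 Z1 Z2 Z1 Z2 Z2, Mat Z1 Z1 Z2 Z1 Z1 Z2 Z2 Z1 Z1, Mat Z1 Z1 Z2 Z1 Z1 Z1 Z2 Z2 Z1),
    (Mat Z1 Z1 Z1 Z1 Z1 Z2 Z1 Z2 Z2, Mat Z1 Z1 Z2 Z1 Z1 Z2 Z2 Z1 Z1, Mat Z1 Z1 Z2 Z2 Z2 Z2 Z2 Z2 Z1),
    (Mat Z1 Z1 Z1 Z1 Z1 Z2 Z1 Z2 Z2, Mat Z1 Z1 Z2 Z1 Z1 Z2 Z2 Z1 Z1, Mat Z2 Z2 Z1 Z1 Z1 Z2 Z2 Z2 Z2),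
    (Mat Z1 Z1 Z1 Z1 Z1 Z2 Z1 Z2 Z2, Mat Z1 Z1 Z2 Z1 Z1 Z2 Z2 Z1 Z1, Mat Z2 Z2 Z2 Z2 Z2 Z1 Z1 Z1 Z2),
    (Mat Z1 Z1 Z1 Z1 Z1 Z2 Z1 Z2 Z2, Mat Z1 Z1 Z2 Z1 Z2 Z1 Z1 Z2 Z1, Mat Z1 Z1 Z1 Z2 Z1 Z2 Z1 Z2 Z1),
    (Mat Z1 Z1 Z1 Z1 Z1 Z2 Z1 Z2 Z2, Mat Z1 Z1 Z2 Z1 Z2 Z1 Z1 Z2 Z1, Mat Z1 Z2 Z1 Z1 Z1 Z1 Z2 Z1 Z2)]"

definition reps3 :: "sig list" where
  "reps3 = [
    (Mat Z1 Z1 Z1 Z1 Z1 Z2 Z1 Z2 Z2, Mat Z1 Z1 Z2 Z1 Z2 Z1 Z1 Z2 Z1, Mat Z1 Z2 Z1 Z2 Z2 Z2 Z2 Z1 Z2),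
    (Mat Z1 Z1 Z1 Z1 Z1 Z2 Z1 Z2 Z2, Mat Z1 Z1 Z2 Z1 Z2 Z1 Z1 Z2 Z1, Mat Z2 Z1 Z2 Z1 Z2 Z1 Z1 Z1 Z1),
    (Mat Z1 Z1 Z1 Z1 Z1 Z2 Z1 Z2 Z2, Mat Z1 Z1 Z2 Z1 Z2 Z1 Z1 Z2 Z1, Mat Z2 Z1 Z2 Z1 Z2 Z1 Z2 Z2 Z2),
    (Mat Z1 Z1 Z1 Z1 Z1 Z2 Z1 Z2 Z2, Mat Z1 Z1 Z2 Z1 Z2 Z1 Z1 Z2 Z1, Mat Z2 Z2 Z2 Z2 Z1 Z2 Z1 Z2 Z1),
    (Mat Z1 Z1 Z1 Z1 Z1 Z2 Z1 Z2 Z2, Mat Z1 Z1 Z2 Z2 Z1 Z2 Z1 Z1 Z1, Mat Z2 Z1 Z2 Z1 Z1 Z2 Z2 Z2 Z2),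
    (Mat Z1 Z1 Z1 Z1 Z1 Z2 Z1 Z2 Z2, Mat Z1 Z1 Z2 Z2 Z1 Z2 Z2 Z2 Z2, Mat Z2 Z1 Z1 Z1 Z1 Z1 Z2 Z2 Z1),
    (Mat Z1 Z1 Z1 Z1 Z1 Z2 Z2 Z2 Z1, Mat Z1 Z1 Z2 Z1 Z2 Z1 Z1 Z2 Z1, Mat Z1 Z1 Z2 Z2 Z1 Z1 Z1 Z2 Z1),
    (Mat Z1 Z1 Z1 Z1 Z1 Z2 Z2 Z2 Z1, Mat Z1 Z1 Z2 Z1 Z2 Z1 Z1 Z2 Z1, Mat Z1 Z2 Z1 Z1 Z1 Z2 Z2 Z1 Z1),
    (Mat Z1 Z1 Z1 Z1 Z1 Z2 Z2 Z2 Z1, Mat Z1 Z1 Z2 Z1 Z2 Z1 Z1 Z2 Z1, Mat Z1 Z2 Z2 Z2 Z2 Z1 Z2 Z1 Z2),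
    (Mat Z1 Z1 Z1 Z1 Z1 Z2 Z2 Z2 Z1, Mat Z1 Z1 Z2 Z1 Z2 Z1 Z1 Z2 Z1, Mat Z2 Z1 Z1 Z1 Z2 Z1 Z1 Z1 Z2),
    (Mat Z1 Z1 Z1 Z1 Z1 Z2 Z2 Z2 Z1, Mat Z1 Z1 Z2 Z1 Z2 Z1 Z1 Z2 Z1, Mat Z2 Z1 Z2 Z1 Z2 Z2 Z2 Z2 Z1),
    (Mat Z1 Z1 Z2 Z1 Z2 Z1 Z2 Z1 Z1, Mat Z1 Z1 Z2 Z1 Z2 Z1 Z2 Z1 Z1, Mat Z1 Z1 Z2 Z1 Z2 Z1 Z2 Z1 Z1),
    rep179,
    rep175]"

definition reps :: "sig list" where
  "reps = reps0 @ reps1 @ reps2 @ reps3"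

fun band_move :: "z3 \<times> (z3 \<times> z3) \<times> (z3 \<times> z3) \<Rightarrow> move" where
  "band_move (e, p, q) = (False, Z0, e, p, q, (Z1, Z0))"

fun proper :: "move \<Rightarrow> bool" where
  "proper (r, h, e, (m0, n0), (m1, n1), (m2, n2)) = (e \<noteq> Z0 \<and> m0 \<noteq> Z0 \<and> m1 \<noteq> Z0 \<and> m2 \<noteq> Z0)"

definition mats :: "mat list" where
  "mats = [Mat a b c d e f g h i. a \<leftarrow> signs, b \<leftarrow> signs, c \<leftarrow> signs, d \<leftarrow> signs, e \<leftarrow> signs, f \<leftarrow> signs, g \<leftarrow> signs, h \<leftarrow> signs, i \<leftarrow> signs]"

definition quints :: "(z3 \<times> z3 \<times> z3 \<times> z3 \<times> z3) list" where
  "quints = [(a, b, c, d, e). a \<leftarrow> signs, b \<leftarrow> signs, c \<leftarrow> signs, d \<leftarrow> signs, e \<leftarrow> signs]"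

fun msum :: "mat \<Rightarrow> z3" where
  "msum (Mat a b c d e f g h i) = a + b + c + d + e + f + g + h + i"

text \<open>Balance with \<open>j = 1\<close> expresses the mixed differences of the third matrix by the first two
  matrices; balance with \<open>j = -1\<close> then is a condition on the first two matrices.\<close>
definition forced :: "mat \<Rightarrow> mat \<Rightarrow> z3 \<Rightarrow> z3 \<Rightarrow> z3" where
  "forced A B k i = - (k * mdiff (at A) i Z1 + i * mdiff (at B) Z1 k)"

definition consistent1 :: "mat \<Rightarrow> mat \<Rightarrow> z3 \<Rightarrow> z3 \<Rightarrow> bool" where
  "consistent1 A B k i \<longleftrightarrow> forced A B k i = k * mdiff (at A) i Z2 + i * mdiff (at B) Z2 k"

definition consistent :: "mat \<Rightarrow> mat \<Rightarrow> bool" where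
  "consistent A B = (if consistent1 A B Z1 Z1 then if consistent1 A B Z1 Z2 then
     if consistent1 A B Z2 Z1 then consistent1 A B Z2 Z2 else False else False else False)"

fun improves :: "(z3 \<times> z3 \<times> z3) list \<Rightarrow> sig \<Rightarrow> move \<Rightarrow> bool" where
  "improves ps r g = lexless ps (move_act g (decode r)) (decode r)"

text \<open>Only the first matrix is compared, and its image under these moves does not depend on the other
  two; so it can stand in for them.\<close>
fun improves0 :: "sig \<Rightarrow> z3 \<times> (z3 \<times> z3) \<times> (z3 \<times> z3) \<Rightarrow> bool" where
  "improves0 r g = improves positions0 r (band_move g)"

fun listed :: "sig list \<Rightarrow> sig \<Rightarrow> bool" where
  "listed [] r = False" | "listed (s # ss) r = (if s = r then True else listed ss r)"

definition settled :: "sig \<Rightarrow> bool" where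
  "settled r = (if any_list (improves positions r) moves then True else listed reps r)"

fun unit4 :: "mat \<Rightarrow> bool" where
  "unit4 (Mat a b c d e f g h i) =
    (if e = Z0 then False else if f = Z0 then False else if h = Z0 then False else i \<noteq> Z0)"

definition settled_if_sign :: "mat \<Rightarrow> mat \<Rightarrow> mat \<Rightarrow> bool" where
  "settled_if_sign A B C = (if unit4 C then settled (A, B, C) else True)"

text \<open>The first row and the first column of the third matrix are free, the other entries follow from
  its mixed differences.\<close>
fun settled_fill :: "mat \<Rightarrow> mat \<Rightarrow> z3 \<Rightarrow> z3 \<Rightarrow> z3 \<Rightarrow> z3 \<Rightarrow> z3 \<times> z3 \<times> z3 \<times> z3 \<times> z3 \<Rightarrow> bool" where
  "settled_fill A B p q r s (a, b, c, d, e) = settled_if_sign A B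
     (Mat a b c d (p + d + b - a) (q + d + c - a) e (r + e + b - a) (s + e + c - a))"

definition settled2 :: "mat \<Rightarrow> mat \<Rightarrow> bool" where
  "settled2 A B = (if consistent A B then
     all_list (settled_fill A B (forced A B Z1 Z1) (forced A B Z1 Z2) (forced A B Z2 Z1) (forced A B Z2 Z2)) quints else True)"

definition settled1 :: "mat \<Rightarrow> bool" where
  "settled1 A = (if msum A = Z0 then if any_list (improves0 (A, A, A)) band_moves then True else all_list (settled2 A) mats else True)"

text \<open>All balanced signatures are visited: the first matrix is arbitrary with vanishing sum of entries
  and not improvable by \<open>band_moves\<close>, the second is consistent with it, and the third is filled in.\<close>
lemma all_settled: "all_list settled1 mats"
  by code_simp

lemma moves_proper: "all_list proper moves" "all_list (\<lambda>g. proper (band_move g)) band_moves"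
  by code_simp+

lemma in_concat: "x \<in> set (concat (map f xs)) \<longleftrightarrow> (\<exists>a\<in>set xs. x \<in> set (f a))"
  by simp

lemma in_map: "x \<in> set (map g xs) \<longleftrightarrow> (\<exists>a\<in>set xs. x = g a)"
  by (simp add: image_iff)

lemma Mat_mem_mats:
  "a \<in> set signs \<Longrightarrow> b \<in> set signs \<Longrightarrow> c \<in> set signs \<Longrightarrow> d \<in> set signs \<Longrightarrow> e \<in> set signs \<Longrightarrow> f \<in> set signs \<Longrightarrow>
    g \<in> set signs \<Longrightarrow> h \<in> set signs \<Longrightarrow> i \<in> set signs \<Longrightarrow> Mat a b c d e f g h i \<in> set mats"
  unfolding mats_def in_concat in_map by blast

lemma quint_mem:
  "a \<in> set signs \<Longrightarrow> b \<in> set signs \<Longrightarrow> c \<in> set signs \<Longrightarrow> d \<in> set signs \<Longrightarrow> e \<in> set signs \<Longrightarrow> (a, b, c, d, e) \<in> set quints"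
  unfolding quints_def in_concat in_map by blast

lemma mat_of_mem: "mat_of M \<in> set mats" if "\<And>i j. M i j \<noteq> 0"
  unfolding mat_of_def by (rule Mat_mem_mats) (simp_all add: set_signs that)

text \<open>Adding the balance equations for \<open>k = 1\<close> and \<open>i, j\<close> in \<open>{1, -1}\<close> cancels the second and third
  matrix. What remains is the sum of the mixed differences of the first one, which in
  characteristic three is the sum of its entries.\<close>
lemma msum_balanced:
  assumes "balanced E" shows "msum (mat_of (E 0)) = 0"
proof -
  have z: "Z0 = 0" "Z1 = 1" "Z2 = -1" by (simp_all add: z3_const)
  have b: "mdiff (E 0) i j + i * mdiff (E 1) j 1 + j * mdiff (E (-1)) 1 i = 0" for i j
    using assms unfolding balanced_def by (metis mult_1)
  \<comment> \<open>Each of the other differences occurs once with either sign.\<close>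
  let ?D = "mdiff (E 0) 1 1 + mdiff (E 0) 1 (-1) + mdiff (E 0) (-1) 1 + mdiff (E 0) (-1) (-1)"
  have "?D = (mdiff (E 0) 1 1 + 1 * mdiff (E 1) 1 1 + 1 * mdiff (E (-1)) 1 1)
     + (mdiff (E 0) 1 (-1) + 1 * mdiff (E 1) (-1) 1 + (-1) * mdiff (E (-1)) 1 1)
     + (mdiff (E 0) (-1) 1 + (-1) * mdiff (E 1) 1 1 + 1 * mdiff (E (-1)) 1 (-1))
     + (mdiff (E 0) (-1) (-1) + (-1) * mdiff (E 1) (-1) 1 + (-1) * mdiff (E (-1)) 1 (-1))"
    by (simp add: algebra_simps)
  also have "\<dots> = 0" unfolding b by simp
  finally have D: "?D = 0" .
  have t: "x + x + x = 0" for x :: z3 by (cases x) (simp_all add: z3_const)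
  let ?t = "E 0 1 0 + E 0 (-1) 0 + E 0 0 1 + E 0 0 (-1)"
  have "msum (mat_of (E 0)) = ?D + (?t + ?t + ?t) - (E 0 0 0 + E 0 0 0 + E 0 0 0)"
    by (simp add: mat_of_def mdiff_def z algebra_simps)
  then show ?thesis unfolding D t by simp
qed

lemma listed_iff: "listed ss r \<longleftrightarrow> r \<in> set ss" by (induction ss) auto

lemma settled_balanced:
  assumes b: "balanced E"
  shows "sig_of E \<in> set reps \<or> (\<exists>g. proper g \<and> lexless positions (move_act g E) E)"
proof -
  have z: "Z0 = 0" "Z1 = 1" "Z2 = -1" by (simp_all add: z3_const)
  have n: "E c i j \<noteq> 0" for c i j using b by (simp add: balanced_def is_sign_def)
  have eq: "k * mdiff (E Z0) i j + i * mdiff (E Z1) j k + j * mdiff (E Z2) k i = 0" for i j k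
    using b unfolding z by (simp add: balanced_def)
  define A B C where "A = mat_of (E Z0)" and "B = mat_of (E Z1)" and "C = mat_of (E Z2)"
  have mem: "A \<in> set mats" "B \<in> set mats" unfolding A_def B_def by (simp_all add: mat_of_mem n)
  have fo: "forced A B k i = mdiff (E Z2) k i" for k i
    unfolding forced_def A_def B_def at_mat_of
    by (rule minus_unique) (use eq [of k i Z1] in \<open>simp add: z\<close>)
  have "consistent1 A B k i" for k i
    unfolding consistent1_def fo unfolding A_def B_def at_mat_of
    by (rule sym) (use eq [of k i Z2] in \<open>simp add: z\<close>)
  then have co: "consistent A B" by (simp add: consistent_def)
  have "settled1 A" using all_settled mem by (simp add: all_list_iff)
  moreover have "msum A = Z0" using msum_balanced [OF b] by (simp add: A_def z)
  ultimately have "any_list (improves0 (A, A, A)) band_moves \<or> all_list (settled2 A) mats"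
    by (simp add: settled1_def split: if_splits)
  then consider g where "g \<in> set band_moves" "improves0 (A, A, A) g" | "settled2 A B"
    unfolding all_list_iff any_list_iff using mem(2) by blast
  then show ?thesis
  proof cases
    case 1
    obtain e m0 n0 m1 n1 where g: "g = (e, (m0, n0), (m1, n1))" by (metis surj_pair)
    have "lexless positions0 (move_act (band_move g) E) E"
    proof -
      have "lexless positions0 (move_act (band_move g) E) E = lexless positions0 (move_act (band_move g) (decode (A, A, A))) (decode (A, A, A))"
      proof (rule lexless_cong)
        fix c i j assume "(c, i, j) \<in> set positions0"
        then have c: "c = Z0" by (auto simp: positions0_def)
        show "move_act (band_move g) E c i j = move_act (band_move g) (decode (A, A, A)) c i j" "E c i j = decode (A, A, A) c i j"
          unfolding c g band_move.simps move_act.simps act_def by (simp_all add: A_def)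
      qed
      then show ?thesis using 1(2) by simp
    qed
    then have "lexless positions (move_act (band_move g) E) E" unfolding positions_def by (rule lexless_append)
    moreover have "proper (band_move g)" using moves_proper(2) 1(1) by (simp add: all_list_iff)
    ultimately show ?thesis by blast
  next
    case 2
    have C: "C = Mat (E Z2 Z0 Z0) (E Z2 Z0 Z1) (E Z2 Z0 Z2) (E Z2 Z1 Z0)
       (mdiff (E Z2) Z1 Z1 + E Z2 Z1 Z0 + E Z2 Z0 Z1 - E Z2 Z0 Z0)
       (mdiff (E Z2) Z1 Z2 + E Z2 Z1 Z0 + E Z2 Z0 Z2 - E Z2 Z0 Z0) (E Z2 Z2 Z0)
       (mdiff (E Z2) Z2 Z1 + E Z2 Z2 Z0 + E Z2 Z0 Z1 - E Z2 Z0 Z0)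
       (mdiff (E Z2) Z2 Z2 + E Z2 Z2 Z0 + E Z2 Z0 Z2 - E Z2 Z0 Z0)"
      by (simp add: C_def mat_of_def mdiff_def)
    have q: "(E Z2 Z0 Z0, E Z2 Z0 Z1, E Z2 Z0 Z2, E Z2 Z1 Z0, E Z2 Z2 Z0) \<in> set quints"
      by (rule quint_mem) (simp_all add: set_signs n)
    have "settled_if_sign A B C"
      using 2 co q unfolding settled2_def fo C by (auto simp: all_list_iff)
    moreover have "unit4 C" using n by (simp add: C_def mat_of_def z)
    ultimately have "settled (A, B, C)" by (simp add: settled_if_sign_def)
    moreover have s: "sig_of E = (A, B, C)" by (simp add: sig_of_def A_def B_def C_def)
    ultimately consider "sig_of E \<in> set reps" | g where "g \<in> set moves" "lexless positions (move_act g (decode (sig_of E))) (decode (sig_of E))"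
      by (auto simp: settled_def any_list_iff listed_iff split: if_splits)
    then show ?thesis
    proof cases
      case (2 g)
      have "proper g" using moves_proper(1) 2(1) by (simp add: all_list_iff)
      with 2(2) [unfolded decode_sig_of] show ?thesis by blast
    qed blast
  qed
qed

lemma wf_z3: "wf {(Z1, Z2)}"
  by (rule wfI [where A = "{Z1}" and B = "{Z2}"]) (auto)

text \<open>Replacing a signature by a smaller one in its orbit can only stop at a representative.\<close>
theorem signature_rep:
  assumes "signature R E"
  shows "\<exists>r\<in>set reps. \<exists>R'. ds_equiv R R' \<and> signature R' (decode r)"
  using assms
proof (induction "key E" arbitrary: E R rule: wf_induct_rule [OF wf_lex [OF wf_z3]])
  case (1 E R)
  from settled_balanced [OF signature_balanced [OF \<open>signature R E\<close>]]
  show ?case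
  proof
    assume "sig_of E \<in> set reps"
    then show ?thesis using \<open>signature R E\<close> ds_equiv_refl [of R] by (intro bexI [of _ "sig_of E"]) auto
  next
    assume "\<exists>g. proper g \<and> lexless positions (move_act g E) E"
    then obtain g where gg: "proper g" "lexless positions (move_act g E) E" by blast
    obtain r h e m0 n0 m1 n1 m2 n2 where "g = (r, h, e, (m0, n0), (m1, n1), (m2, n2))"
      by (rule proper.cases [of g], rule that)
    with gg have g: "e \<noteq> Z0" "m0 \<noteq> Z0" "m1 \<noteq> Z0" "m2 \<noteq> Z0"
      and l: "lexless positions (act r h e (app (Tri m0 m1 m2)) (app (Tri n0 n1 n2)) E) E"
      by simp_all
    have "e \<noteq> 0" "app (Tri m0 m1 m2) c \<noteq> 0" for c using g by (simp_all add: z3_const) (cases c; simp)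
    then obtain R' where R': "ds_equiv R R'" "signature R' (act r h e (app (Tri m0 m1 m2)) (app (Tri n0 n1 n2)) E)"
      by (rule signature_act [OF \<open>signature R E\<close>])
    have "is_sign E" using signature_balanced [OF \<open>signature R E\<close>] by (simp add: balanced_def)
    from 1(1) [OF lexless_lex [OF l this] R'(2)]
    show ?thesis using ds_equiv_trans [OF R'(1)] by blast
  qed
qed

definition affine_pairs :: "(z3 \<times> z3) list" where "affine_pairs = [(m, n). m \<leftarrow> signs, n \<leftarrow> z3_list]"

definition group0 :: "(bool \<times> z3 \<times> z3 \<times> (z3 \<times> z3) \<times> (z3 \<times> z3)) list" where
  "group0 = [(r, h, e, p, q). r \<leftarrow> [False, True], h \<leftarrow> z3_list, e \<leftarrow> signs, p \<leftarrow> affine_pairs, q \<leftarrow> affine_pairs]"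

fun not_improving :: "sig \<Rightarrow> bool \<Rightarrow> z3 \<Rightarrow> z3 \<Rightarrow> z3 \<times> z3 \<Rightarrow> z3 \<times> z3 \<Rightarrow> z3 \<times> z3 \<Rightarrow> bool" where
  "not_improving s r h e p q (m2, n2) = (\<not> improves positions s (r, h, e * m2, p, q, (m2, n2)))"

text \<open>The first matrix of the transformed signature depends on \<open>(m2, n2)\<close> only through the product
  \<open>e * m2\<close>. So it is computed once, with \<open>m2 = 1\<close> and \<open>n2 = 0\<close>, and unless it already exceeds the
  first matrix of the given signature all pairs \<open>(m2, n2)\<close> are tried, with \<open>e * m2\<close> in place of \<open>e\<close>.\<close>
fun minimal1 :: "sig \<Rightarrow> bool \<times> z3 \<times> z3 \<times> (z3 \<times> z3) \<times> (z3 \<times> z3) \<Rightarrow> bool" where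
  "minimal1 s (r, h, e, p, q) =
     (if lexless positions0 (decode s) (move_act (r, h, e, p, q, (Z1, Z0)) (decode s)) then True
      else all_list (not_improving s r h e p q) affine_pairs)"

definition minimal :: "(bool \<times> z3 \<times> z3 \<times> (z3 \<times> z3) \<times> (z3 \<times> z3)) list \<Rightarrow> sig \<Rightarrow> bool" where
  "minimal G s = all_list (minimal1 s) G"

fun nonzero_at :: "sig \<Rightarrow> z3 \<times> z3 \<times> z3 \<Rightarrow> bool" where
  "nonzero_at r (c, i, j) = (decode r c i j \<noteq> Z0)"

fun balanced_at :: "sig \<Rightarrow> z3 \<times> z3 \<times> z3 \<Rightarrow> bool" where
  "balanced_at r (i, j, k) = (k * mdiff (decode r Z0) i j + i * mdiff (decode r Z1) j k + j * mdiff (decode r Z2) k i = Z0)"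

definition balanced_sig :: "sig \<Rightarrow> bool" where
  "balanced_sig r = (if all_list (nonzero_at r) positions then all_list (balanced_at r) positions else False)"

lemma reps_balanced: "all_list balanced_sig reps"
  by code_simp

lemma reps0_minimal: "all_list (minimal group0) reps0"
  by code_simp

lemma reps1_minimal: "all_list (minimal group0) reps1"
  by code_simp

lemma reps2_minimal: "all_list (minimal group0) reps2"
  by code_simp

lemma reps3_minimal: "all_list (minimal group0) reps3"
  by code_simp

lemmas reps_minimal = reps0_minimal reps1_minimal reps2_minimal reps3_minimal

lemma balanced_sig: "balanced_sig r \<Longrightarrow> balanced (decode r)"
proof -
  assume "balanced_sig r"
  then have n: "nonzero_at r p" and b: "balanced_at r p" for p
    using set_positions [of p] by (auto simp: balanced_sig_def all_list_iff split: if_splits)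
  show ?thesis unfolding balanced_def is_sign_def
    using n [of "(c, i, j)" for c i j] b [of "(i, j, k)" for i j k] by (simp add: z3_const)
qed

lemma balanced_rep: "r \<in> set reps \<Longrightarrow> balanced (decode r)"
  using reps_balanced by (intro balanced_sig) (simp add: all_list_iff)

text \<open>The parameter \<open>e * m2\<close> of the precomputed first matrix, multiplied by \<open>m2\<close> once more, is the
  original \<open>e\<close>; hence the enumeration covers the whole group.\<close>
lemma rep_not_improved:
  assumes r: "r \<in> set reps" and e: "e \<noteq> 0" and m: "\<And>c. m c \<noteq> 0"
  shows "\<not> lexless positions (act b h e m n (decode r)) (decode r)"
proof -
  have z: "Z0 = 0" "Z1 = 1" "Z2 = -1" by (simp_all add: z3_const)
  let ?p = "(m Z0, n Z0)" and ?q = "(m Z1, n Z1)" and ?e = "e * m Z2"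
  have ap: "app (Tri (m Z0) (m Z1) (m Z2)) = m" "app (Tri (n Z0) (n Z1) (n Z2)) = n"
    by (rule app_Tri)+
  \<comment> \<open>The square of a unit is 1.\<close>
  have full: "move_act (b, h, ?e * m Z2, ?p, ?q, (m Z2, n Z2)) (decode r) = act b h e m n (decode r)"
    using m by (simp add: ap mult.assoc)
  have part: "move_act (b, h, ?e, ?p, ?q, (Z1, Z0)) (decode r) Z0 i j = act b h e m n (decode r) Z0 i j" for i j
  proof -
    have a: "Z0 - 1 = Z2" "Z0 + 1 = Z1" by (simp_all add: z3_const)
    have t: "x * Z1 = x" for x by (cases x) simp_all
    show ?thesis unfolding move_act.simps act_def a app.simps t ..
  qed
  have aff: "(m c, n c) \<in> set affine_pairs" for c
  proof -
    have "m c \<in> set signs" using m by (simp add: set_signs)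
    then show ?thesis using set_z3_list [of "n c"] unfolding affine_pairs_def in_concat in_map by blast
  qed
  have "(b, h, ?e, ?p, ?q) \<in> set group0"
  proof -
    have "b \<in> set [False, True]" by simp
    moreover have "?e \<in> set signs" using e m by (simp add: set_signs)
    ultimately show ?thesis
      using aff [of Z0] aff [of Z1] set_z3_list [of h] unfolding group0_def in_concat in_map by blast
  qed
  moreover have "minimal group0 r" using r reps_minimal unfolding all_list_iff reps_def set_append by blast
  ultimately have "minimal1 r (b, h, ?e, ?p, ?q)" unfolding minimal_def all_list_iff by blast
  then consider "lexless positions0 (decode r) (move_act (b, h, ?e, ?p, ?q, (Z1, Z0)) (decode r))"
    | "not_improving r b h ?e ?p ?q (m Z2, n Z2)"
    using aff [of Z2] unfolding minimal1.simps all_list_iff if_bool_eq_disj by blast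
  then show ?thesis
  proof cases
    case 1
    have "lexless positions0 (decode r) (move_act (b, h, ?e, ?p, ?q, (Z1, Z0)) (decode r)) = lexless positions0 (decode r) (act b h e m n (decode r))"
      by (rule lexless_cong) (use part in \<open>auto simp: positions0_def\<close>)
    with 1 have "lexless positions (decode r) (act b h e m n (decode r))" unfolding positions_def by (simp add: lexless_append)
    moreover have "is_sign (act b h e m n (decode r))"
      using balanced_rep [OF r] e m by (auto simp: is_sign_def act_def balanced_def Let_def)
    ultimately show ?thesis by (rule lexless_asym)
  next
    case 2
    then show ?thesis unfolding not_improving.simps improves.simps full .
  qed
qed

text \<open>Two representatives in one orbit are both least in it.\<close>
theorem rep_unique:
  assumes r: "r \<in> set reps" "signature R (decode r)" and s: "s \<in> set reps" "signature S (decode s)" and "ds_equiv R S"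
  shows "r = s"
proof -
  have le: "\<not> lexless positions (decode s) (decode r)"
    if r: "r \<in> set reps" "signature R (decode r)" and s: "signature S (decode s)" and e: "ds_equiv R S" for r s R S
  proof -
    obtain b h e m n where "e \<noteq> 0" "\<And>c. m c \<noteq> 0" "decode s = act b h e m n (decode r)"
      by (rule equiv_signature_act [OF e r(2) s], rule that)
    then show ?thesis using rep_not_improved [OF r(1)] by simp
  qed
  have sgn: "is_sign (decode r)" "is_sign (decode s)" using balanced_rep r(1) s(1) by (auto simp: balanced_def)
  have "decode r c i j = decode s c i j" for c i j
    by (rule lexless_total [OF sgn le [OF s r(2) ds_equiv_sym] le [OF r s(2)] set_positions]) (rule assms(5))+
  then have "decode r = decode s" by (intro ext)
  then show ?thesis by (metis sig_of_decode)
qed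

section \<open>Counting the tri-partitions of a model\<close>

text \<open>The point in coordinate \<open>c - 1\<close> of the triple with given points in coordinates \<open>c\<close> and \<open>c + 1\<close>:
  the equation between the latter two is solved for the block, the next one for the inner
  coordinate.\<close>
definition third :: "coeffs \<Rightarrow> z3 \<Rightarrow> pt \<Rightarrow> pt \<Rightarrow> pt" where
  "third E c p q = (let k = (snd q - snd p - offset E c (fst p) (fst q)) * E c (fst p) (fst q)
     in (k, snd q + offset E (c + 1) (fst q) k + E (c + 1) (fst q) k * fst p))"

lemma third_model:
  assumes "balanced E" "v \<in> model E"
  shows "third E c (v c) (v (c + 1)) = v (c - 1)"
proof -
  let ?i = "fst (v c)" and ?j = "fst (v (c + 1))" and ?k = "fst (v (c - 1))"
  have e: "snd (v (d + 1)) - snd (v d) = shift (offset E) E d (fst \<circ> v)" for d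
    using assms(2) by (simp add: model_def affine_rel_def)
  have n: "E c ?i ?j \<noteq> 0" using assms(1) by (simp add: balanced_def is_sign_def)
  have k: "(snd (v (c + 1)) - snd (v c) - offset E c ?i ?j) * E c ?i ?j = ?k"
    using n unfolding e [of c] by (simp add: shift_def mult.commute)
  have "snd (v (c - 1)) = snd (v (c + 1)) + offset E (c + 1) ?j ?k + E (c + 1) ?j ?k * ?i"
    using e [of "c + 1"] by (simp add: shift_def diff_eq_eq)
  then show ?thesis unfolding third_def k Let_def by (simp add: prod_eq_iff)
qed

definition mktri :: "(z3 \<Rightarrow> 'a) \<Rightarrow> 'a tri" where "mktri f = Tri (f Z0) (f Z1) (f Z2)"

lemma app_mktri [simp]: "app (mktri f) = f"
  unfolding mktri_def by (rule app_Tri)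

type_synonym table = "pt tri tri tri tri"

text \<open>The values of a binary function on points, stored in nested triples, so that they are computed
  once and then looked up.\<close>
definition table1 :: "(pt \<Rightarrow> pt \<Rightarrow> pt) \<Rightarrow> z3 \<Rightarrow> z3 \<Rightarrow> z3 \<Rightarrow> z3 \<Rightarrow> pt" where "table1 f i a j b = f (i, a) (j, b)"
definition table2 :: "(pt \<Rightarrow> pt \<Rightarrow> pt) \<Rightarrow> z3 \<Rightarrow> z3 \<Rightarrow> z3 \<Rightarrow> pt tri" where "table2 f i a j = mktri (table1 f i a j)"
definition table3 :: "(pt \<Rightarrow> pt \<Rightarrow> pt) \<Rightarrow> z3 \<Rightarrow> z3 \<Rightarrow> pt tri tri" where "table3 f i a = mktri (table2 f i a)"
definition table4 :: "(pt \<Rightarrow> pt \<Rightarrow> pt) \<Rightarrow> z3 \<Rightarrow> pt tri tri tri" where "table4 f i = mktri (table3 f i)"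
definition table :: "(pt \<Rightarrow> pt \<Rightarrow> pt) \<Rightarrow> table" where "table f = mktri (table4 f)"

fun lookup :: "table \<Rightarrow> pt \<Rightarrow> pt \<Rightarrow> pt" where
  "lookup t (i, a) (j, b) = app (app (app (app t i) a) j) b"

lemma lookup_table: "lookup (table f) = f"
proof (intro ext)
  fix p q show "lookup (table f) p q = f p q"
    by (cases p; cases q) (simp add: table_def table4_def table3_def table2_def table1_def)
qed

fun same_z3 :: "z3 \<Rightarrow> z3 \<Rightarrow> bool" where
  "same_z3 Z0 Z0 = True" | "same_z3 Z1 Z1 = True" | "same_z3 Z2 Z2 = True"
| "same_z3 Z0 Z1 = False" | "same_z3 Z0 Z2 = False" | "same_z3 Z1 Z0 = False"
| "same_z3 Z1 Z2 = False" | "same_z3 Z2 Z0 = False" | "same_z3 Z2 Z1 = False"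

fun same_pt :: "pt \<Rightarrow> pt \<Rightarrow> bool" where
  "same_pt (i, a) (j, b) = (if same_z3 i j then same_z3 a b else False)"

lemma same_pt_iff: "same_pt p q \<longleftrightarrow> p = q"
proof -
  have "same_z3 a b \<longleftrightarrow> a = b" for a b by (cases a; cases b) simp_all
  then show ?thesis by (cases p; cases q) simp
qed

type_synonym triad = "pt \<times> pt \<times> pt"

fun tset :: "triad \<Rightarrow> pt set" where "tset (x, y, z) = {x, y, z}"
fun proper3 :: "triad \<Rightarrow> bool" where "proper3 (x, y, z) \<longleftrightarrow> x \<noteq> y \<and> x \<noteq> z \<and> y \<noteq> z"

fun outside :: "triad \<Rightarrow> pt \<Rightarrow> bool" where
  "outside (x, y, z) p = (if same_pt p x then False else if same_pt p y then False else \<not> same_pt p z)"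

lemma outside_iff: "outside A p \<longleftrightarrow> p \<notin> tset A"
  by (cases A) (simp add: same_pt_iff)

fun disjoint3 :: "triad \<Rightarrow> triad \<Rightarrow> bool" where
  "disjoint3 (x, y, z) B = (if outside B x then if outside B y then outside B z else False else False)"

fun column3 :: "(pt \<Rightarrow> pt \<Rightarrow> pt) \<Rightarrow> triad \<Rightarrow> pt \<Rightarrow> triad" where
  "column3 f (x, y, z) p = (f x p, f y p, f z p)"

definition disjoint_columns :: "triad \<Rightarrow> triad \<Rightarrow> triad \<Rightarrow> bool" where
  "disjoint_columns s t u = (if disjoint3 s t then if disjoint3 s u then disjoint3 t u else False else False)"

text \<open>For rows and columns: the box given by the rows \<open>A\<close> and three columns contains every symbol
  if and only if the three columns of the box are disjoint; within a column the symbols differ anyway.\<close>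
fun good :: "(pt \<Rightarrow> pt \<Rightarrow> pt) \<Rightarrow> triad \<Rightarrow> triad \<Rightarrow> bool" where
  "good f A (u, v, w) = disjoint_columns (column3 f A u) (column3 f A v) (column3 f A w)"

text \<open>Nine cells cover nine symbols if and only if their entries are distinct.\<close>
lemma good_iff:
  assumes inj: "\<And>q. inj (\<lambda>p. f p q)" and A: "proper3 A"
  shows "good f A C \<longleftrightarrow> (\<forall>p. \<exists>a\<in>tset A. \<exists>c\<in>tset C. f a c = p)"
proof -
  obtain x y z where A': "A = (x, y, z)" by (cases A)
  obtain u v w where C': "C = (u, v, w)" by (cases C)
  define L where "L = [f x u, f y u, f z u, f x v, f y v, f z v, f x w, f y w, f z w]"
  have n: "f x q \<noteq> f y q" "f x q \<noteq> f z q" "f y q \<noteq> f z q" for q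
    using A inj_eq [OF inj [of q]] by (simp_all add: A')
  have "good f A C \<longleftrightarrow> distinct L"
    by (simp add: A' C' L_def disjoint_columns_def same_pt_iff n)
  also have "\<dots> \<longleftrightarrow> card (set L) = 9"
  proof -
    have "length L = 9" by (simp add: L_def)
    then show ?thesis using distinct_card [of L] card_distinct [of L] by auto
  qed
  also have "\<dots> \<longleftrightarrow> set L = UNIV"
    using card_subset_eq [of UNIV "set L"] card_pt by auto
  also have "\<dots> \<longleftrightarrow> (\<forall>p. \<exists>a\<in>tset A. \<exists>c\<in>tset C. f a c = p)"
  proof -
    have "p \<in> set L \<longleftrightarrow> (\<exists>a\<in>tset A. \<exists>c\<in>tset C. f a c = p)" for p
      by (auto simp: L_def A' C')
    then show ?thesis by (simp add: set_eq_iff)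
  qed
  finally show ?thesis .
qed

lemma good_third:
  assumes b: "balanced E" and A: "proper3 A"
  shows "good (third E c) A C \<longleftrightarrow> (\<forall>p. \<exists>v\<in>model E. v c \<in> tset A \<and> v (c + 1) \<in> tset C \<and> v (c - 1) = p)"
proof -
  have lat: "latin_rel (model E)" using presents_latin [OF presents_model [OF b]] .
  have ex: "\<exists>v\<in>model E. v c = p \<and> v (c + 1) = q" for p q by (rule latin_any(1) [OF lat]) simp
  have "inj (\<lambda>p. third E c p q)" for q
  proof (rule injI)
    fix p p' assume e: "third E c p q = third E c p' q"
    obtain v where v: "v \<in> model E" "v c = p" "v (c + 1) = q" using ex [of p q] by blast
    obtain w where w: "w \<in> model E" "w c = p'" "w (c + 1) = q" using ex [of p' q] by blast
    have "v (c - 1) = w (c - 1)" using third_model [OF b v(1), of c] third_model [OF b w(1), of c] v w e by simp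
    then have "v = w" using v w latin_any(2) [OF lat, of "c + 1" "c - 1" v w] by simp
    then show "p = p'" using v w by simp
  qed
  then have g: "good (third E c) A C \<longleftrightarrow> (\<forall>p. \<exists>a\<in>tset A. \<exists>q\<in>tset C. third E c a q = p)" by (rule good_iff [OF _ A])
  have "(\<exists>a\<in>tset A. \<exists>q\<in>tset C. third E c a q = p) \<longleftrightarrow>
      (\<exists>v\<in>model E. v c \<in> tset A \<and> v (c + 1) \<in> tset C \<and> v (c - 1) = p)" for p
  proof
    assume "\<exists>a\<in>tset A. \<exists>q\<in>tset C. third E c a q = p"
    then obtain a q where aq: "a \<in> tset A" "q \<in> tset C" "third E c a q = p" by blast
    obtain v where "v \<in> model E" "v c = a" "v (c + 1) = q" using ex by blast
    then show "\<exists>v\<in>model E. v c \<in> tset A \<and> v (c + 1) \<in> tset C \<and> v (c - 1) = p"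
      using third_model [OF b, of v c] aq by auto
  next
    assume "\<exists>v\<in>model E. v c \<in> tset A \<and> v (c + 1) \<in> tset C \<and> v (c - 1) = p"
    then show "\<exists>a\<in>tset A. \<exists>q\<in>tset C. third E c a q = p" using third_model [OF b, of _ c] by blast
  qed
  then show ?thesis unfolding g by simp
qed

text \<open>The sets \<open>{x, y, z}\<close> with \<open>y\<close>, \<open>z\<close> from a list, each of them once, in the order of the list.\<close>
fun triads1 :: "pt \<Rightarrow> pt list \<Rightarrow> triad list" where
  "triads1 x [] = []"
| "triads1 x (y # ys) = map (\<lambda>z. (x, y, z)) ys @ triads1 x ys"

fun triads :: "pt list \<Rightarrow> triad list" where
  "triads [] = []" | "triads (x # xs) = triads1 x xs"

definition rest :: "triad \<Rightarrow> pt list \<Rightarrow> pt list" where "rest A xs = filter (outside A) xs"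

text \<open>The partitions of a list of \<open>3 * n\<close> points into triads, each written in a unique way: the next
  triad always contains the first point that is left.\<close>
primrec parts :: "nat \<Rightarrow> pt list \<Rightarrow> triad list set" where
  "parts 0 xs = {[]}"
| "parts (Suc n) xs = (\<Union>A\<in>set (triads xs). (#) A ` parts n (rest A xs))"

lemma triads1_mem: "A \<in> set (triads1 x xs) \<Longrightarrow> \<exists>y z. A = (x, y, z) \<and> y \<in> set xs \<and> z \<in> set xs"
  by (induction xs) auto

lemma triads1_neq: "distinct xs \<Longrightarrow> (x, y, z) \<in> set (triads1 x xs) \<Longrightarrow> y \<noteq> z"
  by (induction xs) auto

lemma triads1_ex:
  "y \<in> set xs \<Longrightarrow> z \<in> set xs \<Longrightarrow> y \<noteq> z \<Longrightarrow> (x, y, z) \<in> set (triads1 x xs) \<or> (x, z, y) \<in> set (triads1 x xs)"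
proof (induction xs)
  case (Cons w ws)
  then show ?case by (cases "w = y"; cases "w = z") auto
qed simp

lemma triads1_asym: "distinct xs \<Longrightarrow> (x, y, z) \<in> set (triads1 x xs) \<Longrightarrow> (x, z, y) \<notin> set (triads1 x xs)"
proof (induction xs)
  case (Cons w ws)
  then show ?case using triads1_mem [of "(x, y, z)" x ws] triads1_mem [of "(x, z, y)" x ws] by auto
qed simp

lemma set_rest: "set (rest A xs) = set xs - tset A"
  by (auto simp: rest_def outside_iff)

lemma triads_proper:
  assumes "distinct xs" "A \<in> set (triads xs)"
  shows "proper3 A" "tset A \<subseteq> set xs" "hd xs \<in> tset A" "card (tset A) = 3" "xs \<noteq> []"
proof -
  obtain x ys where xs: "xs = x # ys" using assms(2) by (cases xs) auto
  obtain y z where A: "A = (x, y, z)" "y \<in> set ys" "z \<in> set ys" using triads1_mem [of A x ys] assms(2) by (auto simp: xs)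
  have "y \<noteq> z" using triads1_neq [of ys x y z] assms by (simp add: xs A)
  then show "proper3 A" "tset A \<subseteq> set xs" "hd xs \<in> tset A" "card (tset A) = 3" "xs \<noteq> []"
    using assms(1) A(2,3) by (auto simp: A(1) xs card_insert_if)
qed

lemma length_rest:
  assumes "distinct xs" "A \<in> set (triads xs)" shows "length (rest A xs) + 3 = length xs" "distinct (rest A xs)"
proof -
  show d: "distinct (rest A xs)" using assms(1) by (simp add: rest_def)
  have "card (set xs - tset A) = card (set xs) - 3"
    using triads_proper [OF assms] by (subst card_Diff_subset) (auto intro: finite_subset)
  moreover have "3 \<le> card (set xs)" using triads_proper [OF assms] card_mono [of "set xs" "tset A"] by simp
  ultimately show "length (rest A xs) + 3 = length xs"
    using distinct_card [OF d] distinct_card [OF assms(1)] by (simp add: set_rest)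
qed

definition blocks_of :: "triad list \<Rightarrow> pt set set" where "blocks_of P = tset ` set P"

lemma parts_sound:
  assumes "distinct xs" "length xs = 3 * n" "P \<in> parts n xs"
  shows "partition_on (set xs) (blocks_of P) \<and> card (blocks_of P) = n \<and> (\<forall>A\<in>set P. proper3 A \<and> card (tset A) = 3)"
  using assms
proof (induction n arbitrary: xs P)
  case 0 then show ?case by (simp add: blocks_of_def partition_on_empty)
next
  case (Suc n)
  from Suc.prems(3) obtain A P' where P: "P = A # P'" "A \<in> set (triads xs)" "P' \<in> parts n (rest A xs)" by auto
  note t = triads_proper [OF Suc.prems(1) P(2)] and r = length_rest [OF Suc.prems(1) P(2)]
  have len: "length (rest A xs) = 3 * n" using r(1) Suc.prems(2) by simp
  have IH: "partition_on (set xs - tset A) (blocks_of P')" "card (blocks_of P') = n" "\<forall>A\<in>set P'. proper3 A \<and> card (tset A) = 3"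
    using Suc.IH [OF r(2) len P(3)] by (simp_all add: set_rest)
  have un: "\<Union>(blocks_of P') = set xs - tset A" using partition_onD1 [OF IH(1)] by simp
  have bl: "blocks_of P = insert (tset A) (blocks_of P')" by (simp add: blocks_of_def P(1))
  have "partition_on (set xs) (insert (tset A) (blocks_of P'))"
  proof (subst partition_on_insert)
    show "disjnt (tset A) (\<Union>(blocks_of P'))" unfolding un disjnt_def by blast
    show "partition_on (set xs - tset A) (blocks_of P') \<and> tset A \<subseteq> set xs \<and> tset A \<noteq> {}"
      using IH(1) t by auto
  qed
  moreover have "tset A \<notin> blocks_of P'" using un t(3) by blast
  moreover have "finite (blocks_of P')" by (simp add: blocks_of_def)
  ultimately show ?case unfolding bl using IH t by (simp add: P(1))
qed

lemma parts_complete: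
  assumes "distinct xs" "length xs = 3 * n" "partition_on (set xs) Q" "\<forall>A\<in>Q. card A = 3"
  shows "\<exists>P\<in>parts n xs. blocks_of P = Q"
  using assms
proof (induction n arbitrary: xs Q)
  case 0 then show ?case by (simp add: blocks_of_def partition_on_empty)
next
  case (Suc n)
  obtain x ys where xs: "xs = x # ys" using Suc.prems(2) by (cases xs) auto
  have "x \<in> set xs" by (simp add: xs)
  then have "x \<in> \<Union>Q" using partition_onD1 [OF Suc.prems(3)] by simp
  then obtain B where B: "B \<in> Q" "x \<in> B" by blast
  have "card B = 3" using Suc.prems(4) B by blast
  then have c2: "card (B - {x}) = 2" using B(2) by simp
  then obtain y z where yz: "B - {x} = {y, z}" "y \<noteq> z" by (auto simp: card_2_iff)
  have sub: "B \<subseteq> set xs" using partition_onD1 [OF Suc.prems(3)] B(1) by blast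
  have mem: "y \<in> set ys" "z \<in> set ys" using yz(1) sub by (auto simp: xs)
  have Bxyz: "B = {x, y, z}" using yz(1) B(2) by blast
  have "\<exists>A\<in>set (triads xs). tset A = B"
  proof (cases "(x, y, z) \<in> set (triads1 x ys)")
    case True
    then show ?thesis by (intro bexI [of _ "(x, y, z)"]) (simp_all add: xs Bxyz)
  next
    case False
    then have "(x, z, y) \<in> set (triads1 x ys)" using triads1_ex [OF mem yz(2), of x] by blast
    then show ?thesis by (intro bexI [of _ "(x, z, y)"]) (simp_all add: xs Bxyz insert_commute)
  qed
  then obtain A where A: "A \<in> set (triads xs)" "tset A = B" by blast
  note r = length_rest [OF Suc.prems(1) A(1)]
  have len: "length (rest A xs) = 3 * n" using r(1) Suc.prems(2) by simp
  have Q: "insert B (Q - {B}) = Q" using B(1) by blast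
  have dj: "disjnt B (\<Union>(Q - {B}))"
    using partition_onD2 [OF Suc.prems(3)] B(1) unfolding disjoint_def disjnt_def by blast
  have "partition_on (set xs - B) (Q - {B})"
    using Suc.prems(3) partition_on_insert [OF dj, of "set xs"] Q by simp
  then have "partition_on (set (rest A xs)) (Q - {B})" by (simp add: set_rest A(2))
  then obtain P where P: "P \<in> parts n (rest A xs)" "blocks_of P = Q - {B}"
    using Suc.IH [OF r(2) len] Suc.prems(4) by blast
  have "A # P \<in> parts (Suc n) xs" using A(1) P(1) by auto
  moreover have "blocks_of (A # P) = Q" using P(2) Q A(2) by (simp add: blocks_of_def)
  ultimately show ?case by blast
qed

lemma parts_inj:
  assumes "distinct xs" "length xs = 3 * n" "P \<in> parts n xs" "P' \<in> parts n xs" "blocks_of P = blocks_of P'"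
  shows "P = P'"
  using assms
proof (induction n arbitrary: xs P P')
  case (Suc n)
  note d = Suc.prems(1)
  from Suc.prems(3) obtain A S where P: "P = A # S" "A \<in> set (triads xs)" "S \<in> parts n (rest A xs)" by auto
  from Suc.prems(4) obtain A' S' where P': "P' = A' # S'" "A' \<in> set (triads xs)" "S' \<in> parts n (rest A' xs)" by auto
  note t = triads_proper [OF d P(2)] and t' = triads_proper [OF d P'(2)]
  have p: "partition_on (set xs) (blocks_of P)" using parts_sound [OF Suc.prems(1-3)] by simp
  have "tset A \<in> blocks_of P" by (simp add: blocks_of_def P(1))
  moreover have "tset A' \<in> blocks_of P" unfolding Suc.prems(5) by (simp add: blocks_of_def P'(1))
  ultimately have eq: "tset A = tset A'" using partition_onD2 [OF p] t(3) t'(3) unfolding disjoint_def by blast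
  obtain x ys where xs: "xs = x # ys" using t(5) by (cases xs) auto
  obtain y z where A: "A = (x, y, z)" using triads1_mem [of A x ys] P(2) by (auto simp: xs)
  obtain y' z' where A': "A' = (x, y', z')" using triads1_mem [of A' x ys] P'(2) by (auto simp: xs)
  have "y = y' \<and> z = z' \<or> y = z' \<and> z = y'"
  proof -
    \<comment> \<open>Both triads start with the first point of the list.\<close>
    have "{y, z} = tset A - {x}" "{y', z'} = tset A' - {x}" using t(1) t'(1) by (auto simp: A A')
    then have "{y, z} = {y', z'}" by (simp only: eq)
    then show ?thesis by (simp only: doubleton_eq_iff)
  qed
  moreover have "\<not> (y = z' \<and> z = y')" if "\<not> (y = y' \<and> z = z')"
    using triads1_asym [of ys x y z] d P(2) P'(2) by (auto simp: xs A A')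
  ultimately have AA: "A = A'" unfolding A A' by blast
  note r = length_rest [OF d P(2)]
  have len: "length (rest A xs) = 3 * n" using r(1) Suc.prems(2) by simp
  have n: "tset A \<notin> blocks_of T" if "T \<in> parts n (rest A xs)" for T
  proof -
    have "\<Union>(blocks_of T) = set xs - tset A"
      using parts_sound [OF r(2) len that] partition_onD1 [of "set (rest A xs)" "blocks_of T"] by (simp add: set_rest)
    then show ?thesis using t(3) by blast
  qed
  have "insert (tset A) (blocks_of S) = insert (tset A) (blocks_of S')"
    using Suc.prems(5) by (simp add: blocks_of_def P(1) P'(1) AA)
  then have "blocks_of S = blocks_of S'"
    using n [OF P(3)] n [OF P'(3) [folded AA]] by (metis insert_ident)
  then have "S = S'" using Suc.IH [OF r(2) len P(3) P'(3) [folded AA]] by simp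
  then show ?case by (simp add: P(1) P'(1) AA)
qed simp

definition points :: "pt list" where "points = [(i, a). i \<leftarrow> z3_list, a \<leftarrow> z3_list]"

lemma points: "distinct points" "length points = 3 * 3" "set points = UNIV"
proof -
  show d: "distinct points" and l: "length points = 3 * 3" by (simp_all add: points_def z3_list_def)
  have "card (set points) = 9" using distinct_card [OF d] l by simp
  then show "set points = UNIV" using card_subset_eq [of UNIV "set points"] card_pt by simp
qed

lemma sudoku_partition_parts: "sudoku_partition 3 UNIV Q \<longleftrightarrow> Q \<in> blocks_of ` parts 3 points"
proof
  assume "sudoku_partition 3 UNIV Q"
  then show "Q \<in> blocks_of ` parts 3 points"
    using parts_complete [OF points(1,2), of Q] by (auto simp: sudoku_partition_def points(3))
next
  assume "Q \<in> blocks_of ` parts 3 points"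
  then obtain P where "P \<in> parts 3 points" "Q = blocks_of P" by blast
  then show "sudoku_partition 3 UNIV Q"
    using parts_sound [OF points(1,2), of P] by (auto simp: sudoku_partition_def points(3) card_pt blocks_of_def)
qed

fun concat_map :: "('a \<Rightarrow> 'b list) \<Rightarrow> 'a list \<Rightarrow> 'b list" where
  "concat_map f [] = []" | "concat_map f (x # xs) = f x @ concat_map f xs"

lemma set_concat_map: "set (concat_map f xs) = (\<Union>x\<in>set xs. set (f x))"
  by (induction xs) auto

definition good_flip :: "(pt \<Rightarrow> pt \<Rightarrow> pt) \<Rightarrow> triad \<Rightarrow> triad \<Rightarrow> bool" where "good_flip f C A = good f A C"

text \<open>One more triad is chosen in each of the three coordinates, the choice being abandoned as soon as
  the new triad fails against one chosen earlier; the continuation \<open>K\<close> goes on with the remaining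
  points.\<close>
definition extend3 where
  "extend3 K f g h xs ys zs As Cs Ds D = (if all_list (good h D) As then if all_list (good_flip g D) Cs
     then K f g h xs ys (rest D zs) As Cs (D # Ds) else [] else [])"
definition extend2 where
  "extend2 K f g h xs ys zs As Cs Ds C = (if all_list (good_flip f C) As then if all_list (good g C) Ds
     then concat_map (extend3 K f g h xs (rest C ys) zs As (C # Cs) Ds) (triads zs) else [] else [])"
definition extend1 where
  "extend1 K f g h xs ys zs As Cs Ds A = (if all_list (good f A) Cs then if all_list (good_flip h A) Ds
     then concat_map (extend2 K f g h (rest A xs) ys zs (A # As) Cs Ds) (triads ys) else [] else [])"
definition extend where
  "extend K f g h xs ys zs As Cs Ds = concat_map (extend1 K f g h xs ys zs As Cs Ds) (triads xs)"

primrec search :: "nat \<Rightarrow> (pt \<Rightarrow> pt \<Rightarrow> pt) \<Rightarrow> (pt \<Rightarrow> pt \<Rightarrow> pt) \<Rightarrow> (pt \<Rightarrow> pt \<Rightarrow> pt) \<Rightarrow> pt list \<Rightarrow> pt list \<Rightarrow> pt list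
    \<Rightarrow> triad list \<Rightarrow> triad list \<Rightarrow> triad list \<Rightarrow> (triad list \<times> triad list \<times> triad list) list" where
  "search 0 = (\<lambda>f g h xs ys zs As Cs Ds. [(As, Cs, Ds)])"
| "search (Suc n) = extend (search n)"

definition compatible where
  "compatible f g h As Cs Ds \<longleftrightarrow> (\<forall>A\<in>set As. \<forall>C\<in>set Cs. good f A C) \<and>
     (\<forall>C\<in>set Cs. \<forall>D\<in>set Ds. good g C D) \<and> (\<forall>D\<in>set Ds. \<forall>A\<in>set As. good h D A)"

lemma extend_mem:
  assumes "compatible f g h As Cs Ds"
  shows "t \<in> set (extend K f g h xs ys zs As Cs Ds) \<longleftrightarrow>
    (\<exists>A\<in>set (triads xs). \<exists>C\<in>set (triads ys). \<exists>D\<in>set (triads zs). compatible f g h (A # As) (C # Cs) (D # Ds) \<and>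
      t \<in> set (K f g h (rest A xs) (rest C ys) (rest D zs) (A # As) (C # Cs) (D # Ds)))"
proof -
  have i: "t \<in> set (if b then l else []) \<longleftrightarrow> b \<and> t \<in> set l" for b and l :: "'x list" and t by simp
  have c: "compatible f g h (A # As) (C # Cs) (D # Ds) \<longleftrightarrow> (\<forall>C\<in>set Cs. good f A C) \<and> (\<forall>D\<in>set Ds. good h D A) \<and>
     (\<forall>A\<in>set (A # As). good f A C) \<and> (\<forall>D\<in>set Ds. good g C D) \<and> (\<forall>A\<in>set (A # As). good h D A) \<and> (\<forall>C\<in>set (C # Cs). good g C D)"
    for A C D
    using assms unfolding compatible_def by auto
  show ?thesis
    unfolding extend_def extend1_def extend2_def extend3_def set_concat_map UN_iff i all_list_iff good_flip_def c by blast
qed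

lemma compatible_mono:
  assumes c: "compatible f g h As Cs Ds"
    and sub: "set As' \<subseteq> set As" "set Cs' \<subseteq> set Cs" "set Ds' \<subseteq> set Ds"
  shows "compatible f g h As' Cs' Ds'"
  unfolding compatible_def
proof (intro conjI ballI)
  have c': "\<And>A C. A \<in> set As \<Longrightarrow> C \<in> set Cs \<Longrightarrow> good f A C" "\<And>C D. C \<in> set Cs \<Longrightarrow> D \<in> set Ds \<Longrightarrow> good g C D"
    "\<And>D A. D \<in> set Ds \<Longrightarrow> A \<in> set As \<Longrightarrow> good h D A" using c unfolding compatible_def by simp_all
  show "good f A C" if "A \<in> set As'" "C \<in> set Cs'" for A C
    by (rule c'(1) [OF subsetD [OF sub(1) that(1)] subsetD [OF sub(2) that(2)]])
  show "good g C D" if "C \<in> set Cs'" "D \<in> set Ds'" for C D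
    by (rule c'(2) [OF subsetD [OF sub(2) that(1)] subsetD [OF sub(3) that(2)]])
  show "good h D A" if "D \<in> set Ds'" "A \<in> set As'" for D A
    by (rule c'(3) [OF subsetD [OF sub(3) that(1)] subsetD [OF sub(1) that(2)]])
qed

lemma search_mem:
  assumes "compatible f g h As Cs Ds"
  shows "t \<in> set (search n f g h xs ys zs As Cs Ds) \<longleftrightarrow>
    (\<exists>P\<in>parts n xs. \<exists>Q\<in>parts n ys. \<exists>W\<in>parts n zs. t = (rev P @ As, rev Q @ Cs, rev W @ Ds) \<and>
       compatible f g h (rev P @ As) (rev Q @ Cs) (rev W @ Ds))"
  using assms
proof (induction n arbitrary: xs ys zs As Cs Ds)
  case 0 then show ?case by auto
next
  case (Suc n)
  have "t \<in> set (search (Suc n) f g h xs ys zs As Cs Ds) \<longleftrightarrow>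
    (\<exists>A\<in>set (triads xs). \<exists>C\<in>set (triads ys). \<exists>D\<in>set (triads zs). compatible f g h (A # As) (C # Cs) (D # Ds) \<and>
      (\<exists>P\<in>parts n (rest A xs). \<exists>Q\<in>parts n (rest C ys). \<exists>W\<in>parts n (rest D zs).
        t = (rev P @ A # As, rev Q @ C # Cs, rev W @ D # Ds) \<and>
        compatible f g h (rev P @ A # As) (rev Q @ C # Cs) (rev W @ D # Ds)))"
    unfolding search.simps extend_mem [OF Suc.prems] using Suc.IH by blast
  also have "\<dots> \<longleftrightarrow> (\<exists>A\<in>set (triads xs). \<exists>C\<in>set (triads ys). \<exists>D\<in>set (triads zs).
      \<exists>P\<in>parts n (rest A xs). \<exists>Q\<in>parts n (rest C ys). \<exists>W\<in>parts n (rest D zs).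
        t = (rev P @ A # As, rev Q @ C # Cs, rev W @ D # Ds) \<and>
        compatible f g h (rev P @ A # As) (rev Q @ C # Cs) (rev W @ D # Ds))"
  proof -
    have "compatible f g h (A # As) (C # Cs) (D # Ds)"
      if "compatible f g h (rev P @ A # As) (rev Q @ C # Cs) (rev W @ D # Ds)" for A C D P Q W
      by (rule compatible_mono [OF that]) auto
    then show ?thesis by blast
  qed
  also have "\<dots> \<longleftrightarrow> (\<exists>P\<in>parts (Suc n) xs. \<exists>Q\<in>parts (Suc n) ys. \<exists>W\<in>parts (Suc n) zs.
       t = (rev P @ As, rev Q @ Cs, rev W @ Ds) \<and> compatible f g h (rev P @ As) (rev Q @ Cs) (rev W @ Ds))"
  proof -
    have b: "(\<exists>P\<in>parts (Suc n) l. \<Phi> P) \<longleftrightarrow> (\<exists>A\<in>set (triads l). \<exists>P\<in>parts n (rest A l). \<Phi> (A # P))" for l \<Phi> by auto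
    show ?thesis unfolding b by (simp only: rev.simps append_assoc append_Cons append_Nil) blast
  qed
  finally show ?case .
qed

definition tri_partitions :: "coeffs \<Rightarrow> (triad list \<times> triad list \<times> triad list) list" where
  "tri_partitions E = search (Suc (Suc (Suc 0))) (lookup (table (third E Z0))) (lookup (table (third E Z1)))
     (lookup (table (third E Z2))) points points points [] [] []"

text \<open>The search finds exactly the tri-partitions, each in its unique form as lists of triads; so the
  number of its distinct results is \<open>\<pi>\<close>.\<close>
lemma card_tri_partitions:
  assumes b: "balanced E"
  shows "card {Q. tri_partition_rel (model E) Q} = length (remdups (tri_partitions E))"
proof -
  have z: "Z0 = 0" "Z1 = 1" "Z2 = -1" by (simp_all add: z3_const)
  define \<Phi> where "\<Phi> P Q W \<longleftrightarrow> compatible (third E 0) (third E 1) (third E (-1)) (rev P) (rev Q) (rev W)" for P Q W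
  have mem: "t \<in> set (tri_partitions E) \<longleftrightarrow>
     (\<exists>P\<in>parts 3 points. \<exists>Q\<in>parts 3 points. \<exists>W\<in>parts 3 points. t = (rev P, rev Q, rev W) \<and> \<Phi> P Q W)" for t
  proof -
    have e: "compatible (third E 0) (third E 1) (third E (-1)) [] [] []" by (simp add: compatible_def)
    show ?thesis unfolding tri_partitions_def lookup_table z \<Phi>_def numeral_3_eq_3
      unfolding search_mem [OF e] append_Nil2 ..
  qed
  define F where "F = (\<lambda>(P, Q, W) (c :: z3). blocks_of (if c = 0 then P else if c = 1 then Q else W))"
  have br: "blocks_of (rev P) = blocks_of P" for P by (simp add: blocks_of_def)
  have F: "F (P, Q, W) 0 = blocks_of P" "F (P, Q, W) 1 = blocks_of Q" "F (P, Q, W) (-1) = blocks_of W" for P Q W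
    by (simp_all add: F_def)
  have pr: "proper3 A" if "P \<in> parts 3 points" "A \<in> set P" for A P
    using parts_sound [OF points(1,2) that(1)] that(2) by blast
  have div: "divides (model E) (F (P, Q, W)) \<longleftrightarrow> \<Phi> P Q W"
    if P: "P \<in> parts 3 points" "Q \<in> parts 3 points" "W \<in> parts 3 points" for P Q W
  proof -
    have g: "(\<forall>A\<in>blocks_of P. \<forall>C\<in>blocks_of Q. \<forall>p. \<exists>v\<in>model E. v c \<in> A \<and> v (c + 1) \<in> C \<and> v (c - 1) = p)
       \<longleftrightarrow> (\<forall>A\<in>set P. \<forall>C\<in>set Q. good (third E c) A C)" if "P \<in> parts 3 points" for P Q c
    proof -
      have "(\<forall>A\<in>blocks_of P. \<forall>C\<in>blocks_of Q. \<forall>p. \<exists>v\<in>model E. v c \<in> A \<and> v (c + 1) \<in> C \<and> v (c - 1) = p)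
       \<longleftrightarrow> (\<forall>A\<in>set P. \<forall>C\<in>set Q. \<forall>p. \<exists>v\<in>model E. v c \<in> tset A \<and> v (c + 1) \<in> tset C \<and> v (c - 1) = p)"
        unfolding blocks_of_def by blast
      also have "\<dots> \<longleftrightarrow> (\<forall>A\<in>set P. \<forall>C\<in>set Q. good (third E c) A C)"
        using good_third [OF b pr [OF that]] by blast
      finally show ?thesis .
    qed
    have n: "(0::z3) + 1 = 1" "(1::z3) + 1 = -1" "(-1::z3) + 1 = 0" by simp_all
    have "divides (model E) (F (P, Q, W)) \<longleftrightarrow> (\<forall>c. \<forall>A\<in>F (P, Q, W) c. \<forall>C\<in>F (P, Q, W) (c + 1). \<forall>p. \<exists>v\<in>model E. v c \<in> A \<and> v (c + 1) \<in> C \<and> v (c - 1) = p)"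
      by (simp only: divides_def)
    also have "\<dots> \<longleftrightarrow> (\<forall>A\<in>set P. \<forall>C\<in>set Q. good (third E 0) A C) \<and> (\<forall>A\<in>set Q. \<forall>C\<in>set W. good (third E 1) A C) \<and>
        (\<forall>A\<in>set W. \<forall>C\<in>set P. good (third E (-1)) A C)"
    proof -
      define X where "X c \<longleftrightarrow> (\<forall>A\<in>F (P, Q, W) c. \<forall>C\<in>F (P, Q, W) (c + 1). \<forall>p. \<exists>v\<in>model E. v c \<in> A \<and> v (c + 1) \<in> C \<and> v (c - 1) = p)" for c
      have "X 0 \<longleftrightarrow> (\<forall>A\<in>set P. \<forall>C\<in>set Q. good (third E 0) A C)"
        using g [OF P(1), of Q 0] by (simp add: X_def F)
      moreover have "X 1 \<longleftrightarrow> (\<forall>A\<in>set Q. \<forall>C\<in>set W. good (third E 1) A C)"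
        using g [OF P(2), of W 1] by (simp add: X_def F)
      moreover have "X (-1) \<longleftrightarrow> (\<forall>A\<in>set W. \<forall>C\<in>set P. good (third E (-1)) A C)"
        using g [OF P(3), of P "-1"] by (simp add: X_def F)
      ultimately show ?thesis unfolding X_def [symmetric] z3_all by simp
    qed
    finally show ?thesis by (simp add: \<Phi>_def compatible_def)
  qed
  have "{Q. tri_partition_rel (model E) Q} = F ` set (tri_partitions E)"
  proof (intro equalityI subsetI)
    fix Q assume "Q \<in> {Q. tri_partition_rel (model E) Q}"
    then have s: "\<And>c. sudoku_partition 3 UNIV (Q c)" and d: "divides (model E) Q" by (auto simp: tri_partition_rel_def)
    obtain P where P: "P \<in> parts 3 points" "Q 0 = blocks_of P" using s [of 0] sudoku_partition_parts by auto
    obtain P1 where P1: "P1 \<in> parts 3 points" "Q 1 = blocks_of P1" using s [of 1] sudoku_partition_parts by auto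
    obtain P2 where P2: "P2 \<in> parts 3 points" "Q (-1) = blocks_of P2" using s [of "-1"] sudoku_partition_parts by auto
    have Q: "Q = F (P, P1, P2)" by (rule ext3 [of _ 0]) (simp_all add: F P P1 P2)
    then have "\<Phi> P P1 P2" using d div [OF P(1) P1(1) P2(1)] by simp
    then have "(rev P, rev P1, rev P2) \<in> set (tri_partitions E)" unfolding mem using P P1 P2 by blast
    moreover have "Q = F (rev P, rev P1, rev P2)" unfolding Q by (rule ext3 [of _ 0]) (simp_all add: F br)
    ultimately show "Q \<in> F ` set (tri_partitions E)" by blast
  next
    fix Q assume "Q \<in> F ` set (tri_partitions E)"
    then obtain t where t: "t \<in> set (tri_partitions E)" "Q = F t" by blast
    obtain P P1 P2 where P: "P \<in> parts 3 points" "P1 \<in> parts 3 points" "P2 \<in> parts 3 points" "\<Phi> P P1 P2"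
      and tP: "t = (rev P, rev P1, rev P2)" using t(1) unfolding mem by blast
    have Q: "Q = F (rev P, rev P1, rev P2)" by (simp only: t(2) tP)
    have Q: "Q = F (P, P1, P2)" unfolding Q by (rule ext3 [of _ 0]) (simp_all add: F br)
    have "sudoku_partition 3 UNIV (Q c)" for c
      using P(1-3) unfolding Q F_def sudoku_partition_parts by simp
    then show "Q \<in> {Q. tri_partition_rel (model E) Q}" using div [OF P(1-3)] P(4) by (simp add: tri_partition_rel_def Q)
  qed
  moreover have "inj_on F (set (tri_partitions E))"
  proof (rule inj_onI)
    fix t t' assume "t \<in> set (tri_partitions E)" "t' \<in> set (tri_partitions E)" and e: "F t = F t'"
    then obtain P P1 P2 R R1 R2 where t: "t = (rev P, rev P1, rev P2)" "t' = (rev R, rev R1, rev R2)"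
      and m: "P \<in> parts 3 points" "P1 \<in> parts 3 points" "P2 \<in> parts 3 points"
        "R \<in> parts 3 points" "R1 \<in> parts 3 points" "R2 \<in> parts 3 points"
      unfolding mem by blast
    have "blocks_of P = blocks_of R" "blocks_of P1 = blocks_of R1" "blocks_of P2 = blocks_of R2"
      using fun_cong [OF e, of 0] fun_cong [OF e, of 1] fun_cong [OF e, of "-1"] unfolding t F br by simp_all
    then show "t = t'" using parts_inj [OF points(1,2)] m unfolding t by blast
  qed
  ultimately show ?thesis by (simp add: card_image length_remdups_card_conv)
qed

definition tri_count :: "sig \<Rightarrow> nat" where "tri_count r = length (remdups (tri_partitions (decode r)))"


section \<open>The classes and their values\<close>

definition shifted :: "z3 tri \<Rightarrow> pt \<Rightarrow> pt" where
  "shifted t p = (fst p, snd p + app t (fst p))"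

fun cell_agrees :: "(nat \<Rightarrow> nat \<Rightarrow> nat) \<Rightarrow> sig \<Rightarrow> z3 tri \<Rightarrow> z3 tri \<Rightarrow> z3 tri \<Rightarrow> pt \<times> pt \<Rightarrow> bool" where
  "cell_agrees L s t0 t1 t2 (p, q) =
    (L (enc p) (enc q) = enc (shifted t2 (third (decode s) Z0 (shifted t0 p) (shifted t1 q))))"

fun agrees_at :: "coeffs \<Rightarrow> coeffs \<Rightarrow> z3 \<times> z3 \<times> z3 \<Rightarrow> bool" where
  "agrees_at E E' (c, i, j) = (E c i j = E' c i j)"

definition cells :: "(pt \<times> pt) list" where "cells = [(p, q). p \<leftarrow> points, q \<leftarrow> points]"

text \<open>Translating the blocks of rows, columns and symbols by \<open>t0\<close>, \<open>t1\<close> and \<open>- t2\<close> carries \<open>L\<close> to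
  the model of the signature \<open>s\<close>, and the move \<open>g\<close> takes \<open>s\<close> to \<open>r\<close>.\<close>
definition identified :: "(nat \<Rightarrow> nat \<Rightarrow> nat) \<Rightarrow> sig \<Rightarrow> z3 tri \<Rightarrow> z3 tri \<Rightarrow> z3 tri \<Rightarrow> move \<Rightarrow> sig \<Rightarrow> bool" where
  "identified L s t0 t1 t2 g r \<longleftrightarrow> balanced_sig s \<and> all_list (cell_agrees L s t0 t1 t2) cells \<and>
     proper g \<and> all_list (agrees_at (move_act g (decode s)) (decode r)) positions"

lemma model_mem:
  assumes b: "balanced E"
  shows "w \<in> model E \<longleftrightarrow> third E 0 (w 0) (w 1) = w (-1)"
proof
  assume "w \<in> model E"
  then show "third E 0 (w 0) (w 1) = w (-1)" using third_model [OF b, of w 0] by simp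
next
  assume t: "third E 0 (w 0) (w 1) = w (-1)"
  have lat: "latin_rel (model E)" using presents_latin [OF presents_model [OF b]] .
  obtain v where v: "v \<in> model E" "v 0 = w 0" "v 1 = w 1" using latin_any(1) [OF lat, of 0 1 "w 0" "w 1"] by auto
  have "v (-1) = w (-1)" using third_model [OF b v(1), of 0] t v by simp
  then have "v = w" using v by (intro ext3 [of _ 0]) simp_all
  then show "w \<in> model E" using v(1) by simp
qed

definition rep_class :: "sig \<Rightarrow> (nat \<Rightarrow> nat \<Rightarrow> nat) set" where
  "rep_class r = {L. standard_division_sudoku L \<and> ds_equiv (rel_of L) (model (decode r))}"

lemma model_signature: "r \<in> set reps \<Longrightarrow> signature (model (decode r)) (decode r)"
  using presents_model [OF balanced_rep] unfolding signature_def by blast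

lemma ds_equiv_latin:
  assumes "ds_equiv R S" and lat: "latin_rel S" shows "latin_rel R"
proof -
  from ds_equiv_sym [OF assms(1)] obtain \<theta> \<psi> where th: "bij \<theta>" and bm: "\<And>c. block_map (\<psi> c)"
     and RR: "\<And>v. v \<in> S \<longleftrightarrow> (\<lambda>c. \<psi> c (v (\<theta> c))) \<in> R"
    unfolding ds_equiv_def by blast
  have inj: "\<psi> c x = \<psi> c y \<longleftrightarrow> x = y" for c x y using bm [of c] by (simp add: block_map_def bij_def inj_eq)
  have surj: "\<exists>x. \<psi> c x = y" for c y using bm [of c] unfolding block_map_def by (metis bij_pointE)
  have thn: "\<theta> c \<noteq> \<theta> (c + 1)" for c using th by (simp add: bij_def inj_eq)
  have pre: "\<exists>w. v = (\<lambda>c. \<psi> c (w (\<theta> c)))" for v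
  proof -
    have "\<exists>x. \<psi> (inv \<theta> c) x = v (inv \<theta> c)" for c by (rule surj)
    then obtain w where w: "\<And>c. \<psi> (inv \<theta> c) (w c) = v (inv \<theta> c)" by metis
    have "v c = \<psi> c (w (\<theta> c))" for c using w [of "\<theta> c"] th by (simp add: bij_def)
    then show ?thesis by blast
  qed
  show ?thesis
    unfolding latin_rel_def ex1_alt
  proof (intro allI conjI impI)
    fix c p q
    obtain p' q' where pq: "\<psi> c p' = p" "\<psi> (c + 1) q' = q" using surj by blast
    obtain w where "w \<in> S" "w (\<theta> c) = p'" "w (\<theta> (c + 1)) = q'" using latin_any(1) [OF lat thn] by blast
    then show "\<exists>v. v \<in> R \<and> v c = p \<and> v (c + 1) = q"
      using RR [of w] pq by (intro exI [of _ "\<lambda>c. \<psi> c (w (\<theta> c))"]) simp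
    fix x y assume x: "x \<in> R \<and> x c = p \<and> x (c + 1) = q" and y: "y \<in> R \<and> y c = p \<and> y (c + 1) = q"
    obtain x' where x': "x = (\<lambda>c. \<psi> c (x' (\<theta> c)))" using pre [of x] by (elim exE)
    obtain y' where y': "y = (\<lambda>c. \<psi> c (y' (\<theta> c)))" using pre [of y] by (elim exE)
    have m: "x' \<in> S" "y' \<in> S" using x y unfolding RR x' y' by blast+
    have e: "x c = y c" "x (c + 1) = y (c + 1)" using x y by simp_all
    have "x' (\<theta> c) = y' (\<theta> c)" "x' (\<theta> (c + 1)) = y' (\<theta> (c + 1))" using e by (simp_all add: x' y' inj)
    then have "x' = y'" by (rule latin_any(2) [OF lat thn m])
    then show "x = y" by (simp add: x' y')
  qed
qed

lemma ds_equiv_ds_rel: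
  assumes "ds_equiv R S" and ds: "ds_rel S" shows "ds_rel R"
proof -
  have lat: "latin_rel R" using ds_equiv_latin [OF assms(1)] ds by (simp add: ds_rel_def)
  from ds_equiv_sym [OF assms(1)] obtain \<theta> \<psi> where th: "bij \<theta>" and bm: "\<And>c. block_map (\<psi> c)"
     and RR: "\<And>v. v \<in> S \<longleftrightarrow> (\<lambda>c. \<psi> c (v (\<theta> c))) \<in> R"
    unfolding ds_equiv_def by blast
  have bj: "\<And>c. bij (\<psi> c)" using bm by (simp add: block_map_def)
  have "tri_partition_rel S (\<lambda>_. fibres)" using ds by (simp add: tri_partition_rel_def ds_rel_def sudoku_partition_fibres)
  from tri_partition_rel_transfer [OF th bj RR this]
  have t: "tri_partition_rel R (\<lambda>c. (`) (\<psi> c) ` fibres)" .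
  have im: "(`) (\<psi> c) ` fibres = fibres" for c
  proof -
    obtain m n V W where m: "m \<noteq> 0" "\<And>i. V i \<noteq> 0" "\<And>i a. \<psi> c (i, a) = (m * i + n, V i * a + W i)"
      by (rule block_map_affine [OF bm [of c]], rule that)
    have im: "\<psi> c ` ({i} \<times> UNIV) = {m * i + n} \<times> UNIV" for i
    proof -
      have f: "{i} \<times> (UNIV :: z3 set) = range (Pair i)" for i by auto
      have "\<psi> c ` ({i} \<times> UNIV) = Pair (m * i + n) ` range (\<lambda>a. V i * a + W i)" unfolding f by (simp only: image_image m(3))
      also have "range (\<lambda>a. V i * a + W i) = UNIV" by (rule bij_is_surj [OF bij_affine [OF m(2)]])
      finally show ?thesis unfolding f .
    qed
    have "(`) (\<psi> c) ` fibres = (\<lambda>i. {i} \<times> UNIV) ` range (\<lambda>i. m * i + n)"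
      unfolding fibres_def by (simp only: image_image im)
    also have "range (\<lambda>i. m * i + n) = UNIV" by (rule bij_is_surj [OF bij_affine [OF m(1)]])
    finally show ?thesis unfolding fibres_def .
  qed
  show ?thesis using t lat unfolding im by (simp add: tri_partition_rel_def ds_rel_def)
qed

lemma identified_class:
  assumes i: "identified L s t0 t1 t2 g r" and r: "r \<in> set reps"
  shows "L \<in> rep_class r"
proof -
  have b: "balanced (decode s)" using i balanced_sig by (simp add: identified_def)
  obtain m0 n0 m1 n1 m2 n2 b' h e where g: "g = (b', h, e, (m0, n0), (m1, n1), (m2, n2))"
    by (rule proper.cases [of g], rule that)
  have cell: "L (enc p) (enc q) = enc (shifted t2 (third (decode s) 0 (shifted t0 p) (shifted t1 q)))" for p q
  proof -
    have "(p, q) \<in> set cells" unfolding cells_def in_concat in_map using points(3) by blast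
    then have "cell_agrees L s t0 t1 t2 (p, q)" using i unfolding identified_def all_list_iff by blast
    then show ?thesis by (simp add: z3_const)
  qed
  define \<psi> where "\<psi> c = (\<lambda>(i, a). (1 * i + 0 :: z3, 1 * a + (if c = 0 then app t0 i else if c = 1 then app t1 i else - app t2 i)))" for c :: z3
  have bm: "block_map (\<psi> c)" for c unfolding \<psi>_def by (rule affine_block_map) simp_all
  have p01: "\<psi> 0 p = shifted t0 p" "\<psi> 1 p = shifted t1 p" for p
    by (simp_all add: \<psi>_def shifted_def case_prod_beta)
  have p2: "shifted t2 x = y \<longleftrightarrow> x = \<psi> (-1) y" for x y
    by (cases x; cases y) (auto simp: \<psi>_def shifted_def eq_diff_eq)
  have "v \<in> rel_of L \<longleftrightarrow> (\<lambda>c. \<psi> c (v c)) \<in> model (decode s)" for v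
    unfolding model_mem [OF b] rel_of_def mem_Collect_eq cell enc_eq p2 by (simp add: p01)
  then have "ds_equiv (rel_of L) (model (decode s))"
    unfolding ds_equiv_def using bm by (intro exI [of _ id] exI [of _ \<psi>]) simp
  moreover have "ds_equiv (model (decode s)) (model (decode r))"
  proof -
    have sig: "signature (model (decode s)) (decode s)" using presents_model [OF b] unfolding signature_def by blast
    have "e \<noteq> 0" and "app (Tri m0 m1 m2) c \<noteq> 0" for c
      using i unfolding identified_def g by (simp_all add: z3_const) (cases c; simp)
    then obtain R' where R': "ds_equiv (model (decode s)) R'" "signature R' (act b' h e (app (Tri m0 m1 m2)) (app (Tri n0 n1 n2)) (decode s))"
      by (rule signature_act [OF sig])
    have "agrees_at (move_act g (decode s)) (decode r) (c, i, j)" for c i j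
      using i set_positions [of "(c, i, j)"] unfolding identified_def all_list_iff by blast
    then have "move_act g (decode s) = decode r" by (intro ext) simp
    then have "signature R' (decode r)" using R'(2) by (simp add: g)
    from signature_determines [OF this model_signature [OF r]] R'(1) show ?thesis by (rule ds_equiv_trans [rotated])
  qed
  ultimately have e: "ds_equiv (rel_of L) (model (decode r))" by (rule ds_equiv_trans)
  have "ds_rel (model (decode r))" using presents_ds [OF presents_model [OF balanced_rep [OF r]]] .
  from ds_equiv_ds_rel [OF e this] have "standard_division_sudoku L" by (simp add: standard_rel)
  with e show ?thesis by (simp add: rep_class_def)
qed

lemma main_ds_class_rep:
  assumes "L \<in> rep_class r" shows "main_ds_class L = rep_class r"
proof -
  have L: "standard_division_sudoku L" "ds_equiv (rel_of L) (model (decode r))" using assms by (simp_all add: rep_class_def)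
  have "(L, L') \<in> main_ds_rel \<longleftrightarrow> L' \<in> rep_class r" for L'
    unfolding main_ds_rel_iff rep_class_def mem_Collect_eq
    using L ds_equiv_trans [OF ds_equiv_sym] ds_equiv_trans [OF _ ds_equiv_sym] by blast
  then show ?thesis by (auto simp: main_ds_class_def)
qed

lemma rep_class_nonempty:
  assumes "r \<in> set reps" obtains L where "L \<in> rep_class r"
proof -
  have ds: "ds_rel (model (decode r))" using presents_ds [OF presents_model [OF balanced_rep [OF assms]]] .
  then obtain L where L: "rel_of L = model (decode r)" using rel_of_surj by (metis ds_rel_def)
  then have "L \<in> rep_class r" using ds ds_equiv_refl by (simp add: rep_class_def standard_rel)
  then show thesis by (rule that)
qed

lemma standard_in_rep_class:
  assumes "standard_division_sudoku L" obtains r where "r \<in> set reps" "L \<in> rep_class r"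
proof -
  obtain E where E: "signature (rel_of L) E" using ds_rel_signature assms by (auto simp: standard_rel)
  obtain r R' where r: "r \<in> set reps" "ds_equiv (rel_of L) R'" "signature R' (decode r)" using signature_rep [OF E] by blast
  have "ds_equiv (rel_of L) (model (decode r))"
    by (rule ds_equiv_trans [OF r(2) signature_determines [OF r(3) model_signature [OF r(1)]]])
  then have "L \<in> rep_class r" using assms by (simp add: rep_class_def)
  with r(1) show thesis by (rule that)
qed

lemma main_ds_classes_reps: "main_ds_classes = rep_class ` set reps"
proof (intro equalityI subsetI)
  fix K assume "K \<in> main_ds_classes"
  then obtain L where L: "standard_division_sudoku L" "K = main_ds_class L"
    unfolding main_ds_classes_def quotient_def main_ds_class_def by auto
  obtain r where r: "r \<in> set reps" "L \<in> rep_class r" by (rule standard_in_rep_class [OF L(1)])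
  then show "K \<in> rep_class ` set reps" using L(2) main_ds_class_rep by blast
next
  fix K assume "K \<in> rep_class ` set reps"
  then obtain r where r: "r \<in> set reps" "K = rep_class r" by blast
  obtain L where L: "L \<in> rep_class r" by (rule rep_class_nonempty [OF r(1)])
  then have "K = main_ds_rel `` {L}" "standard_division_sudoku L"
    using main_ds_class_rep [OF L] r(2) by (simp_all add: main_ds_class_def rep_class_def)
  then show "K \<in> main_ds_classes" unfolding main_ds_classes_def quotient_def by auto
qed

lemma rep_class_inj: "inj_on rep_class (set reps)"
proof (rule inj_onI)
  fix r s assume r: "r \<in> set reps" and s: "s \<in> set reps" and e: "rep_class r = rep_class s"
  obtain L where L: "L \<in> rep_class r" by (rule rep_class_nonempty [OF r])
  then have "ds_equiv (rel_of L) (model (decode r))" "ds_equiv (rel_of L) (model (decode s))"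
    using e by (auto simp: rep_class_def)
  then have "ds_equiv (model (decode r)) (model (decode s))" by (blast intro: ds_equiv_trans ds_equiv_sym)
  then show "r = s" by (rule rep_unique [OF r model_signature [OF r] s model_signature [OF s]])
qed

lemma rep_class_count:
  assumes "r \<in> set reps" "L \<in> rep_class r" shows "tri_partition_count L = tri_count r"
proof -
  have L: "standard_division_sudoku L" "ds_equiv (rel_of L) (model (decode r))" using assms(2) by (simp_all add: rep_class_def)
  have "latin_rel (rel_of L)" using L(1) by (simp add: standard_rel ds_rel_def)
  then show ?thesis
    using tri_partition_count_rel card_tri_partition_rel_equiv [OF L(2)] card_tri_partitions [OF balanced_rep [OF assms(1)]]
    by (simp add: tri_count_def)
qed

lemma distinct_reps: "distinct reps" "length reps = 45"
  by code_simp+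

lemma tri_counts0: "map tri_count reps0 = [24, 4, 1, 2, 1, 9, 2, 1]"
  by code_simp

lemma tri_counts1: "map tri_count reps1 = [1, 1, 1, 1, 1, 1, 1, 1]"
  by code_simp

lemma tri_counts2: "map tri_count reps2 = [1, 1, 1, 1, 1, 1, 1, 1, 1, 1, 1, 1, 1, 1, 1]"
  by code_simp

lemma tri_counts3: "map tri_count reps3 = [1, 1, 1, 1, 1, 1, 1, 1, 1, 1, 1, 1, 4, 3]"
  by code_simp

lemmas counts = tri_counts0 tri_counts1 tri_counts2 tri_counts3

text \<open>The seven named squares need no reversal of blocks. Their signatures and translations can be
  read off the tables, and the moves lead to the least signatures in the orbits.\<close>
lemma identified_2: "identified DS9_2 (Mat Z1 Z1 Z1 Z1 Z1 Z1 Z1 Z1 Z1, Mat Z1 Z1 Z1 Z2 Z2 Z2 Z1 Z1 Z1, Mat Z2 Z1 Z1 Z2 Z1 Z1 Z2 Z1 Z1) (Tri Z0 Z1 Z2) (Tri Z0 Z1 Z2) (Tri Z0 Z2 Z1) (False, Z0, Z1, (Z1, Z2), (Z1, Z1), (Z1, Z0)) rep2"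
  by code_simp

lemma identified_17: "identified DS9_17 (Mat Z1 Z1 Z1 Z1 Z1 Z1 Z1 Z1 Z1, Mat Z1 Z1 Z1 Z1 Z1 Z1 Z1 Z1 Z1, Mat Z2 Z2 Z2 Z2 Z2 Z2 Z2 Z2 Z2) (Tri Z0 Z1 Z2) (Tri Z0 Z1 Z2) (Tri Z0 Z2 Z1) (False, Z0, Z1, (Z1, Z0), (Z2, Z0), (Z1, Z0)) rep17"
  by code_simp

lemma identified_18: "identified DS9_18 (Mat Z1 Z1 Z1 Z1 Z1 Z1 Z1 Z1 Z1, Mat Z1 Z1 Z1 Z1 Z1 Z1 Z1 Z1 Z1, Mat Z2 Z2 Z1 Z2 Z2 Z1 Z2 Z2 Z1) (Tri Z0 Z1 Z2) (Tri Z0 Z1 Z2) (Tri Z0 Z2 Z1) (True, Z2, Z1, (Z2, Z0), (Z1, Z0), (Z2, Z1)) rep18"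
  by code_simp

lemma identified_20: "identified DS9_20 (Mat Z1 Z1 Z1 Z1 Z1 Z1 Z2 Z2 Z2, Mat Z1 Z1 Z1 Z1 Z1 Z1 Z1 Z1 Z1, Mat Z2 Z2 Z1 Z2 Z2 Z1 Z2 Z2 Z1) (Tri Z0 Z1 Z2) (Tri Z0 Z1 Z2) (Tri Z0 Z2 Z1) (False, Z1, Z1, (Z2, Z0), (Z1, Z0), (Z1, Z0)) rep20"
  by code_simp

lemma identified_27: "identified DS9_27 (Mat Z1 Z1 Z1 Z1 Z1 Z1 Z2 Z2 Z2, Mat Z1 Z1 Z1 Z1 Z1 Z1 Z1 Z1 Z1, Mat Z2 Z1 Z2 Z2 Z1 Z2 Z2 Z1 Z2) (Tri Z0 Z1 Z2) (Tri Z0 Z1 Z2) (Tri Z0 Z2 Z1) (False, Z1, Z2, (Z1, Z0), (Z2, Z0), (Z2, Z0)) rep27"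
  by code_simp

lemma identified_175: "identified DS9_175 (Mat Z1 Z1 Z2 Z1 Z2 Z1 Z2 Z1 Z1, Mat Z1 Z1 Z2 Z1 Z2 Z1 Z2 Z1 Z1, Mat Z2 Z1 Z2 Z2 Z2 Z1 Z1 Z2 Z2) (Tri Z0 Z1 Z2) (Tri Z0 Z1 Z2) (Tri Z0 Z2 Z1) (False, Z0, Z1, (Z1, Z0), (Z1, Z0), (Z1, Z0)) rep175"
  by code_simp

lemma identified_179: "identified DS9_179 (Mat Z1 Z1 Z2 Z1 Z2 Z1 Z2 Z1 Z1, Mat Z1 Z2 Z1 Z2 Z1 Z1 Z1 Z1 Z2, Mat Z2 Z1 Z2 Z2 Z2 Z1 Z1 Z2 Z2) (Tri Z0 Z1 Z2) (Tri Z0 Z1 Z2) (Tri Z0 Z2 Z1) (False, Z0, Z1, (Z1, Z0), (Z1, Z0), (Z1, Z1)) rep179"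
  by code_simp

definition multiple_reps :: "sig list" where
  "multiple_reps = [rep2, rep17, rep18, rep20, rep27, rep175, rep179]"

lemma multiple_reps_in_reps: "set multiple_reps \<subseteq> set reps"
  by (simp add: multiple_reps_def reps_def reps0_def reps3_def)

lemma named_counts: "tri_count rep2 = 2" "tri_count rep17 = 24" "tri_count rep18 = 4" "tri_count rep20 = 9" "tri_count rep27 = 2"
    "tri_count rep175 = 3" "tri_count rep179 = 4"
  using counts(1,4) by (simp_all add: reps0_def reps3_def)

lemma count_gt_1: "{r \<in> set reps. 1 < tri_count r} = set multiple_reps"
proof (intro equalityI subsetI)
  fix r assume "r \<in> {r \<in> set reps. 1 < tri_count r}"
  then have r: "r \<in> set reps0 \<union> set reps1 \<union> set reps2 \<union> set reps3" "1 < tri_count r" by (auto simp: reps_def)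
  have one: "tri_count x = 1" if "x \<in> set xs" "map tri_count xs = replicate n 1" for x xs n
    using that by (metis in_set_conv_nth length_map nth_map nth_replicate length_replicate)
  have "r \<in> set reps0 \<union> set reps3"
    using one [of r reps1 8] one [of r reps2 15] counts(2,3) r by (auto simp: numeral_eq_Suc)
  then show "r \<in> set multiple_reps"
    using r(2) counts(1,4) by (auto simp: reps0_def reps3_def multiple_reps_def)
next
  fix r assume r: "r \<in> set multiple_reps"
  then have "1 < tri_count r" using named_counts by (auto simp: multiple_reps_def)
  then show "r \<in> {r \<in> set reps. 1 < tri_count r}" using r multiple_reps_in_reps by auto
qed

theorem proposition5p3:
  shows "card main_ds_classes = 45 \<and>
    {K \<in> main_ds_classes. \<forall>L\<in>K. tri_partition_count L > 1} =
      main_ds_class ` {DS9_2, DS9_17, DS9_18, DS9_20, DS9_27, DS9_175, DS9_179} \<and>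
    {K \<in> main_ds_classes. \<exists>L\<in>K. tri_partition_count L > 1} =
      main_ds_class ` {DS9_2, DS9_17, DS9_18, DS9_20, DS9_27, DS9_175, DS9_179} \<and>
    card (main_ds_class ` {DS9_2, DS9_17, DS9_18, DS9_20, DS9_27, DS9_175, DS9_179}) = 7 \<and>
    tri_partition_count DS9_2 = 2 \<and>
    tri_partition_count DS9_17 = 24 \<and>
    tri_partition_count DS9_18 = 4 \<and>
    tri_partition_count DS9_20 = 9 \<and>
    tri_partition_count DS9_27 = 2 \<and>
    tri_partition_count DS9_175 = 3 \<and>
    tri_partition_count DS9_179 = 4"
proof -
  have mem: "rep2 \<in> set reps" "rep17 \<in> set reps" "rep18 \<in> set reps" "rep20 \<in> set reps" "rep27 \<in> set reps"
      "rep175 \<in> set reps" "rep179 \<in> set reps"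
    using multiple_reps_in_reps by (simp_all add: multiple_reps_def)
  note cl = identified_class [OF identified_2 mem(1)] identified_class [OF identified_17 mem(2)]
    identified_class [OF identified_18 mem(3)] identified_class [OF identified_20 mem(4)]
    identified_class [OF identified_27 mem(5)] identified_class [OF identified_175 mem(6)]
    identified_class [OF identified_179 mem(7)]
  have cls: "main_ds_class ` {DS9_2, DS9_17, DS9_18, DS9_20, DS9_27, DS9_175, DS9_179} = rep_class ` set multiple_reps"
    by (simp add: multiple_reps_def main_ds_class_rep [OF cl(1)] main_ds_class_rep [OF cl(2)] main_ds_class_rep [OF cl(3)]
      main_ds_class_rep [OF cl(4)] main_ds_class_rep [OF cl(5)] main_ds_class_rep [OF cl(6)] main_ds_class_rep [OF cl(7)])
  have "card main_ds_classes = 45"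
    unfolding main_ds_classes_reps card_image [OF rep_class_inj] using distinct_card [OF distinct_reps(1)] distinct_reps(2) by simp
  moreover have "{K \<in> main_ds_classes. \<forall>L\<in>K. tri_partition_count L > 1} = rep_class ` set multiple_reps"
    and "{K \<in> main_ds_classes. \<exists>L\<in>K. tri_partition_count L > 1} = rep_class ` set multiple_reps"
  proof -
    have "(\<forall>L\<in>rep_class r. tri_partition_count L > 1) \<longleftrightarrow> 1 < tri_count r"
      "(\<exists>L\<in>rep_class r. tri_partition_count L > 1) \<longleftrightarrow> 1 < tri_count r" if r: "r \<in> set reps" for r
    proof -
      obtain L where "L \<in> rep_class r" by (rule rep_class_nonempty [OF r])
      then show "(\<forall>L\<in>rep_class r. tri_partition_count L > 1) \<longleftrightarrow> 1 < tri_count r"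
        "(\<exists>L\<in>rep_class r. tri_partition_count L > 1) \<longleftrightarrow> 1 < tri_count r" using rep_class_count [OF r] by auto
    qed
    then have "{r \<in> set reps. \<forall>L\<in>rep_class r. tri_partition_count L > 1} = set multiple_reps"
      "{r \<in> set reps. \<exists>L\<in>rep_class r. tri_partition_count L > 1} = set multiple_reps"
      unfolding count_gt_1 [symmetric] by blast+
    moreover have "{K \<in> rep_class ` S. \<Phi> K} = rep_class ` {r \<in> S. \<Phi> (rep_class r)}" for S \<Phi> by blast
    ultimately show "{K \<in> main_ds_classes. \<forall>L\<in>K. tri_partition_count L > 1} = rep_class ` set multiple_reps"
      "{K \<in> main_ds_classes. \<exists>L\<in>K. tri_partition_count L > 1} = rep_class ` set multiple_reps"
      unfolding main_ds_classes_reps by simp_all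
  qed
  moreover have "card (rep_class ` set multiple_reps) = 7"
  proof -
    have "distinct multiple_reps" by code_simp
    then have "card (set multiple_reps) = 7" using distinct_card [of multiple_reps] by (simp add: multiple_reps_def)
    then show ?thesis using card_image [OF inj_on_subset [OF rep_class_inj multiple_reps_in_reps]] by simp
  qed
  moreover note rep_class_count [OF mem(1) cl(1)] rep_class_count [OF mem(2) cl(2)] rep_class_count [OF mem(3) cl(3)]
    rep_class_count [OF mem(4) cl(4)] rep_class_count [OF mem(5) cl(5)] rep_class_count [OF mem(6) cl(6)]
    rep_class_count [OF mem(7) cl(7)]
  ultimately show ?thesis unfolding cls named_counts by blast
qed

end
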